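(* Let $\nu$ be a skew Young diagram and $\boldsymbol{\gamma}\in T(\nu,\mathbb{N})$. Let $S$ denote the antipode of the Hopf algebra $\mathrm{Qsym}$ of quasi-symmetric functions. Then $$S(S_\nu(\boldsymbol{\gamma}))=(-1)^{|\nu|}S_{\nu^{\#}}(\boldsymbol{\gamma}^{\#}).$$ Moreover, when $\boldsymbol{\gamma}\in T^{\mathrm{diag}}(\nu,\mathbb{N})$, writing $\nu^\#=\kappa/\tau$ with $\kappa,\tau$ partitions having (after allowing zero parts) $r$ rows and $s$ columns, we have $$S(S_\nu(\boldsymbol{\gamma}))=(-1)^{|\nu|}\sum_{\Theta=(\theta_1,\ldots,\theta_r)\in\mathrm{Rim}^{\nu^\#}_H}\varepsilon_H(\Theta)\,E_{\theta_1(\boldsymbol{\gamma}^\#)}E_{\theta_2(\boldsymbol{\gamma}^\#)}\cdots E_{\theta_r(\boldsymbol{\gamma}^\#)},$$ $$S(S_\nu(\boldsymbol{\gamma}))=(-1)^{|\nu|}\sum_{\Theta=(\theta_1,\ldots,\theta_s)\in\mathrm{Rim}^{\nu^\#}_E}\varepsilon_E(\Theta)\,M_{\theta_1(\boldsymbol{\gamma}^\#)}M_{\theta_2(\boldsymbol{\gamma}^\#)}\cdots M_{\theta_s(\boldsymbol{\gamma}^\#)}.$$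
   Context: Quasi-symmetric functions: for a composition $(\gamma_1,\ldots,\gamma_n)$ of positive integers, $M_{(\gamma_1,\ldots,\gamma_n)}=\sum_{m_1<\cdots<m_n}t_{m_1}^{\gamma_1}\cdots t_{m_n}^{\gamma_n}$ and $E_{(\gamma_1,\ldots,\gamma_n)}=\sum_{m_1\le\cdots\le m_n}t_{m_1}^{\gamma_1}\cdots t_{m_n}^{\gamma_n}$ (with value $1$ for the empty composition). $\mathrm{Qsym}$ is the algebra of quasi-symmetric functions over $\mathbb{Z}$, with $\mathbb{Z}$-basis the $M_{\boldsymbol\gamma}$; it is a commutative Hopf algebra with coproduct $\Delta M_{(\gamma_1,\ldots,\gamma_n)}=\sum_{k=0}^nM_{(\gamma_1,\ldots,\gamma_k)}\otimes M_{(\gamma_{k+1},\ldots,\gamma_n)}$, and its antipode $S$ is the $\mathbb{Z}$-linear map given explicitly by $S(M_{(\gamma_1,\ldots,\gamma_n)})=(-1)^nE_{(\gamma_n,\ldots,\gamma_1)}$ (a known result of Hoffman). Skew diagrams: for partitions $\mu\subset\lambda$, $\nu=\lambda/\mu$ has diagram $D(\nu)=D(\lambda)\setminus D(\mu)$ with $D(\lambda)=\{(i,j):1\le j\le\lambda_i\}$; $|\nu|=\#D(\nu)$. $T(\nu,\mathbb{N})$ is the set of fillings of $D(\nu)$ by positive integers, $T^{\mathrm{diag}}(\nu,\mathbb{N})$ the subset with $t_{ij}=t_{kl}$ whenever $j-i=l-k$, $\mathrm{SSYT}(\nu)$ the subset of semi-standard ones (rows weakly increasing, columns strictly increasing). The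 Schur type quasi-symmetric function is $S_\nu(\boldsymbol{\gamma})=\sum_{(m_{ij})\in\mathrm{SSYT}(\nu)}\prod_{(i,j)\in D(\nu)}t_{m_{ij}}^{\gamma_{ij}}$. Anti-diagonal transpose: if $\nu$ is contained in the rectangle with $R$ rows and $C$ columns, $\nu^\#$ is the skew diagram that is the image of $\nu$ under $(i,j)\mapsto(C+1-j,\,R+1-i)$, and $\boldsymbol{\gamma}^\#\in T(\nu^\#,\mathbb{N})$ has in box $(C+1-j,R+1-i)$ the entry $\gamma_{ij}$ (the choice of rectangle only translates the result). Rim decompositions of $\kappa/\tau$, where $\kappa=(\kappa_1,\ldots,\kappa_r)$, $\tau=(\tau_1,\ldots,\tau_r)$, $\kappa_1\le s$, with conjugates $\kappa'=(\kappa'_1,\ldots,\kappa'_s)$, $\tau'=(\tau'_1,\ldots,\tau'_s)$ (zero parts allowed). A ribbon is a connected skew diagram containing no $2\times2$ block of boxes. An $H$-rim decomposition of $\kappa/\tau$ is a sequence $\Theta=(\theta_1,\ldots,\theta_r)$ such that each $\theta_i$ is either empty or a ribbon in $D(\kappa/\tau)$ whose bottom-left end box is the leftmost box $(i,\tau_i+1)$ of row $i$, the $\theta_i$ are disjoint, $D(\tau)\sqcup\theta_1\sqcup\cdots\sqcup\theta_k$ is the diagram of a partition for every $1\le k\le r$, and for $k=r$ it equals $D(\kappa)$. Its sign $\varepsilon_H(\Theta)$ is the signature of the unique $\sigma\in S_r$ with $|\theta_i|=\kappa_{\sigma(i)}-\sigma(i)-\tau_i+i$ for all $i$. For such $\Theta$,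 $\theta_i(\boldsymbol{\gamma}^\#)$ is the composition obtained by reading the entries of $\boldsymbol{\gamma}^\#$ in $\theta_i$ from bottom left to top right. An $E$-rim decomposition is a sequence $\Theta=(\theta_1,\ldots,\theta_s)$ with the same properties except that each non-empty $\theta_i$ has as its top-right end box the topmost box $(\tau'_i+1,i)$ of column $i$ (and $k$ runs over $1\le k\le s$); $\varepsilon_E(\Theta)$ is the signature of the unique $\sigma\in S_s$ with $|\theta_i|=\kappa'_{\sigma(i)}-\sigma(i)-\tau'_i+i$ for all $i$, and $\theta_i(\boldsymbol{\gamma}^\#)$ is read from top right to bottom left. $\mathrm{Rim}^{\kappa/\tau}_H$ and $\mathrm{Rim}^{\kappa/\tau}_E$ denote the sets of $H$- and $E$-rim decompositions. *)

theory Defs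
  imports
    "HOL-Library.Poly_Mapping"
    "HOL-Library.FuncSet"
    "HOL-Combinatorics.Permutations"
begin

section \<open>Formal power series in infinitely many variables over the integers\<close>

text \<open>
  A monomial is given by its exponent vector, a finitely supported function sending the index
  \<open>m\<close> of the variable \<open>t\<^sub>m\<close> to its exponent. A series assigns an arbitrary integer
  coefficient to every monomial. The variables in use are \<open>t\<^sub>1, t\<^sub>2, \<dots>\<close>; none of the
  series below involves \<open>t\<^sub>0\<close>.
\<close>

type_synonym mono = "nat \<Rightarrow>\<^sub>0 nat"

typedef series = "UNIV :: (mono \<Rightarrow> int) set"
  morphisms coeff Series ..

lemma coeff_Series [simp]: "coeff (Series f) = f"
  by (simp add: Series_inverse)

lemma series_eqI: "(\<And>m. coeff f m = coeff g m) \<Longrightarrow> f = g"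
  by (metis coeff_inject ext)

lemma finite_mono_splits: "finite {(a, b). a + b = (m :: mono)}"
proof -
  let ?L = "\<lambda>a :: mono. restrict (Poly_Mapping.lookup a) (Poly_Mapping.keys m)"
  let ?A = "{a. \<exists>b. a + b = m}"
  have le: "Poly_Mapping.lookup a x \<le> Poly_Mapping.lookup m x" if "a \<in> ?A" for a x
    using that by (auto simp: lookup_add)
  have "?L ` ?A \<subseteq> Poly_Mapping.keys m \<rightarrow>\<^sub>E {..Max (range (Poly_Mapping.lookup m))}"
  proof
    fix f assume "f \<in> ?L ` ?A"
    then obtain a where a: "a \<in> ?A" "f = ?L a" by blast
    have "finite (range (Poly_Mapping.lookup m))"
      by (rule finite_subset[of _ "insert 0 (Poly_Mapping.lookup m ` Poly_Mapping.keys m)"])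
         (auto simp: in_keys_iff)
    then have "Poly_Mapping.lookup a x \<le> Max (range (Poly_Mapping.lookup m))" for x
      using le[OF a(1), of x] by (meson Max_ge dual_order.trans rangeI)
    then show "f \<in> Poly_Mapping.keys m \<rightarrow>\<^sub>E {..Max (range (Poly_Mapping.lookup m))}"
      using a(2) by auto
  qed
  then have "finite (?L ` ?A)"
    by (rule finite_subset) (auto intro: finite_PiE)
  moreover have "inj_on ?L ?A"
  proof (rule inj_onI)
    fix a b assume a: "a \<in> ?A" and b: "b \<in> ?A" and eq: "?L a = ?L b"
    show "a = b"
    proof (rule poly_mapping_eqI)
      fix x show "Poly_Mapping.lookup a x = Poly_Mapping.lookup b x"
      proof (cases "x \<in> Poly_Mapping.keys m")
        case True
        then show ?thesis using fun_cong[OF eq, of x] by simp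
      next
        case False
        then show ?thesis using le[OF a, of x] le[OF b, of x] by (simp add: in_keys_iff)
      qed
    qed
  qed
  ultimately have fin: "finite ?A" by (rule finite_imageD)
  have "{(a, b). a + b = m} \<subseteq> ?A \<times> ?A"
    by (auto simp: add.commute) (metis add.commute)
  then show ?thesis using fin by (meson finite_SigmaI finite_subset)
qed

instantiation series :: comm_ring_1
begin

definition "0 = Series (\<lambda>_. 0)"
definition "1 = Series (\<lambda>m. if m = 0 then 1 else 0)"
definition "f + g = Series (\<lambda>m. coeff f m + coeff g m)"
definition "f - g = Series (\<lambda>m. coeff f m - coeff g m)"
definition "- f = Series (\<lambda>m. - coeff f m)"
definition "f * g = Series (\<lambda>m. \<Sum>(a, b) \<in> {(a, b). a + b = m}. coeff f a * coeff g b)"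

instance
proof
  fix f g h :: series
  note defs = zero_series_def one_series_def plus_series_def minus_series_def
    uminus_series_def times_series_def
  show "f + g + h = f + (g + h)" "f + g = g + f" "0 + f = f" "- f + f = 0" "f - g = f + - g"
    by (auto intro!: series_eqI simp: defs)
  show "(0 :: series) \<noteq> 1"
    by (metis (mono_tags) coeff_Series one_series_def zero_neq_one zero_series_def)
  show "(f + g) * h = f * h + g * h"
    by (auto intro!: series_eqI simp: defs case_prod_unfold algebra_simps sum.distrib)
  show comm: "f * g = g * f" for f g :: series
  proof (rule series_eqI)
    fix m
    show "coeff (f * g) m = coeff (g * f) m"
      unfolding times_series_def coeff_Series
      by (rule sum.reindex_bij_witness[of _ prod.swap prod.swap])
         (auto simp: add.commute mult.commute)
  qed
  show "1 * f = f"
  proof (rule series_eqI)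
    fix m
    have "coeff (1 * f) m = (\<Sum>(a, b) \<in> {(0, m)}. coeff 1 a * coeff f b)"
      unfolding times_series_def coeff_Series
      by (rule sum.mono_neutral_right) (auto simp: finite_mono_splits one_series_def split: if_splits)
    then show "coeff (1 * f) m = coeff f m" by (simp add: one_series_def)
  qed
  have L: "coeff (f * g * h) m =
      (\<Sum>(a, b, c) \<in> {(a, b, c). a + b + c = m}. coeff f a * coeff g b * coeff h c)"
    for f g h m
  proof -
    have "coeff (f * g * h) m = (\<Sum>p \<in> {(a, b). a + b = m}. \<Sum>q \<in> {(a, b). a + b = fst p}.
        coeff f (fst q) * coeff g (snd q) * coeff h (snd p))"
      by (simp add: times_series_def sum_distrib_right case_prod_unfold)
    also have "\<dots> = (\<Sum>(p, q) \<in> Sigma {(a, b). a + b = m} (\<lambda>p. {(a, b). a + b = fst p}).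
        coeff f (fst q) * coeff g (snd q) * coeff h (snd p))"
      by (rule sum.Sigma) (auto simp: finite_mono_splits)
    also have "\<dots> =
        (\<Sum>(a, b, c) \<in> {(a, b, c). a + b + c = m}. coeff f a * coeff g b * coeff h c)"
      by (rule sum.reindex_bij_witness[of _ "\<lambda>(a, b, c). ((a + b, c), (a, b))"
            "\<lambda>(p, q). (fst q, snd q, snd p)"]) auto
    finally show ?thesis .
  qed
  show "f * g * h = f * (g * h)"
  proof (rule series_eqI)
    fix m
    have "coeff (f * (g * h)) m = coeff (g * h * f) m" by (simp only: comm)
    also have "\<dots> = coeff (f * g * h) m"
      unfolding L
      by (rule sum.reindex_bij_witness[of _ "\<lambda>(a, b, c). (b, c, a)" "\<lambda>(a, b, c). (c, a, b)"])
         (auto simp: ac_simps)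
    finally show "coeff (f * g * h) m = coeff (f * (g * h)) m" ..
  qed
qed

end

text \<open>
  The formal sum of the monomials with exponents \<open>e i\<close> for \<open>i \<in> I\<close>. It is only meaningful if
  each monomial occurs finitely often. In all uses below \<open>i\<close> attaches positive exponents to
  finitely many variables, each of which therefore occurs in \<open>e i\<close>, so this holds.
\<close>

definition monomial_sum :: "'i set \<Rightarrow> ('i \<Rightarrow> mono) \<Rightarrow> series" where
  "monomial_sum I e = Series (\<lambda>m. int (card {i \<in> I. e i = m}))"


section \<open>Quasi-symmetric functions and the antipode\<close>

definition compositions :: "nat list set" where
  "compositions = {\<gamma>. \<forall>x \<in> set \<gamma>. 1 \<le> x}"

definition word_mono :: "nat list \<Rightarrow> nat list \<Rightarrow> mono" where
  "word_mono \<gamma> ms = (\<Sum>k < length \<gamma>. Poly_Mapping.single (ms ! k) (\<gamma> ! k))"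

definition M :: "nat list \<Rightarrow> series" where
  "M \<gamma> = monomial_sum
     {ms. length ms = length \<gamma> \<and> (\<forall>m \<in> set ms. 1 \<le> m) \<and> sorted_wrt (<) ms} (word_mono \<gamma>)"

definition E :: "nat list \<Rightarrow> series" where
  "E \<gamma> = monomial_sum
     {ms. length ms = length \<gamma> \<and> (\<forall>m \<in> set ms. 1 \<le> m) \<and> sorted_wrt (\<le>) ms} (word_mono \<gamma>)"

definition Qsym :: "series set" where
  "Qsym = {\<Sum>\<gamma> \<in> A. of_int (c \<gamma>) * M \<gamma> | A c. finite A \<and> A \<subseteq> compositions}"

text \<open>
  The antipode is the two-sided convolution inverse of the identity, i.e. the linear
  endomorphism of \<open>Qsym\<close> with
  \<open>mult \<circ> (S \<otimes> id) \<circ> \<Delta> = unit \<circ> counit = mult \<circ> (id \<otimes> S) \<circ> \<Delta>\<close>.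
  By linearity these equations are required on the basis \<open>M\<close>, where the coproduct is
  deconcatenation, \<open>\<Delta> (M \<gamma>) = (\<Sum>k \<le> length \<gamma>. M (take k \<gamma>) \<otimes> M (drop k \<gamma>))\<close>, and the counit
  sends \<open>M []\<close> to \<open>1\<close> and every other \<open>M \<gamma>\<close> to \<open>0\<close>. Additivity is the same as linearity over
  the integers. The extensional function space fixes the irrelevant values outside \<open>Qsym\<close>.
\<close>

definition is_antipode :: "(series \<Rightarrow> series) \<Rightarrow> bool" where
  "is_antipode S \<longleftrightarrow>
     S \<in> Qsym \<rightarrow>\<^sub>E Qsym \<and>
     (\<forall>f \<in> Qsym. \<forall>g \<in> Qsym. S (f + g) = S f + S g) \<and>
     (\<forall>\<gamma> \<in> compositions.
        (\<Sum>k \<le> length \<gamma>. S (M (take k \<gamma>)) * M (drop k \<gamma>)) = (if \<gamma> = [] then 1 else 0) \<and>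
        (\<Sum>k \<le> length \<gamma>. M (take k \<gamma>) * S (M (drop k \<gamma>))) = (if \<gamma> = [] then 1 else 0))"

definition antipode :: "series \<Rightarrow> series" where
  "antipode = (THE S. is_antipode S)"


section \<open>Skew diagrams and Schur type quasi-symmetric functions\<close>

text \<open>
  Partitions are weakly decreasing lists in which zero parts are allowed, so that the length of
  the list is the chosen number of rows. Parts are numbered from 1.
\<close>

type_synonym box = "nat \<times> nat"

definition is_partition :: "nat list \<Rightarrow> bool" where
  "is_partition lam \<longleftrightarrow> sorted_wrt (\<ge>) lam"

definition part :: "nat list \<Rightarrow> nat \<Rightarrow> nat" where
  "part lam i = (if 1 \<le> i \<and> i \<le> length lam then lam ! (i - 1) else 0)"

definition conj_part :: "nat list \<Rightarrow> nat \<Rightarrow> nat" where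
  "conj_part lam j = card {i \<in> {1..length lam}. j \<le> part lam i}"

definition diagram :: "nat list \<Rightarrow> box set" where
  "diagram lam = {(i, j). 1 \<le> i \<and> 1 \<le> j \<and> j \<le> part lam i}"

text \<open>A skew diagram is represented by its set of boxes, so \<open>\<bar>\<nu>\<bar>\<close> is \<open>card \<nu>\<close>.\<close>

definition skew_diagram :: "box set \<Rightarrow> bool" where
  "skew_diagram \<nu> \<longleftrightarrow>
     (\<exists>lam mu. is_partition lam \<and> is_partition mu \<and> diagram mu \<subseteq> diagram lam \<and>
       \<nu> = diagram lam - diagram mu)"

definition fillings :: "box set \<Rightarrow> (box \<Rightarrow> nat) set" where
  "fillings \<nu> = \<nu> \<rightarrow>\<^sub>E {1..}"

definition content :: "box \<Rightarrow> int" where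
  "content = (\<lambda>(i, j). int j - int i)"

definition diag_fillings :: "box set \<Rightarrow> (box \<Rightarrow> nat) set" where
  "diag_fillings \<nu> =
     {\<gamma> \<in> fillings \<nu>. \<forall>b \<in> \<nu>. \<forall>b' \<in> \<nu>. content b = content b' \<longrightarrow> \<gamma> b = \<gamma> b'}"

definition SSYT :: "box set \<Rightarrow> (box \<Rightarrow> nat) set" where
  "SSYT \<nu> = {m \<in> fillings \<nu>.
     (\<forall>i j j'. (i, j) \<in> \<nu> \<and> (i, j') \<in> \<nu> \<and> j < j' \<longrightarrow> m (i, j) \<le> m (i, j')) \<and>
     (\<forall>i i' j. (i, j) \<in> \<nu> \<and> (i', j) \<in> \<nu> \<and> i < i' \<longrightarrow> m (i, j) < m (i', j))}"

definition schur_qsym :: "box set \<Rightarrow> (box \<Rightarrow> nat) \<Rightarrow> series" where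
  "schur_qsym \<nu> \<gamma> =
     monomial_sum (SSYT \<nu>) (\<lambda>m. \<Sum>b \<in> \<nu>. Poly_Mapping.single (m b) (\<gamma> b))"

text \<open>
  Anti-diagonal transpose inside the rectangle with \<open>R\<close> rows and \<open>C\<close> columns. The map
  \<open>(a, b) \<mapsto> (R + 1 - b, C + 1 - a)\<close> used for fillings is the inverse of
  \<open>(i, j) \<mapsto> (C + 1 - j, R + 1 - i)\<close>.
\<close>

definition anti_transpose :: "nat \<Rightarrow> nat \<Rightarrow> box set \<Rightarrow> box set" where
  "anti_transpose R C \<nu> = (\<lambda>(i, j). (C + 1 - j, R + 1 - i)) ` \<nu>"

definition anti_filling :: "nat \<Rightarrow> nat \<Rightarrow> box set \<Rightarrow> (box \<Rightarrow> nat) \<Rightarrow> box \<Rightarrow> nat" where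
  "anti_filling R C \<nu> \<gamma> =
     (\<lambda>(a, b) \<in> anti_transpose R C \<nu>. \<gamma> (R + 1 - b, C + 1 - a))"


section \<open>Rim decompositions\<close>

definition adjacent :: "box \<Rightarrow> box \<Rightarrow> bool" where
  "adjacent = (\<lambda>(i, j) (k, l). i = k \<and> (l = j + 1 \<or> j = l + 1) \<or> j = l \<and> (k = i + 1 \<or> i = k + 1))"

definition box_connected :: "box set \<Rightarrow> bool" where
  "box_connected \<theta> \<longleftrightarrow>
     (\<forall>b \<in> \<theta>. \<forall>b' \<in> \<theta>. (b, b') \<in> {(x, y). x \<in> \<theta> \<and> y \<in> \<theta> \<and> adjacent x y}\<^sup>*)"

definition ribbon :: "box set \<Rightarrow> bool" where
  "ribbon \<theta> \<longleftrightarrow> skew_diagram \<theta> \<and> \<theta> \<noteq> {} \<and> box_connected \<theta> \<and>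
     \<not> (\<exists>i j. {(i, j), (i, j + 1), (i + 1, j), (i + 1, j + 1)} \<subseteq> \<theta>)"

definition bottom_left_end :: "box set \<Rightarrow> box \<Rightarrow> bool" where
  "bottom_left_end \<theta> b \<longleftrightarrow> b \<in> \<theta> \<and> (\<forall>(i, j) \<in> \<theta>. i \<le> fst b \<and> snd b \<le> j)"

definition top_right_end :: "box set \<Rightarrow> box \<Rightarrow> bool" where
  "top_right_end \<theta> b \<longleftrightarrow> b \<in> \<theta> \<and> (\<forall>(i, j) \<in> \<theta>. fst b \<le> i \<and> j \<le> snd b)"

text \<open>
  Along a ribbon the content increases by 1 from each box to the next, from bottom left to
  top right.
\<close>

definition read_up :: "(box \<Rightarrow> nat) \<Rightarrow> box set \<Rightarrow> nat list" where
  "read_up \<gamma> \<theta> = map \<gamma> (sorted_key_list_of_set content \<theta>)"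

definition read_down :: "(box \<Rightarrow> nat) \<Rightarrow> box set \<Rightarrow> nat list" where
  "read_down \<gamma> \<theta> = rev (read_up \<gamma> \<theta>)"

text \<open>
  \<open>rim_sequences P n \<kappa> \<tau>\<close> collects what the two kinds of rim decompositions have in common:
  sequences \<open>\<theta>\<^sub>1, \<dots>, \<theta>\<^sub>n\<close>, as functions on \<open>{1..n}\<close>, where \<open>P k \<theta>\<close> is the condition on the
  end box of a non-empty \<open>\<theta>\<^sub>k\<close>.
\<close>

definition rim_sequences ::
  "(nat \<Rightarrow> box set \<Rightarrow> bool) \<Rightarrow> nat \<Rightarrow> nat list \<Rightarrow> nat list \<Rightarrow> (nat \<Rightarrow> box set) set" where
  "rim_sequences P n \<kappa> \<tau> = {\<Theta> \<in> {1..n} \<rightarrow>\<^sub>E Pow (diagram \<kappa> - diagram \<tau>).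
     (\<forall>k \<in> {1..n}. \<Theta> k = {} \<or> ribbon (\<Theta> k) \<and> P k (\<Theta> k)) \<and>
     disjoint_family_on \<Theta> {1..n} \<and>
     (\<forall>k \<in> {1..n}. \<exists>\<rho>. is_partition \<rho> \<and> diagram \<tau> \<union> (\<Union>l \<in> {1..k}. \<Theta> l) = diagram \<rho>) \<and>
     diagram \<tau> \<union> (\<Union>l \<in> {1..n}. \<Theta> l) = diagram \<kappa>}"

definition Rim_H :: "nat \<Rightarrow> nat list \<Rightarrow> nat list \<Rightarrow> (nat \<Rightarrow> box set) set" where
  "Rim_H r \<kappa> \<tau> = rim_sequences (\<lambda>i \<theta>. bottom_left_end \<theta> (i, part \<tau> i + 1)) r \<kappa> \<tau>"

definition Rim_E :: "nat \<Rightarrow> nat list \<Rightarrow> nat list \<Rightarrow> (nat \<Rightarrow> box set) set" where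
  "Rim_E s \<kappa> \<tau> = rim_sequences (\<lambda>j \<theta>. top_right_end \<theta> (conj_part \<tau> j + 1, j)) s \<kappa> \<tau>"

text \<open>
  The sign, for parts \<open>p 1, \<dots>, p n\<close> of the outer and \<open>q 1, \<dots>, q n\<close> of the inner partition.
\<close>

definition rim_sign :: "nat \<Rightarrow> (nat \<Rightarrow> nat) \<Rightarrow> (nat \<Rightarrow> nat) \<Rightarrow> (nat \<Rightarrow> box set) \<Rightarrow> int" where
  "rim_sign n p q \<Theta> = sign (THE \<sigma>. \<sigma> permutes {1..n} \<and>
     (\<forall>i \<in> {1..n}. int (card (\<Theta> i)) = int (p (\<sigma> i)) - int (\<sigma> i) - int (q i) + int i))"

definition sign_H :: "nat \<Rightarrow> nat list \<Rightarrow> nat list \<Rightarrow> (nat \<Rightarrow> box set) \<Rightarrow> int" where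
  "sign_H r \<kappa> \<tau> = rim_sign r (part \<kappa>) (part \<tau>)"

definition sign_E :: "nat \<Rightarrow> nat list \<Rightarrow> nat list \<Rightarrow> (nat \<Rightarrow> box set) \<Rightarrow> int" where
  "sign_E s \<kappa> \<tau> = rim_sign s (conj_part \<kappa>) (conj_part \<tau>)"

end

theory Submission
  imports Defs
begin

text \<open>
  The values of the antipode on the basis come from Hoffman's formula
  \<open>M \<gamma> \<mapsto> (- 1) ^ n * E (rev \<gamma>)\<close>. The convolution inverse of the identity is unique
  (\<open>is_antipode_unique\<close>), so it suffices that this map satisfies the two convolution equations. The
  product of \<open>E (rev (take k \<gamma>))\<close> and \<open>M (drop k \<gamma>)\<close> is a sum over words that decrease weakly up
  to position \<open>k\<close> and increase strictly afterwards; a non-empty word has no such \<open>k\<close> or exactly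
  two, which are adjacent and cancel (\<open>alternating_sum_splits\<close>).

  A Schur type function is the generating function \<open>K P\<close> of the fillings of a finite set \<open>P\<close> that
  satisfy certain weak and strict inequalities (\<open>filling_gf\<close>). Cutting the values of a filling at a
  bound shows that the coproduct of \<open>K P\<close> is the sum of \<open>K I \<otimes> K (P - I)\<close> over the
  lower sets \<open>I\<close> of \<open>P\<close>. Hence the values of the antipode are determined recursively by
  \<open>\<Sum>I. S (K I) * K (P - I) = 0\<close>. The generating functions with all inequalities reversed and with
  weak and strict exchanged, multiplied by \<open>(- 1) ^ card I\<close>, satisfy the same recursion: for a fixed
  filling of \<open>P\<close>, the box with the least value, and among those with the least content, can be moved
  between \<open>I\<close> and \<open>P - I\<close>, which changes the sign (\<open>sum_reconciled\<close>). This gives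
  \<open>antipode_filling_gf\<close>. For the inequalities of semistandard tableaux, the exchange is the
  anti-diagonal transposition of the diagram.

  For the rim expansions write \<open>x i = \<tau>\<^sub>i - i\<close> and \<open>y i = \<kappa>\<^sub>i - i\<close>, so that row \<open>i\<close> of the diagram
  \<open>\<kappa> / \<tau>\<close> has the contents \<open>x i + 1, \<dots>, y i\<close>. For a diagonal filling the exponents only depend on
  the content, so that there is an \<open>E\<close> for every interval of contents, and the determinant
  \<open>\<Sum>\<sigma>. sign \<sigma> * (\<Prod>i. E (x i, y (\<sigma> i)])\<close> is the generating function of the semistandard
  tableaux: if a family of rows violates a column inequality, exchanging the tails of two
  neighbouring rows at the first violation keeps all contents, hence the monomial, and changes the
  sign of \<open>\<sigma>\<close> (\<open>signed_sum_rows\<close>, the argument of Lindstrom, Gessel and Viennot). The permutations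
  with \<open>x i \<le> y (\<sigma> i)\<close> correspond to the rim decompositions: the first \<open>k\<close> ribbons lead to the
  partition whose shifted parts are \<open>y (\<sigma> 1), \<dots>, y (\<sigma> k), x (k + 1), \<dots>, x r\<close> in some order, and
  raising one shifted part from \<open>x k\<close> to \<open>y (\<sigma> k)\<close> adds a ribbon with one box of each content in
  between (\<open>Rim_H_eq\<close>). All of this works for the relation \<open><\<close> instead of \<open>\<le>\<close> along the rows; applied
  to the transposed diagram this yields the expansion in the \<open>M\<close>.
\<close>

section \<open>Formal sums of monomials\<close>

abbreviation (input) keys :: "mono \<Rightarrow> nat set" where
  "keys \<equiv> Poly_Mapping.keys"

abbreviation (input) lookup :: "mono \<Rightarrow> nat \<Rightarrow> nat" where
  "lookup \<equiv> Poly_Mapping.lookup"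

lemma coeff_zero [simp]: "coeff 0 m = 0"
  by (simp add: zero_series_def)

lemma coeff_one: "coeff 1 m = (if m = 0 then 1 else 0)"
  by (simp add: one_series_def)

lemma coeff_add [simp]: "coeff (f + g) m = coeff f m + coeff g m"
  by (simp add: plus_series_def)

lemma coeff_uminus [simp]: "coeff (- f) m = - coeff f m"
  by (simp add: uminus_series_def)

lemma coeff_sum [simp]: "coeff (\<Sum>i\<in>I. f i) m = (\<Sum>i\<in>I. coeff (f i) m)"
  by (induction I rule: infinite_finite_induct) auto

lemma coeff_of_int_mult [simp]: "coeff (of_int c * f) m = c * coeff f m"
proof -
  have nat: "coeff (of_nat n * f) m = int n * coeff f m" for n
    by (induction n) (auto simp: algebra_simps)
  show ?thesis
    by (cases c rule: int_cases2) (simp_all add: nat)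
qed

lemma coeff_sign_mult [simp]: "coeff ((- 1) ^ n * f) m = (- 1) ^ n * coeff f m"
  using coeff_of_int_mult[of "(- 1) ^ n" f m] by simp

lemma coeff_mult: "coeff (f * g) m = (\<Sum>(a, b) \<in> {(a, b). a + b = m}. coeff f a * coeff g b)"
  by (simp add: times_series_def)

lemma coeff_monomial_sum: "coeff (monomial_sum I e) m = int (card {i \<in> I. e i = m})"
  by (simp add: monomial_sum_def)

text \<open>
  The condition under which \<open>monomial_sum I e\<close> is a meaningful formal sum.
\<close>
definition finite_fibres :: "'i set \<Rightarrow> ('i \<Rightarrow> mono) \<Rightarrow> bool" where
  "finite_fibres I e \<longleftrightarrow> (\<forall>m. finite {i \<in> I. e i = m})"

lemma bij_betw_fibres:
  assumes "bij_betw h I J" "\<And>i. i \<in> I \<Longrightarrow> e' (h i) = e i"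
  shows "bij_betw h {i \<in> I. e i = m} {j \<in> J. e' j = m}"
  using assms unfolding bij_betw_def inj_on_def by auto

lemma monomial_sum_reindex:
  assumes "bij_betw h I J" "\<And>i. i \<in> I \<Longrightarrow> e' (h i) = e i"
  shows "monomial_sum I e = monomial_sum J e'"
  by (rule series_eqI) (simp add: coeff_monomial_sum bij_betw_same_card[OF bij_betw_fibres[of h I J e' e, OF assms]])

lemma finite_fibres_reindex:
  assumes "bij_betw h I J" "\<And>i. i \<in> I \<Longrightarrow> e' (h i) = e i" "finite_fibres I e"
  shows "finite_fibres J e'"
  using assms(3) bij_betw_finite[OF bij_betw_fibres[of h I J e' e, OF assms(1,2)]]
  by (simp add: finite_fibres_def)

lemma finite_fibres_Times:
  assumes "finite_fibres I e" "finite_fibres J e'"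
  shows "finite_fibres (I \<times> J) (\<lambda>(i, j). e i + e' j)"
  unfolding finite_fibres_def
proof
  fix m
  have "{p \<in> I \<times> J. (case p of (i, j) \<Rightarrow> e i + e' j) = m} =
     (\<Union>(a, b) \<in> {(a, b). a + b = m}. {i \<in> I. e i = a} \<times> {j \<in> J. e' j = b})" by auto
  also have "finite \<dots>"
    using assms finite_mono_splits[of m] by (intro finite_UN_I) (auto simp: finite_fibres_def)
  finally show "finite {p \<in> I \<times> J. (case p of (i, j) \<Rightarrow> e i + e' j) = m}" .
qed

lemma monomial_sum_mult:
  assumes "finite_fibres I e" "finite_fibres J e'"
  shows "monomial_sum I e * monomial_sum J e' = monomial_sum (I \<times> J) (\<lambda>(i, j). e i + e' j)"
proof (rule series_eqI)
  fix m
  have eq: "{p \<in> I \<times> J. (case p of (i, j) \<Rightarrow> e i + e' j) = m} =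
     (\<Union>(a, b) \<in> {(a, b). a + b = m}. {i \<in> I. e i = a} \<times> {j \<in> J. e' j = b})" by auto
  have "card {p \<in> I \<times> J. (case p of (i, j) \<Rightarrow> e i + e' j) = m} =
      (\<Sum>(a, b) \<in> {(a, b). a + b = m}. card ({i \<in> I. e i = a} \<times> {j \<in> J. e' j = b}))"
    unfolding eq using assms finite_mono_splits[of m]
    by (subst card_UN_disjoint) (auto simp: finite_fibres_def case_prod_unfold intro!: sum.cong)
  then show "coeff (monomial_sum I e * monomial_sum J e') m =
      coeff (monomial_sum (I \<times> J) (\<lambda>(i, j). e i + e' j)) m"
    by (simp add: coeff_mult coeff_monomial_sum card_cartesian_product case_prod_unfold)
qed

text \<open>
  Finiteness of the fibres is part of the claim because the induction step multiplies by the sum for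
  the smaller index set.
\<close>
lemma prod_monomial_sum:
  assumes "finite I" "\<And>i. i \<in> I \<Longrightarrow> finite_fibres (A i) (e i)"
  shows "finite_fibres (PiE I A) (\<lambda>F. \<Sum>i\<in>I. e i (F i)) \<and>
    (\<Prod>i\<in>I. monomial_sum (A i) (e i)) = monomial_sum (PiE I A) (\<lambda>F. \<Sum>i\<in>I. e i (F i))"
  using assms
proof (induction I rule: finite_induct)
  case empty
  have "finite_fibres {\<lambda>_. undefined} (\<lambda>F. 0)" by (simp add: finite_fibres_def)
  moreover have "{i. i = (\<lambda>_::'a. undefined::'b) \<and> (0::mono) = m} = (if m = 0 then {\<lambda>_. undefined} else {})" for m
    by auto
  ultimately show ?case
    by (auto intro!: series_eqI simp: coeff_one coeff_monomial_sum)
next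
  case (insert k I)
  let ?h = "\<lambda>(f, F). F(k := f)"
  have bij: "bij_betw ?h (A k \<times> PiE I A) (PiE (insert k I) A)"
    unfolding bij_betw_def
  proof
    show "inj_on ?h (A k \<times> PiE I A)"
    proof (rule inj_onI, clarify)
      fix f F f' F' assume F: "F \<in> PiE I A" "F' \<in> PiE I A" and eq: "F(k := f) = F'(k := f')"
      have "f = f'" using eq by (metis fun_upd_same)
      moreover have "F i = F' i" for i
        using eq F insert.hyps(2) by (metis PiE_E fun_upd_other)
      ultimately show "f = f' \<and> F = F'" by auto
    qed
    show "?h ` (A k \<times> PiE I A) = PiE (insert k I) A"
      by (auto simp: PiE_insert_eq image_def)
  qed
  have IH: "finite_fibres (PiE I A) (\<lambda>F. \<Sum>i\<in>I. e i (F i))"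
    "(\<Prod>i\<in>I. monomial_sum (A i) (e i)) = monomial_sum (PiE I A) (\<lambda>F. \<Sum>i\<in>I. e i (F i))"
    using insert by auto
  have k: "finite_fibres (A k) (e k)" using insert.prems by simp
  have wt: "(\<Sum>i\<in>insert k I. e i (?h p i)) = (\<lambda>(f, F). e k f + (\<Sum>i\<in>I. e i (F i))) p" for p
  proof -
    obtain f F where p: "p = (f, F)" by fastforce
    have "(\<Sum>i\<in>I. e i ((F(k := f)) i)) = (\<Sum>i\<in>I. e i (F i))"
      using insert.hyps by (intro sum.cong) auto
    then show ?thesis using insert.hyps p by simp
  qed
  show ?case
  proof
    show "finite_fibres (PiE (insert k I) A) (\<lambda>F. \<Sum>i\<in>insert k I. e i (F i))"
      by (rule finite_fibres_reindex[where h = ?h and e' = "\<lambda>F. \<Sum>i\<in>insert k I. e i (F i)",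
            OF bij wt finite_fibres_Times[OF k IH(1)]])
    show "(\<Prod>i\<in>insert k I. monomial_sum (A i) (e i)) =
        monomial_sum (PiE (insert k I) A) (\<lambda>F. \<Sum>i\<in>insert k I. e i (F i))"
      using insert.hyps IH monomial_sum_mult[OF k IH(1)]
        monomial_sum_reindex[where h = ?h and e' = "\<lambda>F. \<Sum>i\<in>insert k I. e i (F i)", OF bij wt]
      by simp
  qed
qed

subsection \<open>Fillings of a finite set\<close>

definition weight :: "('b \<Rightarrow> nat) \<Rightarrow> 'b set \<Rightarrow> ('b \<Rightarrow> nat) \<Rightarrow> mono" where
  "weight w P m = (\<Sum>b\<in>P. Poly_Mapping.single (m b) (w b))"

lemma lookup_weight: "lookup (weight w P m) v = (\<Sum>b\<in>P. if m b = v then w b else 0)"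
  by (simp add: weight_def lookup_sum lookup_single when_def)

lemma lookup_weight_fibre:
  "finite P \<Longrightarrow> lookup (weight w P m) v = (\<Sum>b | b \<in> P \<and> m b = v. w b)"
  by (simp add: lookup_weight sum.If_cases) (auto intro!: sum.cong)

lemma keys_weight:
  assumes "finite P" "\<And>b. b \<in> P \<Longrightarrow> 1 \<le> w b"
  shows "keys (weight w P m) = m ` P"
proof -
  have "v \<in> keys (weight w P m) \<longleftrightarrow> v \<in> m ` P" for v
    using assms by (force simp: in_keys_iff lookup_weight Suc_le_eq)
  then show ?thesis by blast
qed

lemma weight_cong: "(\<And>b. b \<in> P \<Longrightarrow> m b = m' b) \<Longrightarrow> weight w P m = weight w P m'"
  by (simp add: weight_def)

lemma weight_Un:
  "finite P \<Longrightarrow> finite Q \<Longrightarrow> P \<inter> Q = {} \<Longrightarrow> weight w (P \<union> Q) m = weight w P m + weight w Q m"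
  by (simp add: weight_def sum.union_disjoint)

lemma finite_weight_fibre:
  assumes "finite P" "\<And>b. b \<in> P \<Longrightarrow> 1 \<le> w b"
  shows "finite {m \<in> P \<rightarrow>\<^sub>E {1..}. weight w P m = \<mu>}"
proof (rule finite_subset)
  show "{m \<in> P \<rightarrow>\<^sub>E {1..}. weight w P m = \<mu>} \<subseteq> P \<rightarrow>\<^sub>E keys \<mu>"
    using keys_weight[of P w] assms by auto
  show "finite (P \<rightarrow>\<^sub>E keys \<mu>)"
    using assms by (intro finite_PiE) auto
qed

lemma finite_fibres_weight:
  assumes "finite P" "\<And>b. b \<in> P \<Longrightarrow> 1 \<le> w b" "A \<subseteq> P \<rightarrow>\<^sub>E {1..}"
  shows "finite_fibres A (weight w P)"
  unfolding finite_fibres_def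
proof
  fix \<mu>
  show "finite {m \<in> A. weight w P m = \<mu>}"
    using assms(3) by (intro finite_subset[OF _ finite_weight_fibre[of P w \<mu>, OF assms(1,2)]]) auto
qed

text \<open>
  Renaming boxes along a bijection. The fillings of \<open>P\<close> and \<open>Q\<close> correspond to each other anyway, so
  that only the conditions that define \<open>A\<close> and \<open>B\<close> have to be compared.
\<close>
lemma monomial_sum_transport:
  assumes f: "bij_betw f P Q" and w: "\<And>b. b \<in> P \<Longrightarrow> w' (f b) = w b"
    and A: "A \<subseteq> P \<rightarrow>\<^sub>E {1..}" and B: "B \<subseteq> Q \<rightarrow>\<^sub>E {1..}"
    and iff: "\<And>m. m \<in> Q \<rightarrow>\<^sub>E {1..} \<Longrightarrow> (\<lambda>b\<in>P. m (f b)) \<in> A \<longleftrightarrow> m \<in> B"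
  shows "monomial_sum B (weight w' Q) = monomial_sum A (weight w P)"
proof (rule monomial_sum_reindex)
  let ?h = "\<lambda>m. \<lambda>b\<in>P. m (f b)"
  show "bij_betw ?h B A"
    unfolding bij_betw_def
  proof (intro conjI inj_onI equalityI subsetI)
    fix m m' assume m: "m \<in> B" "m' \<in> B" and eq: "?h m = ?h m'"
    show "m = m'"
    proof (rule PiE_ext)
      show "m \<in> Q \<rightarrow>\<^sub>E {1..}" "m' \<in> Q \<rightarrow>\<^sub>E {1..}" using m B by blast+
      fix q assume "q \<in> Q"
      then obtain b where b: "b \<in> P" "q = f b" using f by (auto simp: bij_betw_def)
      then show "m q = m' q" using fun_cong[OF eq, of b] by simp
    qed
  next
    fix n assume "n \<in> ?h ` B"
    then show "n \<in> A" using B iff by blast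
  next
    fix n assume n: "n \<in> A"
    then have nP: "n \<in> P \<rightarrow>\<^sub>E {1..}" using A by blast
    define m where "m = (\<lambda>q\<in>Q. n (inv_into P f q))"
    have "m \<in> Q \<rightarrow>\<^sub>E {1..}"
      unfolding m_def using nP f by (auto simp: bij_betw_def inv_into_into)
    moreover have "?h m = n"
    proof
      fix b show "?h m b = n b"
      proof (cases "b \<in> P")
        case True
        then show ?thesis using f by (simp add: m_def bij_betw_inv_into_left bij_betw_apply)
      next
        case False
        then show ?thesis using PiE_arb[OF nP False] by simp
      qed
    qed
    ultimately show "n \<in> ?h ` B" using iff[of m] n by blast
  qed
  show "weight w P (?h m) = weight w' Q m" for m
    unfolding weight_def sum.reindex_bij_betw[OF f, symmetric] using w by simp
qed

text \<open>
  The common form of \<open>M\<close> and \<open>E\<close>.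
\<close>
definition chain_sum :: "(nat \<Rightarrow> nat \<Rightarrow> bool) \<Rightarrow> nat list \<Rightarrow> series" where
  "chain_sum rel \<gamma> = monomial_sum
     {ms. length ms = length \<gamma> \<and> (\<forall>m \<in> set ms. 1 \<le> m) \<and> sorted_wrt rel ms} (word_mono \<gamma>)"

lemma M_chain_sum: "M = chain_sum (<)" and E_chain_sum: "E = chain_sum (\<le>)"
  by (auto simp: M_def E_def chain_sum_def)

text \<open>
  The positions of a composition may be named by the elements of any set \<open>P\<close> of the same size, for
  instance by the contents of the boxes in a row.
\<close>
lemma chain_sum_fillings:
  assumes h: "bij_betw h {..<length \<gamma>} P" and w: "\<And>k. k < length \<gamma> \<Longrightarrow> w (h k) = \<gamma> ! k"
  shows "chain_sum rel \<gamma> = monomial_sum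
    {m \<in> P \<rightarrow>\<^sub>E {1..}. \<forall>k l. k < l \<and> l < length \<gamma> \<longrightarrow> rel (m (h k)) (m (h l))} (weight w P)"
    (is "_ = monomial_sum ?B _")
proof -
  let ?n = "length \<gamma>"
  let ?A = "{ms. length ms = ?n \<and> (\<forall>m \<in> set ms. 1 \<le> m) \<and> sorted_wrt rel ms}"
  let ?f = "\<lambda>m. map (\<lambda>k. m (h k)) [0..<?n]"
  have hP: "h k \<in> P" if "k < ?n" for k using h that by (auto simp: bij_betw_def)
  have Ph: "\<exists>k<?n. b = h k" if "b \<in> P" for b using h that by (auto simp: bij_betw_def)
  let ?i = "inv_into {..<?n} h"
  have ih: "?i (h k) = k" if "k < ?n" for k
    using h that by (simp add: bij_betw_inv_into_left)
  have "bij_betw ?f ?B ?A"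
  proof (rule bij_betw_byWitness[where f' = "\<lambda>ms. \<lambda>b\<in>P. ms ! ?i b"])
    show "\<forall>m\<in>?B. (\<lambda>b\<in>P. ?f m ! ?i b) = m"
    proof
      fix m assume m: "m \<in> ?B"
      show "(\<lambda>b\<in>P. ?f m ! ?i b) = m"
      proof
        fix b show "(\<lambda>b\<in>P. ?f m ! ?i b) b = m b"
        proof (cases "b \<in> P")
          case True
          then obtain k where "k < ?n" "b = h k" using Ph by blast
          then show ?thesis using True ih[of k] by simp
        next
          case False
          then show ?thesis using m PiE_arb[of m P "\<lambda>_. {1..}" b] by simp
        qed
      qed
    qed
    show "\<forall>ms\<in>?A. ?f (\<lambda>b\<in>P. ms ! ?i b) = ms"
    proof
      fix ms assume "ms \<in> ?A"
      then show "?f (\<lambda>b\<in>P. ms ! ?i b) = ms"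
        using hP ih by (intro nth_equalityI) simp_all
    qed
    show "?f ` ?B \<subseteq> ?A"
    proof (rule image_subsetI)
      fix m assume m: "m \<in> ?B"
      have "1 \<le> m (h k)" if "k < ?n" for k
        using PiE_mem[of m P "\<lambda>_. {1..}" "h k"] m hP[OF that] by simp
      then show "?f m \<in> ?A" using m by (simp add: sorted_wrt_iff_nth_less)
    qed
    show "(\<lambda>ms. \<lambda>b\<in>P. ms ! ?i b) ` ?A \<subseteq> ?B"
    proof (rule image_subsetI)
      fix ms assume ms: "ms \<in> ?A"
      have "ms ! ?i b \<ge> 1" if "b \<in> P" for b
      proof -
        obtain k where k: "k < ?n" "b = h k" using Ph \<open>b \<in> P\<close> by blast
        then have "ms ! k \<in> set ms" using ms by simp
        then show ?thesis using k ih[of k] ms by simp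
      qed
      then show "(\<lambda>b\<in>P. ms ! ?i b) \<in> ?B"
        using ms hP ih by (simp add: sorted_wrt_iff_nth_less)
    qed
  qed
  moreover have "word_mono \<gamma> (?f m) = weight w P m" for m
    unfolding weight_def sum.reindex_bij_betw[OF h, symmetric]
    using w by (simp add: word_mono_def)
  ultimately show ?thesis
    unfolding chain_sum_def by (rule monomial_sum_reindex[where h = ?f, symmetric])
qed

section \<open>Coefficients of quasi-symmetric functions\<close>

text \<open>
  The only composition \<open>\<gamma>\<close> for which \<open>M \<gamma>\<close> can contain the monomial.
\<close>
definition exps :: "mono \<Rightarrow> nat list" where
  "exps \<mu> = map (lookup \<mu>) (sorted_list_of_set (keys \<mu>))"

text \<open>
  The monomial of \<open>M \<gamma>\<close> in the first variables. The coefficients of a quasi-symmetric function in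
  the basis \<open>M\<close> are its coefficients at these monomials.
\<close>
definition packed_mono :: "nat list \<Rightarrow> mono" where
  "packed_mono \<gamma> = word_mono \<gamma> [1..<Suc (length \<gamma>)]"

lemma exps_composition: "exps \<mu> \<in> compositions"
  by (auto simp: exps_def compositions_def in_keys_iff Suc_le_eq)

lemma word_mono_weight: "word_mono \<gamma> ms = weight (\<lambda>k. \<gamma> ! k) {..<length \<gamma>} (\<lambda>k. ms ! k)"
  by (simp add: word_mono_def weight_def)

lemma keys_word_mono:
  assumes "\<gamma> \<in> compositions" "length ms = length \<gamma>"
  shows "keys (word_mono \<gamma> ms) = set ms"
proof -
  have "1 \<le> \<gamma> ! k" if "k < length \<gamma>" for k
    using assms(1) that by (simp add: compositions_def)
  then show ?thesis
    unfolding word_mono_weight using assms(2)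
    by (subst keys_weight) (auto simp: set_conv_nth)
qed

lemma lookup_word_mono:
  assumes "distinct ms" "length ms = length \<gamma>" "k < length \<gamma>"
  shows "lookup (word_mono \<gamma> ms) (ms ! k) = \<gamma> ! k"
proof -
  have "{l. l \<in> {..<length \<gamma>} \<and> ms ! l = ms ! k} = {k}"
    using assms by (auto simp: nth_eq_iff_index_eq)
  then show ?thesis by (simp add: word_mono_weight lookup_weight_fibre)
qed

lemma sorted_list_of_set_strict: "sorted_wrt (<) (xs :: nat list) \<Longrightarrow> sorted_list_of_set (set xs) = xs"
  by (simp add: strict_sorted_iff sorted_list_of_set.idem_if_sorted_distinct)

lemma exps_word_mono:
  assumes "\<gamma> \<in> compositions" "length ms = length \<gamma>" "sorted_wrt (<) ms"
  shows "exps (word_mono \<gamma> ms) = \<gamma>"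
  using assms lookup_word_mono[of ms \<gamma>]
  by (auto simp: exps_def keys_word_mono sorted_list_of_set_strict strict_sorted_iff intro!: nth_equalityI)

lemma word_mono_exps: "word_mono (exps \<mu>) (sorted_list_of_set (keys \<mu>)) = \<mu>"
proof (rule poly_mapping_eqI)
  fix v
  let ?ms = "sorted_list_of_set (keys \<mu>)"
  have len: "length ?ms = length (exps \<mu>)" by (simp add: exps_def)
  show "lookup (word_mono (exps \<mu>) ?ms) v = lookup \<mu> v"
  proof (cases "v \<in> keys \<mu>")
    case True
    then have "v \<in> set ?ms" by simp
    then obtain k where k: "k < length ?ms" "v = ?ms ! k" unfolding in_set_conv_nth by blast
    have "lookup (word_mono (exps \<mu>) ?ms) v = exps \<mu> ! k"
      unfolding k(2) using k(1) len by (intro lookup_word_mono) simp_all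
    then show ?thesis using k len by (simp add: exps_def)
  next
    case False
    then have "v \<notin> keys (word_mono (exps \<mu>) ?ms)"
      by (subst keys_word_mono[OF exps_composition len]) simp
    then show ?thesis using False by (simp add: in_keys_iff)
  qed
qed

text \<open>
  The word that produces a monomial consists of the variables of the monomial in increasing order.
  Different \<open>M \<gamma>\<close> therefore have no monomial in common, which makes them linearly independent.
\<close>
lemma coeff_M:
  assumes "\<gamma> \<in> compositions"
  shows "coeff (M \<gamma>) \<mu> = (if exps \<mu> = \<gamma> \<and> 0 \<notin> keys \<mu> then 1 else 0)"
proof -
  let ?A = "{ms. (length ms = length \<gamma> \<and> (\<forall>m \<in> set ms. 1 \<le> m) \<and> sorted_wrt (<) ms) \<and> word_mono \<gamma> ms = \<mu>}"
  have "?A = (if exps \<mu> = \<gamma> \<and> 0 \<notin> keys \<mu> then {sorted_list_of_set (keys \<mu>)} else {})"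
    (is "_ = ?B")
  proof (intro equalityI subsetI)
    fix ms assume ms: "ms \<in> ?A"
    then have k: "keys \<mu> = set ms" using keys_word_mono[OF assms, of ms] by auto
    have "exps \<mu> = \<gamma>" using ms exps_word_mono[OF assms, of ms] by auto
    moreover have "0 \<notin> keys \<mu>" using k ms by fastforce
    moreover have "ms = sorted_list_of_set (keys \<mu>)"
      using ms k by (simp add: sorted_list_of_set_strict)
    ultimately show "ms \<in> ?B" by simp
  next
    fix ms assume "ms \<in> ?B"
    then have e: "exps \<mu> = \<gamma>" "0 \<notin> keys \<mu>" and ms: "ms = sorted_list_of_set (keys \<mu>)"
      by (auto split: if_splits)
    have "length ms = length \<gamma>" using ms e(1) by (auto simp: exps_def)
    moreover have "word_mono \<gamma> ms = \<mu>" using word_mono_exps[of \<mu>] ms e(1) by simp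
    moreover have "\<forall>m \<in> set ms. 1 \<le> m" using e(2) ms by (auto simp: Suc_le_eq intro: gr0I)
    ultimately show "ms \<in> ?A" using ms by simp
  qed
  then show ?thesis by (simp add: M_def coeff_monomial_sum)
qed

lemma
  assumes "\<gamma> \<in> compositions"
  shows exps_packed_mono: "exps (packed_mono \<gamma>) = \<gamma>"
    and keys_packed_mono: "keys (packed_mono \<gamma>) = {1..length \<gamma>}"
proof -
  let ?ms = "[1..<Suc (length \<gamma>)]"
  have len: "length ?ms = length \<gamma>" by (simp only: length_upt diff_Suc_1)
  have "sorted_wrt (<) ?ms" by (rule sorted_wrt_upt)
  then show "exps (packed_mono \<gamma>) = \<gamma>"
    unfolding packed_mono_def by (rule exps_word_mono[OF assms len])
  have "set ?ms = {1..length \<gamma>}" by (simp only: set_upt atLeastLessThanSuc_atLeastAtMost)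
  then show "keys (packed_mono \<gamma>) = {1..length \<gamma>}"
    unfolding packed_mono_def keys_word_mono[OF assms len] .
qed

definition quasi_symmetric :: "series \<Rightarrow> bool" where
  "quasi_symmetric f \<longleftrightarrow>
     (\<forall>\<mu>. 0 \<in> keys \<mu> \<longrightarrow> coeff f \<mu> = 0) \<and>
     (\<forall>\<mu> \<mu>'. 0 \<notin> keys \<mu> \<and> 0 \<notin> keys \<mu>' \<and> exps \<mu> = exps \<mu>' \<longrightarrow>
        coeff f \<mu> = coeff f \<mu>')"

lemma quasi_symmetricD:
  assumes "quasi_symmetric f"
  shows "0 \<in> keys \<mu> \<Longrightarrow> coeff f \<mu> = 0"
    and "0 \<notin> keys \<mu> \<Longrightarrow> 0 \<notin> keys \<mu>' \<Longrightarrow> exps \<mu> = exps \<mu>' \<Longrightarrow>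
      coeff f \<mu> = coeff f \<mu>'"
  using assms unfolding quasi_symmetric_def by blast+

definition support :: "series \<Rightarrow> nat list set" where
  "support f = {\<gamma> \<in> compositions. coeff f (packed_mono \<gamma>) \<noteq> 0}"

text \<open>
  The index set \<open>A\<close> may exceed the support, so that several functions can be expanded over one set.
\<close>
lemma quasi_symmetric_expansion:
  assumes "quasi_symmetric f" "finite A" "support f \<subseteq> A" "A \<subseteq> compositions"
  shows "f = (\<Sum>\<gamma>\<in>A. of_int (coeff f (packed_mono \<gamma>)) * M \<gamma>)"
proof (rule series_eqI)
  fix \<mu>
  have "coeff (\<Sum>\<gamma>\<in>A. of_int (coeff f (packed_mono \<gamma>)) * M \<gamma>) \<mu>
      = (\<Sum>\<gamma>\<in>A. if \<gamma> = exps \<mu> then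
          (if 0 \<notin> keys \<mu> then coeff f (packed_mono (exps \<mu>)) else 0) else 0)"
    unfolding coeff_sum coeff_of_int_mult
    by (intro sum.cong) (use assms(4) in \<open>auto simp: coeff_M\<close>)
  also have "\<dots> = (if exps \<mu> \<in> A \<and> 0 \<notin> keys \<mu> then coeff f (packed_mono (exps \<mu>)) else 0)"
    using assms(2) by simp
  also have "\<dots> = coeff f \<mu>"
  proof (cases "0 \<in> keys \<mu>")
    case True
    then show ?thesis using quasi_symmetricD(1)[OF assms(1)] by simp
  next
    case False
    then have "coeff f \<mu> = coeff f (packed_mono (exps \<mu>))"
      by (intro quasi_symmetricD(2)[OF assms(1)])
        (simp_all add: exps_packed_mono keys_packed_mono exps_composition)
    moreover have "coeff f (packed_mono (exps \<mu>)) = 0" if "exps \<mu> \<notin> A"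
      using that assms(3) exps_composition[of \<mu>] by (auto simp: support_def)
    ultimately show ?thesis using False by simp
  qed
  finally show "coeff f \<mu> = coeff (\<Sum>\<gamma>\<in>A. of_int (coeff f (packed_mono \<gamma>)) * M \<gamma>) \<mu>" ..
qed

lemma Qsym_iff: "f \<in> Qsym \<longleftrightarrow> quasi_symmetric f \<and> finite (support f)"
proof
  assume "f \<in> Qsym"
  then obtain A c where A: "finite A" "A \<subseteq> compositions" and f: "f = (\<Sum>\<gamma>\<in>A. of_int (c \<gamma>) * M \<gamma>)"
    by (auto simp: Qsym_def)
  have c: "coeff f \<mu> = (\<Sum>\<gamma>\<in>A. c \<gamma> * (if exps \<mu> = \<gamma> \<and> 0 \<notin> keys \<mu> then 1 else 0))" for \<mu>
    unfolding f coeff_sum coeff_of_int_mult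
    by (intro sum.cong) (use A(2) in \<open>auto simp: coeff_M\<close>)
  have "quasi_symmetric f" by (auto simp: quasi_symmetric_def c)
  moreover have "support f \<subseteq> A"
  proof
    fix \<gamma> assume "\<gamma> \<in> support f"
    then have \<gamma>: "\<gamma> \<in> compositions" "coeff f (packed_mono \<gamma>) \<noteq> 0" by (auto simp: support_def)
    show "\<gamma> \<in> A"
    proof (rule ccontr)
      assume "\<gamma> \<notin> A"
      then have "coeff f (packed_mono \<gamma>) = 0"
        unfolding c exps_packed_mono[OF \<gamma>(1)] by (intro sum.neutral) auto
      then show False using \<gamma>(2) by simp
    qed
  qed
  ultimately show "quasi_symmetric f \<and> finite (support f)" using A(1) finite_subset by blast
next
  assume "quasi_symmetric f \<and> finite (support f)"
  moreover have "support f \<subseteq> compositions" by (auto simp: support_def)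
  ultimately have "f = (\<Sum>\<gamma>\<in>support f. of_int (coeff f (packed_mono \<gamma>)) * M \<gamma>) \<and>
      finite (support f) \<and> support f \<subseteq> compositions"
    using quasi_symmetric_expansion[of f "support f"] by simp
  then show "f \<in> Qsym" unfolding Qsym_def mem_Collect_eq by (intro exI)
qed

lemma zero_Qsym: "0 \<in> Qsym"
  by (auto simp: Qsym_iff quasi_symmetric_def support_def)

lemma add_Qsym: "f \<in> Qsym \<Longrightarrow> g \<in> Qsym \<Longrightarrow> f + g \<in> Qsym"
proof -
  assume "f \<in> Qsym" "g \<in> Qsym"
  then have qs: "quasi_symmetric f" "quasi_symmetric g" and fin: "finite (support f \<union> support g)"
    by (auto simp: Qsym_iff)
  have "quasi_symmetric (f + g)"
    unfolding quasi_symmetric_def coeff_add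
    using quasi_symmetricD[OF qs(1)] quasi_symmetricD[OF qs(2)] by (metis add_0)
  moreover have "support (f + g) \<subseteq> support f \<union> support g" by (auto simp: support_def)
  ultimately show ?thesis using fin finite_subset by (auto simp: Qsym_iff)
qed

lemma scale_Qsym: "f \<in> Qsym \<Longrightarrow> of_int c * f \<in> Qsym"
proof -
  assume "f \<in> Qsym"
  then have qs: "quasi_symmetric f" and fin: "finite (support f)"
    by (auto simp: Qsym_iff)
  have "quasi_symmetric (of_int c * f)"
    unfolding quasi_symmetric_def coeff_of_int_mult
    using quasi_symmetricD[OF qs] by (metis mult_zero_right)
  moreover have "support (of_int c * f) \<subseteq> support f" by (auto simp: support_def)
  ultimately show ?thesis using fin finite_subset by (auto simp: Qsym_iff)
qed

lemma sum_Qsym: "(\<And>i. i \<in> I \<Longrightarrow> f i \<in> Qsym) \<Longrightarrow> (\<Sum>i\<in>I. f i) \<in> Qsym"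
  by (induction I rule: infinite_finite_induct) (auto intro: zero_Qsym add_Qsym)

lemma M_Qsym: "\<gamma> \<in> compositions \<Longrightarrow> M \<gamma> \<in> Qsym"
  and support_M: "\<gamma> \<in> compositions \<Longrightarrow> support (M \<gamma>) = {\<gamma>}"
proof -
  assume \<gamma>: "\<gamma> \<in> compositions"
  show s: "support (M \<gamma>) = {\<gamma>}"
    using \<gamma> by (auto simp: support_def coeff_M exps_packed_mono keys_packed_mono)
  show "M \<gamma> \<in> Qsym" using \<gamma> s by (auto simp: Qsym_iff quasi_symmetric_def coeff_M)
qed

lemma coeff_M_packed: "\<gamma> \<in> compositions \<Longrightarrow> coeff (M \<gamma>) (packed_mono \<gamma>) = 1"
  by (simp add: coeff_M exps_packed_mono keys_packed_mono)

section \<open>Generating functions of fillings with inequalities\<close>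

definition admissible :: "('b \<Rightarrow> 'b \<Rightarrow> bool) \<Rightarrow> ('b \<Rightarrow> 'b \<Rightarrow> bool) \<Rightarrow> 'b set \<Rightarrow> ('b \<Rightarrow> nat) set" where
  "admissible W T P = {m \<in> P \<rightarrow>\<^sub>E {1..}.
     \<forall>b \<in> P. \<forall>b' \<in> P. (W b b' \<longrightarrow> m b \<le> m b') \<and> (T b b' \<longrightarrow> m b < m b')}"

text \<open>
  Also known as a P-partition generating function: \<open>W\<close> relates boxes whose values must increase
  weakly, \<open>T\<close> those whose values must increase strictly. The functions \<open>M \<gamma>\<close>, \<open>E \<gamma>\<close> and the Schur
  type functions are instances.
\<close>
definition filling_gf ::
  "('b \<Rightarrow> 'b \<Rightarrow> bool) \<Rightarrow> ('b \<Rightarrow> 'b \<Rightarrow> bool) \<Rightarrow> ('b \<Rightarrow> nat) \<Rightarrow> 'b set \<Rightarrow> series" where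
  "filling_gf W T w P = monomial_sum (admissible W T P) (weight w P)"

lemma finite_fibres_admissible:
  assumes "finite P" "\<And>b. b \<in> P \<Longrightarrow> 1 \<le> w b"
  shows "finite_fibres (admissible W T P) (weight w P)"
  using assms by (rule finite_fibres_weight) (auto simp: admissible_def)

lemma coeff_filling_gf: "coeff (filling_gf W T w P) \<mu> = int (card {m \<in> admissible W T P. weight w P m = \<mu>})"
  by (simp add: filling_gf_def coeff_monomial_sum)

lemma finite_admissible_fibre:
  "finite P \<Longrightarrow> (\<And>b. b \<in> P \<Longrightarrow> 1 \<le> w b) \<Longrightarrow> finite {m \<in> admissible W T P. weight w P m = \<mu>}"
  using finite_fibres_admissible[of P w W T] by (simp add: finite_fibres_def)

lemma obtain_relabelling:
  assumes "exps \<mu> = exps \<mu>'"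
  obtains \<phi> where "strict_mono_on (keys \<mu>) \<phi>" "\<phi> ` keys \<mu> = keys \<mu>'"
    "\<And>v. v \<in> keys \<mu> \<Longrightarrow> lookup \<mu>' (\<phi> v) = lookup \<mu> v"
proof -
  define xs where "xs = sorted_list_of_set (keys \<mu>)"
  define ys where "ys = sorted_list_of_set (keys \<mu>')"
  have xy: "map (lookup \<mu>) xs = map (lookup \<mu>') ys"
    using assms by (simp add: exps_def xs_def ys_def)
  then have len: "length xs = length ys" using map_eq_imp_length_eq by blast
  have xs: "sorted_wrt (<) xs" "set xs = keys \<mu>" "distinct xs"
    and ys: "sorted_wrt (<) ys" "set ys = keys \<mu>'" by (auto simp: xs_def ys_def)
  define \<phi> where "\<phi> = (\<lambda>v. ys ! inv_into {..<length xs} ((!) xs) v)"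
  have \<phi>: "\<phi> (xs ! k) = ys ! k" if "k < length xs" for k
    unfolding \<phi>_def using that xs(3)
    by (subst inv_into_f_f) (auto simp: inj_on_def nth_eq_iff_index_eq)
  have ex: "\<exists>k<length xs. v = xs ! k" if "v \<in> keys \<mu>" for v
    using that xs(2) by (metis in_set_conv_nth)
  show ?thesis
  proof
    show "strict_mono_on (keys \<mu>) \<phi>"
    proof (rule strict_mono_onI)
      fix u v assume "u \<in> keys \<mu>" "v \<in> keys \<mu>" "u < v"
      then obtain k l where kl: "k < length xs" "l < length xs" "u = xs ! k" "v = xs ! l" using ex by metis
      have "k < l"
      proof (rule ccontr)
        assume "\<not> k < l"
        then have "xs ! l \<le> xs ! k"
          using xs(1) kl by (metis linorder_neqE_nat order_refl less_imp_le sorted_wrt_nth_less)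
        then show False using \<open>u < v\<close> kl by simp
      qed
      then show "\<phi> u < \<phi> v" using kl \<phi> len ys(1) by (simp add: sorted_wrt_nth_less)
    qed
    show "\<phi> ` keys \<mu> = keys \<mu>'"
      unfolding xs(2)[symmetric] ys(2)[symmetric] using \<phi> len
      by (auto simp: set_conv_nth) (metis (mono_tags, lifting) image_iff mem_Collect_eq)
    show "lookup \<mu>' (\<phi> v) = lookup \<mu> v" if v: "v \<in> keys \<mu>" for v
    proof -
      obtain k where k: "k < length xs" "v = xs ! k" using ex[OF v] by blast
      have "map (lookup \<mu>) xs ! k = map (lookup \<mu>') ys ! k" using xy by simp
      then show ?thesis using k \<phi>[OF k(1)] len by simp
    qed
  qed
qed

text \<open>
  Composition with an order isomorphism between the variables of the two monomials respects weak and
  strict inequalities.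
\<close>
lemma card_fibre_relabel_le:
  assumes "finite P" "\<And>b. b \<in> P \<Longrightarrow> 1 \<le> w b"
    and exps: "exps \<mu> = exps \<mu>'" and pos: "0 \<notin> keys \<mu>'"
  shows "card {m \<in> admissible W T P. weight w P m = \<mu>} \<le> card {m \<in> admissible W T P. weight w P m = \<mu>'}"
proof -
  obtain \<phi> where mono: "strict_mono_on (keys \<mu>) \<phi>"
    and img: "\<phi> ` keys \<mu> = keys \<mu>'"
    and lookup: "\<And>v. v \<in> keys \<mu> \<Longrightarrow> lookup \<mu>' (\<phi> v) = lookup \<mu> v"
    using obtain_relabelling[OF exps] by metis
  have inj: "inj_on \<phi> (keys \<mu>)" using mono by (rule strict_mono_on_imp_inj_on)
  have less: "\<phi> u < \<phi> v" if "u < v" "u \<in> keys \<mu>" "v \<in> keys \<mu>" for u v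
    using mono that by (simp add: strict_mono_onD)
  have le: "\<phi> u \<le> \<phi> v" if "u \<le> v" "u \<in> keys \<mu>" "v \<in> keys \<mu>" for u v
    using less that by (cases "u = v") (auto simp: less_imp_le)
  let ?h = "\<lambda>m. \<lambda>b\<in>P. \<phi> (m b)"
  let ?A = "\<lambda>\<mu>. {m \<in> admissible W T P. weight w P m = \<mu>}"
  have k: "m b \<in> keys \<mu>" if "m \<in> ?A \<mu>" "b \<in> P" for m b
    using that keys_weight[of P w m] assms(1,2) by auto
  show ?thesis
  proof (rule card_inj_on_le)
    show "inj_on ?h (?A \<mu>)"
    proof (rule inj_onI)
      fix m m' assume m: "m \<in> ?A \<mu>" "m' \<in> ?A \<mu>" and eq: "?h m = ?h m'"
      show "m = m'"
      proof (rule PiE_ext)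
        show "m \<in> P \<rightarrow>\<^sub>E {1..}" "m' \<in> P \<rightarrow>\<^sub>E {1..}" using m by (auto simp: admissible_def)
        fix b assume b: "b \<in> P"
        then have "\<phi> (m b) = \<phi> (m' b)" using fun_cong[OF eq, of b] by simp
        then show "m b = m' b" using inj k m b by (meson inj_onD)
      qed
    qed
    show "?h ` ?A \<mu> \<subseteq> ?A \<mu>'"
    proof (rule image_subsetI)
      fix m assume m: "m \<in> ?A \<mu>"
      have "1 \<le> \<phi> (m b)" if "b \<in> P" for b
        using k[OF m that] img pos by (metis One_nat_def Suc_leI gr0I image_eqI)
      then have "?h m \<in> admissible W T P"
        using m k[OF m] by (auto simp: admissible_def intro!: less le)
      moreover have "weight w P (?h m) = \<mu>'"
      proof (rule poly_mapping_eqI)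
        fix v'
        have "lookup (weight w P (?h m)) v' = (\<Sum>b | b \<in> P \<and> \<phi> (m b) = v'. w b)"
          using assms(1) by (auto simp: lookup_weight_fibre intro!: sum.cong)
        also have "\<dots> = lookup \<mu>' v'"
        proof (cases "v' \<in> keys \<mu>'")
          case True
          then obtain v where v: "v \<in> keys \<mu>" "v' = \<phi> v" using img by blast
          then have "{b. b \<in> P \<and> \<phi> (m b) = v'} = {b. b \<in> P \<and> m b = v}"
            using k[OF m] inj by (auto dest: inj_onD)
          then have "(\<Sum>b | b \<in> P \<and> \<phi> (m b) = v'. w b) = lookup \<mu> v"
            using m lookup_weight_fibre[OF assms(1), of w m v] by simp
          then show ?thesis using lookup v by simp
        next
          case False
          then have "{b. b \<in> P \<and> \<phi> (m b) = v'} = {}" using k[OF m] img by blast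
          then show ?thesis using False by (simp only: in_keys_iff) simp
        qed
        finally show "lookup (weight w P (?h m)) v' = lookup \<mu>' v'" .
      qed
      ultimately show "?h m \<in> ?A \<mu>'" by simp
    qed
    show "finite (?A \<mu>')" using assms(1,2) by (rule finite_admissible_fibre)
  qed
qed

text \<open>
  The support is finite because a filling takes at most \<open>card P\<close> values.
\<close>
lemma filling_gf_Qsym:
  assumes fin: "finite P" and w: "\<And>b. b \<in> P \<Longrightarrow> 1 \<le> w b"
  shows "filling_gf W T w P \<in> Qsym"
  unfolding Qsym_iff
proof
  show "quasi_symmetric (filling_gf W T w P)"
    unfolding quasi_symmetric_def coeff_filling_gf
  proof (intro conjI allI impI)
    fix \<mu> :: mono assume "0 \<in> keys \<mu>"
    moreover have "0 \<notin> keys (weight w P m)" if "m \<in> admissible W T P" for m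
      using that keys_weight[of P w m, OF fin w] by (auto simp: admissible_def dest: PiE_mem)
    ultimately have "{m \<in> admissible W T P. weight w P m = \<mu>} = {}" by blast
    then show "int (card {m \<in> admissible W T P. weight w P m = \<mu>}) = 0" by (simp only: card.empty of_nat_0)
  next
    fix \<mu> \<mu>' :: mono
    assume "0 \<notin> keys \<mu> \<and> 0 \<notin> keys \<mu>' \<and> exps \<mu> = exps \<mu>'"
    then show "int (card {m \<in> admissible W T P. weight w P m = \<mu>}) =
        int (card {m \<in> admissible W T P. weight w P m = \<mu>'})"
      using card_fibre_relabel_le[of P w \<mu> \<mu>' W T] card_fibre_relabel_le[of P w \<mu>' \<mu> W T] fin w by simp
  qed
  have "support (filling_gf W T w P) \<subseteq> (\<lambda>m. exps (weight w P m)) ` (P \<rightarrow>\<^sub>E {1..card P})"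
  proof
    fix \<gamma> assume "\<gamma> \<in> support (filling_gf W T w P)"
    then have \<gamma>: "\<gamma> \<in> compositions" and "{m \<in> admissible W T P. weight w P m = packed_mono \<gamma>} \<noteq> {}"
      by (auto simp: support_def coeff_filling_gf simp del: Collect_empty_eq)
    then obtain m where m: "m \<in> P \<rightarrow>\<^sub>E {1..}" "weight w P m = packed_mono \<gamma>"
      by (auto simp: admissible_def)
    have img: "m ` P = {1..length \<gamma>}"
      using keys_weight[of P w m, OF fin w] m(2) keys_packed_mono[OF \<gamma>] by simp
    then have "length \<gamma> \<le> card P" using card_image_le[OF fin, of m] by simp
    then have "m ` P \<subseteq> {1..card P}" using img by simp
    then have "m \<in> P \<rightarrow>\<^sub>E {1..card P}" using m(1) by (auto simp: PiE_iff)
    moreover have "\<gamma> = exps (weight w P m)" using m(2) exps_packed_mono[OF \<gamma>] by simp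
    ultimately show "\<gamma> \<in> (\<lambda>m. exps (weight w P m)) ` (P \<rightarrow>\<^sub>E {1..card P})" by blast
  qed
  then show "finite (support (filling_gf W T w P))"
    using fin by (meson finite_PiE finite_atLeastAtMost finite_imageI finite_subset)
qed

text \<open>
  The sets that can be cut off from \<open>P\<close> by a bound on the values of an admissible filling.
\<close>
definition lower_sets :: "('b \<Rightarrow> 'b \<Rightarrow> bool) \<Rightarrow> ('b \<Rightarrow> 'b \<Rightarrow> bool) \<Rightarrow> 'b set \<Rightarrow> 'b set set" where
  "lower_sets W T P = {I \<in> Pow P. \<forall>b \<in> P - I. \<forall>b' \<in> I. \<not> W b b' \<and> \<not> T b b'}"

lemma bij_betw_restrict_pair:
  assumes disj: "I \<inter> J = {}" and A: "A \<subseteq> I \<rightarrow>\<^sub>E {1..}" and B: "B \<subseteq> J \<rightarrow>\<^sub>E {1..}"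
  shows "bij_betw (\<lambda>m. (restrict m I, restrict m J))
    {m \<in> I \<union> J \<rightarrow>\<^sub>E {1 :: nat..}. restrict m I \<in> A \<and> restrict m J \<in> B} (A \<times> B)"
proof (rule bij_betw_byWitness[where f' = "\<lambda>(m, m'). \<lambda>b \<in> I \<union> J. if b \<in> I then m b else m' b"])
  let ?C = "{m \<in> I \<union> J \<rightarrow>\<^sub>E {1..}. restrict m I \<in> A \<and> restrict m J \<in> B}"
  let ?g = "\<lambda>(m, m'). \<lambda>b \<in> I \<union> J. if b \<in> I then m b else m' b"
  show "\<forall>m\<in>?C. ?g (restrict m I, restrict m J) = m"
    by (auto simp: fun_eq_iff PiE_def extensional_def)
  have g: "restrict (?g (m, m')) I = m \<and> restrict (?g (m, m')) J = m'" if "m \<in> A" "m' \<in> B" for m m'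
  proof -
    have "m \<in> extensional I" "m' \<in> extensional J" using that A B by (auto simp: PiE_def)
    then show ?thesis using disj by (auto simp: fun_eq_iff extensional_def)
  qed
  then show "\<forall>p \<in> A \<times> B. (restrict (?g p) I, restrict (?g p) J) = p" by auto
  show "(\<lambda>m. (restrict m I, restrict m J)) ` ?C \<subseteq> A \<times> B" by auto
  show "?g ` (A \<times> B) \<subseteq> ?C"
  proof (rule image_subsetI)
    fix p assume "p \<in> A \<times> B"
    then obtain m m' where p: "p = (m, m')" and m: "m \<in> A" "m' \<in> B" by blast
    have "m \<in> I \<rightarrow>\<^sub>E {1..}" "m' \<in> J \<rightarrow>\<^sub>E {1..}" using m A B by blast+
    then have "?g (m, m') \<in> I \<union> J \<rightarrow>\<^sub>E {1..}" by (auto dest: PiE_mem)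
    then show "?g p \<in> ?C" unfolding p using g[OF m] m by simp
  qed
qed

text \<open>
  The coproduct of a generating function of fillings, in terms of coefficients: \<open>I\<close> consists of the
  boxes that are filled with variables of \<open>\<mu>\<close>.
\<close>
lemma coeff_filling_gf_split:
  assumes fin: "finite P" and w: "\<And>b. b \<in> P \<Longrightarrow> 1 \<le> w b"
    and less: "\<And>u v. u \<in> keys \<mu> \<Longrightarrow> v \<in> keys \<mu>' \<Longrightarrow> u < v"
  shows "coeff (filling_gf W T w P) (\<mu> + \<mu>') =
    (\<Sum>I \<in> lower_sets W T P. coeff (filling_gf W T w I) \<mu> * coeff (filling_gf W T w (P - I)) \<mu>')"
proof -
  let ?A = "\<lambda>P \<mu>. {m \<in> admissible W T P. weight w P m = \<mu>}"
  let ?S = "\<lambda>I. {m \<in> P \<rightarrow>\<^sub>E {1..}. restrict m I \<in> ?A I \<mu> \<and> restrict m (P - I) \<in> ?A (P - I) \<mu>'}"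
  let ?I = "\<lambda>m. {b \<in> P. m b \<in> keys \<mu>}"
  have finA: "finite (?A Q \<mu>)" if "Q \<subseteq> P" for Q \<mu>
    using that fin w by (intro finite_admissible_fibre) (auto intro: finite_subset)
  have bij: "bij_betw (\<lambda>m. (restrict m I, restrict m (P - I))) (?S I) (?A I \<mu> \<times> ?A (P - I) \<mu>')" if "I \<subseteq> P" for I
  proof -
    have "I \<union> (P - I) = P" using that by blast
    then show ?thesis
      using bij_betw_restrict_pair[of I "P - I" "?A I \<mu>" "?A (P - I) \<mu>'"] by (simp add: admissible_def subset_iff)
  qed
  have wt: "weight w P m = weight w I (restrict m I) + weight w (P - I) (restrict m (P - I))" if "I \<subseteq> P" for I m
  proof -
    have "weight w I (restrict m I) = weight w I m" "weight w (P - I) (restrict m (P - I)) = weight w (P - I) m"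
      by (rule weight_cong; simp)+
    then show ?thesis using that weight_Un[of I "P - I" w m] fin finite_subset by (auto simp: Un_absorb1)
  qed
  have keys: "keys (weight w Q m) = m ` Q" if "Q \<subseteq> P" for Q m
    by (rule keys_weight) (use that fin w in \<open>auto intro: finite_subset\<close>)
  have S: "I = ?I m \<and> m \<in> ?A P (\<mu> + \<mu>')" if I: "I \<in> lower_sets W T P" and m: "m \<in> ?S I" for I m
  proof -
    have IP: "I \<subseteq> P" and no: "\<And>b b'. b \<in> P - I \<Longrightarrow> b' \<in> I \<Longrightarrow> \<not> W b b' \<and> \<not> T b b'"
      using I by (auto simp: lower_sets_def)
    have k: "keys \<mu> = m ` I" "keys \<mu>' = m ` (P - I)"
      using m keys[OF IP, of "restrict m I"] keys[OF Diff_subset, of I "restrict m (P - I)"] by auto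
    then have lt: "m b < m b'" if "b \<in> I" "b' \<in> P - I" for b b' using less that by blast
    have "m b \<in> keys \<mu> \<longleftrightarrow> b \<in> I" if "b \<in> P" for b
      using that lt k(1) by (metis DiffI image_iff less_irrefl)
    then have "I = ?I m" using IP by blast
    moreover have "W b b' \<longrightarrow> m b \<le> m b'" "T b b' \<longrightarrow> m b < m b'" if "b \<in> P" "b' \<in> P" for b b'
      using that m lt[of b b'] no[of b b'] by (cases "b \<in> I"; cases "b' \<in> I"; force simp: admissible_def)+
    then have "m \<in> admissible W T P" using m by (simp add: admissible_def)
    moreover have "weight w P m = \<mu> + \<mu>'" using wt[OF IP, of m] m by simp
    ultimately show ?thesis by simp
  qed
  have "?A P (\<mu> + \<mu>') = (\<Union>I \<in> lower_sets W T P. ?S I)"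
  proof (intro equalityI subsetI)
    fix m assume m: "m \<in> ?A P (\<mu> + \<mu>')"
    let ?J = "?I m"
    have "m ` P = keys (\<mu> + \<mu>')" using m keys[of P m] by simp
    then have k': "m b \<in> keys \<mu>'" if "b \<in> P - ?J" for b
      using that Poly_Mapping.keys_add[of \<mu> \<mu>'] by blast
    have eq: "weight w ?J (restrict m ?J) + weight w (P - ?J) (restrict m (P - ?J)) = \<mu> + \<mu>'"
      using m wt[of ?J m] by simp
    have "weight w ?J (restrict m ?J) = \<mu>"
    proof (rule poly_mapping_eqI)
      fix v
      have eq_v: "lookup (weight w ?J (restrict m ?J)) v +
          lookup (weight w (P - ?J) (restrict m (P - ?J))) v =
          lookup \<mu> v + lookup \<mu>' v"
        using arg_cong[OF eq, of "\<lambda>\<mu>. lookup \<mu> v"] by (simp add: lookup_add)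
      show "lookup (weight w ?J (restrict m ?J)) v = lookup \<mu> v"
      proof (cases "v \<in> keys \<mu>")
        case True
        then have "lookup \<mu>' v = 0" using less[of v v] by (meson in_keys_iff less_irrefl)
        moreover have "lookup (weight w (P - ?J) (restrict m (P - ?J))) v = 0"
          unfolding lookup_weight using True by (intro sum.neutral) auto
        ultimately show ?thesis using eq_v by simp
      next
        case False
        then have "lookup (weight w ?J (restrict m ?J)) v = 0"
          unfolding lookup_weight by (intro sum.neutral) auto
        then show ?thesis using False by (simp add: in_keys_iff)
      qed
    qed
    moreover from this eq have "weight w (P - ?J) (restrict m (P - ?J)) = \<mu>'" by simp
    moreover have "?J \<in> lower_sets W T P"
      unfolding lower_sets_def
    proof (intro CollectI conjI ballI)
      show "?J \<in> Pow P" by blast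
      fix b b' assume "b \<in> P - ?J" "b' \<in> ?J"
      then have "b \<in> P" "b' \<in> P" "m b' < m b" using less[of "m b'" "m b"] k'[of b] by auto
      moreover from this(1,2) have "W b b' \<longrightarrow> m b \<le> m b'" "T b b' \<longrightarrow> m b < m b'"
        using m by (auto simp: admissible_def)
      ultimately show "\<not> W b b'" "\<not> T b b'" by auto
    qed
    moreover have "m \<in> P \<rightarrow>\<^sub>E {1..}" "restrict m ?J \<in> admissible W T ?J" "restrict m (P - ?J) \<in> admissible W T (P - ?J)"
      using m by (auto simp: admissible_def)
    ultimately show "m \<in> (\<Union>I \<in> lower_sets W T P. ?S I)" by blast
  qed (use S in blast)
  then have "card (?A P (\<mu> + \<mu>')) = card (\<Union>I \<in> lower_sets W T P. ?S I)" by (rule arg_cong)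
  also have "\<dots> = (\<Sum>I \<in> lower_sets W T P. card (?S I))"
  proof (rule card_UN_disjoint)
    show "finite (lower_sets W T P)" using fin by (auto simp: lower_sets_def)
    show "\<forall>I \<in> lower_sets W T P. finite (?S I)"
    proof
      fix I assume I: "I \<in> lower_sets W T P"
      have "?S I \<subseteq> ?A P (\<mu> + \<mu>')" using S[OF I] by blast
      then show "finite (?S I)" by (rule finite_subset) (rule finA[OF order_refl])
    qed
    show "\<forall>I \<in> lower_sets W T P. \<forall>J \<in> lower_sets W T P. I \<noteq> J \<longrightarrow> ?S I \<inter> ?S J = {}"
    proof (intro ballI impI equals0I)
      fix I J m assume "I \<in> lower_sets W T P" "J \<in> lower_sets W T P" "I \<noteq> J" "m \<in> ?S I \<inter> ?S J"
      moreover from this have "I = ?I m" "J = ?I m" using S by blast+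
      ultimately show False by metis
    qed
  qed
  also have "\<dots> = (\<Sum>I \<in> lower_sets W T P. card (?A I \<mu>) * card (?A (P - I) \<mu>'))"
    using bij_betw_same_card[OF bij] by (intro sum.cong) (auto simp: lower_sets_def card_cartesian_product)
  finally show ?thesis by (simp add: coeff_filling_gf)
qed

section \<open>The antipode\<close>

lemma word_mono_append:
  assumes "length ms = length \<alpha>" "length ms' = length \<beta>"
  shows "word_mono (\<alpha> @ \<beta>) (ms @ ms') = word_mono \<alpha> ms + word_mono \<beta> ms'"
proof -
  let ?n = "length \<alpha>" and ?s = "\<lambda>k. Poly_Mapping.single ((ms @ ms') ! k) ((\<alpha> @ \<beta>) ! k)"
  have "{..<?n + length \<beta>} = {..<?n} \<union> (+) ?n ` {..<length \<beta>}"
  proof (rule set_eqI)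
    fix k show "k \<in> {..<?n + length \<beta>} \<longleftrightarrow> k \<in> {..<?n} \<union> (+) ?n ` {..<length \<beta>}"
      by (cases "k < ?n") (auto intro!: image_eqI[of _ _ "k - ?n"])
  qed
  then have "word_mono (\<alpha> @ \<beta>) (ms @ ms') = sum ?s ({..<?n} \<union> (+) ?n ` {..<length \<beta>})"
    by (simp add: word_mono_def)
  also have "\<dots> = sum ?s {..<?n} + sum ?s ((+) ?n ` {..<length \<beta>})"
    by (rule sum.union_disjoint) auto
  also have "sum ?s {..<?n} = word_mono \<alpha> ms"
    unfolding word_mono_def using assms by (intro sum.cong) (auto simp: nth_append)
  also have "sum ?s ((+) ?n ` {..<length \<beta>}) = word_mono \<beta> ms'"
    using assms(1) by (simp add: sum.reindex word_mono_def nth_append)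
  finally show ?thesis .
qed

lemma word_mono_rev:
  assumes "length ms = length \<gamma>"
  shows "word_mono (rev \<gamma>) (rev ms) = word_mono \<gamma> ms"
proof -
  have "word_mono (rev \<gamma>) (rev ms) =
      (\<Sum>k<length \<gamma>. Poly_Mapping.single (ms ! (length \<gamma> - Suc k)) (\<gamma> ! (length \<gamma> - Suc k)))"
    unfolding word_mono_def using assms by (intro sum.cong) (auto simp: rev_nth)
  also have "\<dots> = word_mono \<gamma> ms" unfolding word_mono_def by (rule sum.nat_diff_reindex)
  finally show ?thesis .
qed

lemma chain_sum_rev: "chain_sum rel (rev \<gamma>) = chain_sum (\<lambda>a b. rel b a) \<gamma>"
proof -
  let ?A = "\<lambda>rel. {ms. length ms = length \<gamma> \<and> (\<forall>m \<in> set ms. 1 \<le> m) \<and> sorted_wrt rel ms}"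
  have "bij_betw rev (?A (\<lambda>a b. rel b a)) (?A rel)"
    by (rule bij_betw_byWitness[where f' = rev]) (auto simp: sorted_wrt_rev)
  then have "monomial_sum (?A (\<lambda>a b. rel b a)) (word_mono \<gamma>) = monomial_sum (?A rel) (word_mono (rev \<gamma>))"
    by (rule monomial_sum_reindex) (simp add: word_mono_rev)
  then show ?thesis by (simp add: chain_sum_def)
qed

lemma finite_words:
  assumes "\<gamma> \<in> compositions"
  shows "finite {ms. length ms = length \<gamma> \<and> word_mono \<gamma> ms = \<mu>}"
proof (rule finite_subset)
  show "{ms. length ms = length \<gamma> \<and> word_mono \<gamma> ms = \<mu>} \<subseteq>
      {ms. set ms \<subseteq> keys \<mu> \<and> length ms = length \<gamma>}"
    using keys_word_mono[OF assms] by auto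
  show "finite {ms. set ms \<subseteq> keys \<mu> \<and> length ms = length \<gamma>}"
    by (rule finite_lists_length_eq) simp
qed

lemma finite_fibres_words:
  assumes "\<gamma> \<in> compositions" "\<And>ms. ms \<in> A \<Longrightarrow> length ms = length \<gamma>"
  shows "finite_fibres A (word_mono \<gamma>)"
  unfolding finite_fibres_def
proof
  fix \<mu> show "finite {ms \<in> A. word_mono \<gamma> ms = \<mu>}"
    using assms(2) by (intro finite_subset[OF _ finite_words[OF assms(1), of \<mu>]]) auto
qed

lemma chain_sum_mult:
  assumes "\<alpha> \<in> compositions" "\<beta> \<in> compositions"
  shows "chain_sum rel \<alpha> * chain_sum rel' \<beta> = monomial_sum
    {ms. length ms = length \<alpha> + length \<beta> \<and> (\<forall>m \<in> set ms. 1 \<le> m) \<and>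
      sorted_wrt rel (take (length \<alpha>) ms) \<and> sorted_wrt rel' (drop (length \<alpha>) ms)} (word_mono (\<alpha> @ \<beta>))"
    (is "_ = monomial_sum ?B _")
proof -
  let ?A = "\<lambda>rel \<gamma>. {ms. length ms = length \<gamma> \<and> (\<forall>m \<in> set ms. 1 \<le> m) \<and> sorted_wrt rel ms}"
  let ?n = "length \<alpha>"
  have "chain_sum rel \<alpha> * chain_sum rel' \<beta> =
      monomial_sum (?A rel \<alpha> \<times> ?A rel' \<beta>) (\<lambda>(ms, ms'). word_mono \<alpha> ms + word_mono \<beta> ms')"
    unfolding chain_sum_def
    by (rule monomial_sum_mult) (auto intro!: finite_fibres_words assms)
  also have "\<dots> = monomial_sum ?B (word_mono (\<alpha> @ \<beta>))"
  proof (rule monomial_sum_reindex)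
    show "bij_betw (\<lambda>(ms, ms'). ms @ ms') (?A rel \<alpha> \<times> ?A rel' \<beta>) ?B"
      by (rule bij_betw_byWitness[where f' = "\<lambda>ms. (take ?n ms, drop ?n ms)"])
        (auto dest: in_set_takeD in_set_dropD)
    show "\<And>p. p \<in> ?A rel \<alpha> \<times> ?A rel' \<beta> \<Longrightarrow>
        word_mono (\<alpha> @ \<beta>) (case p of (ms, ms') \<Rightarrow> ms @ ms') = (case p of (ms, ms') \<Rightarrow> word_mono \<alpha> ms + word_mono \<beta> ms')"
      by (auto simp: word_mono_append)
  qed
  finally show ?thesis .
qed

text \<open>
  If the first two letters are related by \<open>rel\<close>, then the summand of \<open>k = 0\<close> vanishes and the first
  letter can be removed; otherwise only \<open>k = 0\<close> and \<open>k = 1\<close> contribute, with opposite signs.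
\<close>
lemma alternating_sum_splits:
  fixes ms :: "'a list"
  assumes "transp rel" "transp rel'" "\<And>a b. rel' a b \<longleftrightarrow> \<not> rel a b" "ms \<noteq> []"
  shows "(\<Sum>k\<le>length ms. if sorted_wrt rel (take k ms) \<and> sorted_wrt rel' (drop k ms) then (- 1) ^ k else 0)
    = (0 :: int)"
  using assms(4)
proof (induction ms rule: list_nonempty_induct)
  case (single x)
  then show ?case by (simp add: atMost_Suc)
next
  case (cons x xs)
  let ?c = "\<lambda>ms k. if sorted_wrt rel (take k ms) \<and> sorted_wrt rel' (drop k ms) then (- 1) ^ k else (0 :: int)"
  obtain y ys where xs: "xs = y # ys" using cons.hyps by (cases xs) auto
  have split: "(\<Sum>k\<le>length (x # xs). ?c (x # xs) k) =
      ?c (x # xs) 0 + (\<Sum>k\<le>length xs. ?c (x # xs) (Suc k))"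
    by (simp only: length_Cons sum.atMost_Suc_shift)
  show ?case
  proof (cases "rel x y")
    case True
    have "rel x z" if "rel y z" for z using True that assms(1) by (meson transpD)
    then have "?c (x # xs) (Suc k) = - ?c xs k" if "k \<le> length xs" for k
      using True by (cases k) (auto simp: xs)
    moreover have "?c (x # xs) 0 = 0" using True assms(3) by (simp add: xs)
    ultimately show ?thesis unfolding split using cons.IH by (simp add: sum_negf)
  next
    case False
    then have xy: "rel' x y" using assms(3) by blast
    have tr: "rel' x z" if "rel' y z" for z using xy that assms(2) by (meson transpD)
    have "?c (x # xs) (Suc k) = (if k = 0 then - ?c (x # xs) 0 else 0)" for k
      using False xy tr by (cases k) (auto simp: xs)
    then show ?thesis unfolding split by simp
  qed
qed

lemma take_drop_compositions:
  "\<gamma> \<in> compositions \<Longrightarrow> take k \<gamma> \<in> compositions" "\<gamma> \<in> compositions \<Longrightarrow> drop k \<gamma> \<in> compositions"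
  by (auto simp: compositions_def dest: in_set_takeD in_set_dropD)

lemma chain_sum_Nil: "chain_sum rel [] = 1"
proof (rule series_eqI)
  fix \<mu>
  have "{ms. ms = [] \<and> (\<forall>m \<in> set ms. 1 \<le> m) \<and> sorted_wrt rel ms \<and> word_mono [] ms = \<mu>} =
    (if \<mu> = 0 then {[]} else {})" by (auto simp: word_mono_def)
  then show "coeff (chain_sum rel []) \<mu> = coeff 1 \<mu>"
    by (auto simp: chain_sum_def coeff_monomial_sum coeff_one word_mono_def)
qed

lemma card_filter_eq_sum: "finite X \<Longrightarrow> int (card {x \<in> X. Q x}) = (\<Sum>x\<in>X. if Q x then 1 else 0)"
  by (simp add: sum.inter_filter[symmetric])

text \<open>
  With \<open>\<ge>\<close> and \<open><\<close> in the one or the other order, this becomes the two equations that define the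
  antipode.
\<close>
lemma chain_sum_convolution:
  assumes "transp rel" "transp rel'" "\<And>a b. rel' a b \<longleftrightarrow> \<not> rel a b" "\<gamma> \<in> compositions"
  shows "(\<Sum>k\<le>length \<gamma>. (- 1) ^ k * (chain_sum rel (take k \<gamma>) * chain_sum rel' (drop k \<gamma>))) =
    (if \<gamma> = [] then 1 else 0)"
proof (cases "\<gamma> = []")
  case True
  then show ?thesis by (simp add: chain_sum_Nil)
next
  case False
  show ?thesis
  proof (rule series_eqI)
    fix \<mu>
    let ?n = "length \<gamma>"
    let ?X = "{ms. length ms = ?n \<and> (\<forall>m \<in> set ms. 1 \<le> m) \<and> word_mono \<gamma> ms = \<mu>}"
    let ?P = "\<lambda>k ms. sorted_wrt rel (take k ms) \<and> sorted_wrt rel' (drop k ms)"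
    have X: "finite ?X" by (rule finite_subset[OF _ finite_words[OF assms(4), of \<mu>]]) auto
    have c: "coeff (chain_sum rel (take k \<gamma>) * chain_sum rel' (drop k \<gamma>)) \<mu> =
        (\<Sum>ms\<in>?X. if ?P k ms then 1 else 0)" if "k \<le> ?n" for k
    proof -
      have "chain_sum rel (take k \<gamma>) * chain_sum rel' (drop k \<gamma>) = monomial_sum
          {ms. length ms = ?n \<and> (\<forall>m \<in> set ms. 1 \<le> m) \<and> ?P k ms} (word_mono \<gamma>)"
        using chain_sum_mult[OF take_drop_compositions[OF assms(4)], of rel k rel' k] that by simp
      then have "coeff (chain_sum rel (take k \<gamma>) * chain_sum rel' (drop k \<gamma>)) \<mu> = int (card {ms \<in> ?X. ?P k ms})"
        by (simp add: coeff_monomial_sum conj_ac cong: conj_cong)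
      also have "\<dots> = (\<Sum>ms\<in>?X. if ?P k ms then 1 else 0)"
        by (rule card_filter_eq_sum[OF X])
      finally show ?thesis .
    qed
    have "coeff (\<Sum>k\<le>?n. (- 1) ^ k * (chain_sum rel (take k \<gamma>) * chain_sum rel' (drop k \<gamma>))) \<mu> =
        (\<Sum>k\<le>?n. (- 1) ^ k * (\<Sum>ms\<in>?X. if ?P k ms then 1 else 0))"
      unfolding coeff_sum coeff_sign_mult by (intro sum.cong) (auto simp: c)
    also have "\<dots> = (\<Sum>k\<le>?n. \<Sum>ms\<in>?X. if ?P k ms then (- 1) ^ k else 0)"
      unfolding sum_distrib_left by (intro sum.cong) auto
    also have "\<dots> = (\<Sum>ms\<in>?X. \<Sum>k\<le>?n. if ?P k ms then (- 1) ^ k else 0)"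
      by (rule sum.swap)
    also have "\<dots> = 0"
    proof (rule sum.neutral, rule ballI)
      fix ms assume ms: "ms \<in> ?X"
      then have "ms \<noteq> []" using False by auto
      then show "(\<Sum>k\<le>?n. if ?P k ms then (- 1) ^ k else (0 :: int)) = 0"
        using alternating_sum_splits[OF assms(1-3), of ms] ms by simp
    qed
    finally show "coeff (\<Sum>k\<le>?n. (- 1) ^ k * (chain_sum rel (take k \<gamma>) * chain_sum rel' (drop k \<gamma>))) \<mu> =
        coeff (if \<gamma> = [] then 1 else 0) \<mu>" using False by simp
  qed
qed

definition hoffman_antipode :: "series \<Rightarrow> series" where
  "hoffman_antipode = (\<lambda>f \<in> Qsym. \<Sum>\<gamma> \<in> support f.
     of_int (coeff f (packed_mono \<gamma>)) * ((- 1) ^ length \<gamma> * E (rev \<gamma>)))"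

text \<open>
  \<open>E \<gamma>\<close> is the generating function of a chain with weak inequalities.
\<close>
lemma E_Qsym:
  assumes "\<gamma> \<in> compositions"
  shows "E \<gamma> \<in> Qsym"
proof -
  let ?P = "{..<length \<gamma>}"
  have "E \<gamma> = filling_gf (<) (\<lambda>_ _. False) (\<lambda>k. \<gamma> ! k) ?P"
    unfolding E_chain_sum filling_gf_def chain_sum_fillings[of id \<gamma> ?P "\<lambda>k. \<gamma> ! k", simplified]
    by (intro arg_cong2[where f = monomial_sum]) (auto simp: admissible_def)
  moreover have "1 \<le> \<gamma> ! k" if "k \<in> ?P" for k using assms that by (simp add: compositions_def)
  ultimately show ?thesis using filling_gf_Qsym[of ?P "\<lambda>k. \<gamma> ! k"] by simp
qed

lemma hoffman_antipode_eq:
  assumes "f \<in> Qsym" "finite A" "support f \<subseteq> A" "A \<subseteq> compositions"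
  shows "hoffman_antipode f = (\<Sum>\<gamma>\<in>A. of_int (coeff f (packed_mono \<gamma>)) * ((- 1) ^ length \<gamma> * E (rev \<gamma>)))"
  unfolding hoffman_antipode_def using assms
  by (auto simp: support_def intro!: sum.mono_neutral_left)

lemma hoffman_antipode_M:
  assumes "\<gamma> \<in> compositions"
  shows "hoffman_antipode (M \<gamma>) = (- 1) ^ length \<gamma> * E (rev \<gamma>)"
  using assms by (simp add: hoffman_antipode_def M_Qsym support_M coeff_M_packed)

lemma is_antipode_hoffman: "is_antipode hoffman_antipode"
  unfolding is_antipode_def
proof (intro conjI ballI)
  show "hoffman_antipode \<in> Qsym \<rightarrow>\<^sub>E Qsym"
  proof
    fix f assume "f \<in> Qsym"
    then have "hoffman_antipode f =
      (\<Sum>\<gamma> \<in> support f. of_int (coeff f (packed_mono \<gamma>)) * (of_int ((- 1) ^ length \<gamma>) * E (rev \<gamma>)))"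
      by (simp add: hoffman_antipode_def)
    also have "\<dots> \<in> Qsym"
      by (intro sum_Qsym scale_Qsym E_Qsym) (auto simp: support_def compositions_def)
    finally show "hoffman_antipode f \<in> Qsym" .
  qed (simp add: hoffman_antipode_def)
next
  fix f g assume fg: "f \<in> Qsym" "g \<in> Qsym"
  let ?A = "support f \<union> support g"
  have A: "finite ?A" "?A \<subseteq> compositions" using fg by (auto simp: Qsym_iff support_def)
  have "support (f + g) \<subseteq> ?A" by (auto simp: support_def)
  then show "hoffman_antipode (f + g) = hoffman_antipode f + hoffman_antipode g"
    using hoffman_antipode_eq[OF fg(1) A(1) _ A(2)] hoffman_antipode_eq[OF fg(2) A(1) _ A(2)]
      hoffman_antipode_eq[OF add_Qsym[OF fg] A(1) _ A(2)]
    by (simp add: sum.distrib distrib_right)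
next
  fix \<gamma> assume \<gamma>: "\<gamma> \<in> compositions"
  have S: "hoffman_antipode (M (take k \<gamma>)) = (- 1) ^ k * chain_sum (\<ge>) (take k \<gamma>)"
    "hoffman_antipode (M (drop k \<gamma>)) = (- 1) ^ (length \<gamma> - k) * chain_sum (\<ge>) (drop k \<gamma>)"
    if "k \<le> length \<gamma>" for k
    using that take_drop_compositions[OF \<gamma>]
    by (simp_all add: hoffman_antipode_M E_chain_sum chain_sum_rev)
  have "(\<Sum>k\<le>length \<gamma>. hoffman_antipode (M (take k \<gamma>)) * M (drop k \<gamma>)) =
      (\<Sum>k\<le>length \<gamma>. (- 1) ^ k * (chain_sum (\<ge>) (take k \<gamma>) * chain_sum (<) (drop k \<gamma>)))"
  proof (rule sum.cong)
    fix k assume "k \<in> {..length \<gamma>}"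
    then show "hoffman_antipode (M (take k \<gamma>)) * M (drop k \<gamma>) =
        (- 1) ^ k * (chain_sum (\<ge>) (take k \<gamma>) * chain_sum (<) (drop k \<gamma>))"
      by (simp add: S(1) mult.assoc) (simp add: M_chain_sum)
  qed simp
  also have "\<dots> = (if \<gamma> = [] then 1 else 0)"
    by (rule chain_sum_convolution) (auto simp: \<gamma> transp_def)
  finally show "(\<Sum>k\<le>length \<gamma>. hoffman_antipode (M (take k \<gamma>)) * M (drop k \<gamma>)) = (if \<gamma> = [] then 1 else 0)" .
  have "(\<Sum>k\<le>length \<gamma>. M (take k \<gamma>) * hoffman_antipode (M (drop k \<gamma>))) =
      (\<Sum>k\<le>length \<gamma>. (- 1) ^ length \<gamma> * ((- 1) ^ k * (chain_sum (<) (take k \<gamma>) * chain_sum (\<ge>) (drop k \<gamma>))))"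
  proof (rule sum.cong)
    fix k assume "k \<in> {..length \<gamma>}"
    then have k: "k \<le> length \<gamma>" by simp
    then have "(- 1 :: series) ^ (length \<gamma> - k) = (- 1) ^ length \<gamma> * (- 1) ^ k"
      by (simp flip: neg_one_power_add_eq_neg_one_power_diff add: power_add)
    then show "M (take k \<gamma>) * hoffman_antipode (M (drop k \<gamma>)) =
        (- 1) ^ length \<gamma> * ((- 1) ^ k * (chain_sum (<) (take k \<gamma>) * chain_sum (\<ge>) (drop k \<gamma>)))"
      unfolding S(2)[OF k] unfolding M_chain_sum by (simp add: mult_ac)
  qed simp
  also have "\<dots> = (- 1) ^ length \<gamma> * (if \<gamma> = [] then 1 else 0)"
    unfolding sum_distrib_left[symmetric]
    by (subst chain_sum_convolution) (auto simp: \<gamma> transp_def)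
  finally show "(\<Sum>k\<le>length \<gamma>. M (take k \<gamma>) * hoffman_antipode (M (drop k \<gamma>))) = (if \<gamma> = [] then 1 else 0)"
    by simp
qed

lemma additive_Qsym:
  assumes S: "\<And>f g. f \<in> Qsym \<Longrightarrow> g \<in> Qsym \<Longrightarrow> S (f + g) = S f + (S g :: series)"
  shows "finite A \<Longrightarrow> A \<subseteq> compositions \<Longrightarrow>
    S (\<Sum>\<gamma>\<in>A. of_int (c \<gamma>) * M \<gamma>) = (\<Sum>\<gamma>\<in>A. of_int (c \<gamma>) * S (M \<gamma>))"
proof -
  have zero: "S 0 = 0" using S[OF zero_Qsym zero_Qsym] by simp
  have nat: "S (of_nat n * f) = of_nat n * S f" if "f \<in> Qsym" for n f
  proof (induction n)
    case (Suc n)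
    have "of_nat n * f \<in> Qsym" using scale_Qsym[OF that, of "int n"] by simp
    then show ?case using Suc S[OF that, of "of_nat n * f"] by (simp add: distrib_right)
  qed (simp add: zero)
  have int: "S (of_int c * f) = of_int c * S f" if f: "f \<in> Qsym" for c f
  proof (cases c rule: int_cases2)
    case (nonneg n)
    then show ?thesis using nat[OF f] by simp
  next
    case (nonpos n)
    have "of_nat n * f \<in> Qsym" "- (of_nat n * f) \<in> Qsym"
      using scale_Qsym[OF f, of "int n"] scale_Qsym[OF f, of "- int n"] by simp_all
    then have "S (- (of_nat n * f)) + S (of_nat n * f) = 0"
      using S[of "- (of_nat n * f)" "of_nat n * f"] zero by simp
    then show ?thesis using nonpos nat[OF f, of n] by (simp add: add_eq_0_iff)
  qed
  show "finite A \<Longrightarrow> A \<subseteq> compositions \<Longrightarrow> ?thesis"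
  proof (induction A rule: finite_induct)
    case (insert \<gamma> A)
    then show ?case
      by (simp add: S int M_Qsym scale_Qsym sum_Qsym subset_iff)
  qed (simp add: zero)
qed

text \<open>
  In the first convolution equation the summand \<open>k = length \<gamma>\<close> is \<open>S (M \<gamma>)\<close>, and the other summands
  only involve shorter compositions.
\<close>
lemma is_antipode_unique:
  assumes "is_antipode S" "is_antipode S'"
  shows "S = S'"
proof -
  have M: "S (M \<gamma>) = S' (M \<gamma>)" if "\<gamma> \<in> compositions" for \<gamma>
    using that
  proof (induction \<gamma> rule: length_induct)
    case (1 \<gamma>)
    have rec: "S (M \<gamma>) = (if \<gamma> = [] then 1 else 0) - (\<Sum>k<length \<gamma>. S (M (take k \<gamma>)) * M (drop k \<gamma>))"
      if "is_antipode S" for S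
    proof -
      have "S (M \<gamma>) * M (drop (length \<gamma>) \<gamma>) = S (M \<gamma>)" by (simp add: M_chain_sum chain_sum_Nil)
      moreover have "(\<Sum>k\<le>length \<gamma>. S (M (take k \<gamma>)) * M (drop k \<gamma>)) = (if \<gamma> = [] then 1 else 0)"
        using that 1(2) by (simp add: is_antipode_def)
      ultimately show ?thesis by (simp add: lessThan_Suc_atMost[symmetric] algebra_simps)
    qed
    have "S (M (take k \<gamma>)) = S' (M (take k \<gamma>))" if "k < length \<gamma>" for k
      using 1 that take_drop_compositions(1)[of \<gamma> k] by simp
    then show ?case unfolding rec[OF assms(1)] rec[OF assms(2)] by simp
  qed
  show ?thesis
  proof
    fix f
    show "S f = S' f"
    proof (cases "f \<in> Qsym")
      case True
      then obtain A c where A: "finite A" "A \<subseteq> compositions" and f: "f = (\<Sum>\<gamma>\<in>A. of_int (c \<gamma>) * M \<gamma>)"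
        by (auto simp: Qsym_def)
      have "S f = (\<Sum>\<gamma>\<in>A. of_int (c \<gamma>) * S (M \<gamma>))" "S' f = (\<Sum>\<gamma>\<in>A. of_int (c \<gamma>) * S' (M \<gamma>))"
        unfolding f using assms A by (auto intro!: additive_Qsym simp: is_antipode_def)
      moreover have "(\<Sum>\<gamma>\<in>A. of_int (c \<gamma>) * S (M \<gamma>)) = (\<Sum>\<gamma>\<in>A. of_int (c \<gamma>) * S' (M \<gamma>))"
        using A(2) M by (intro sum.cong) auto
      ultimately show ?thesis by simp
    next
      case False
      then show ?thesis using assms by (auto simp: is_antipode_def PiE_def extensional_def)
    qed
  qed
qed

lemma is_antipode_antipode: "is_antipode antipode"
  unfolding antipode_def
  by (rule theI[of is_antipode, OF is_antipode_hoffman]) (rule is_antipode_unique[OF _ is_antipode_hoffman])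

section \<open>Reversing all inequalities\<close>

text \<open>
  The coproduct again, now in the basis \<open>M\<close>, where it is deconcatenation.
\<close>
lemma coeff_filling_gf_append:
  assumes fin: "finite P" and w: "\<And>b. b \<in> P \<Longrightarrow> 1 \<le> w b"
    and \<alpha>: "\<alpha> \<in> compositions" and \<beta>: "\<beta> \<in> compositions"
  shows "(\<Sum>I \<in> lower_sets W T P. coeff (filling_gf W T w I) (packed_mono \<alpha>) *
      coeff (filling_gf W T w (P - I)) (packed_mono \<beta>)) = coeff (filling_gf W T w P) (packed_mono (\<alpha> @ \<beta>))"
proof -
  let ?n = "length \<alpha>"
  define ms where "ms = [Suc ?n..<Suc ?n + length \<beta>]"
  have ms: "length ms = length \<beta>" "sorted_wrt (<) ms" "set ms = {Suc ?n..<Suc ?n + length \<beta>}"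
    unfolding ms_def by (simp_all only: length_upt sorted_wrt_upt set_upt diff_add_inverse)
  define \<mu> where "\<mu> = word_mono \<beta> ms"
  have k: "keys \<mu> = {Suc ?n..<Suc ?n + length \<beta>}" and e: "exps \<mu> = \<beta>"
    using keys_word_mono[OF \<beta> ms(1)] exps_word_mono[OF \<beta> ms(1,2)] ms(3) by (simp_all add: \<mu>_def)
  have "packed_mono (\<alpha> @ \<beta>) = word_mono (\<alpha> @ \<beta>) ([1..<Suc ?n] @ ms)"
    unfolding packed_mono_def ms_def
    using upt_add_eq_append[of 1 "Suc ?n" "length \<beta>"] by (simp del: upt_Suc)
  also have "\<dots> = packed_mono \<alpha> + \<mu>"
    unfolding packed_mono_def \<mu>_def by (rule word_mono_append) (simp_all only: length_upt diff_Suc_1 ms(1))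
  finally have packed: "packed_mono (\<alpha> @ \<beta>) = packed_mono \<alpha> + \<mu>" .
  have "coeff (filling_gf W T w P) (packed_mono (\<alpha> @ \<beta>)) =
      (\<Sum>I \<in> lower_sets W T P. coeff (filling_gf W T w I) (packed_mono \<alpha>) * coeff (filling_gf W T w (P - I)) \<mu>)"
    unfolding packed using keys_packed_mono[OF \<alpha>] k by (intro coeff_filling_gf_split[OF fin w]) auto
  moreover have "coeff (filling_gf W T w (P - I)) \<mu> = coeff (filling_gf W T w (P - I)) (packed_mono \<beta>)" for I
  proof (rule quasi_symmetricD(2))
    show "quasi_symmetric (filling_gf W T w (P - I))"
      using filling_gf_Qsym[of "P - I" w W T] fin w by (simp add: Qsym_iff)
  qed (use k e keys_packed_mono[OF \<beta>] exps_packed_mono[OF \<beta>] in auto)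
  ultimately show ?thesis by simp
qed

text \<open>
  The equation \<open>mult \<circ> (S \<otimes> id) \<circ> \<Delta> = unit \<circ> counit\<close>, applied to a generating function of
  fillings. It follows from the equation on the basis by bilinearity.
\<close>
lemma antipode_filling_gf_convolution:
  assumes S: "is_antipode S" and fin: "finite P" and w: "\<And>b. b \<in> P \<Longrightarrow> 1 \<le> w b" and ne: "P \<noteq> {}"
  shows "(\<Sum>I \<in> lower_sets W T P. S (filling_gf W T w I) * filling_gf W T w (P - I)) = 0"
proof -
  let ?K = "filling_gf W T w"
  let ?c = "\<lambda>I \<gamma>. coeff (?K I) (packed_mono \<gamma>)"
  define D where "D = support (?K P)"
  \<comment> \<open>A finite set of compositions over which all functions involved can be expanded, and which contains
    the two parts of every composition that occurs in \<open>?K P\<close>.\<close>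
  define C where "C = (\<Union>I \<in> Pow P. support (?K I)) \<union> (\<Union>\<delta> \<in> D. \<Union>k \<in> {..length \<delta>}. {take k \<delta>, drop k \<delta>})"
  have Q: "?K I \<in> Qsym" if "I \<subseteq> P" for I
    using that fin w by (intro filling_gf_Qsym) (auto intro: finite_subset)
  have D: "finite D" "D \<subseteq> compositions" using Q[of P] by (auto simp: D_def Qsym_iff support_def)
  have "finite C" using D Q fin by (auto simp: C_def Qsym_iff)
  have C: "C \<subseteq> compositions" using D(2) by (auto simp: C_def support_def take_drop_compositions)
  have cut: "take k \<delta> \<in> C \<and> drop k \<delta> \<in> C" if "\<delta> \<in> D" "k \<le> length \<delta>" for k \<delta>
    using that unfolding C_def by blast
  have add: "S (f + g) = S f + S g" if "f \<in> Qsym" "g \<in> Qsym" for f g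
    using S that by (simp add: is_antipode_def)
  have exp: "?K I = (\<Sum>\<gamma>\<in>C. of_int (?c I \<gamma>) * M \<gamma>)" if "I \<subseteq> P" for I
    using that Q[OF that] \<open>finite C\<close> C
    by (intro quasi_symmetric_expansion) (auto simp: Qsym_iff C_def)
  have Sexp: "S (?K I) = (\<Sum>\<gamma>\<in>C. of_int (?c I \<gamma>) * S (M \<gamma>))" if "I \<subseteq> P" for I
    by (subst exp[OF that]) (rule additive_Qsym[of S, OF add \<open>finite C\<close> C])
  have "(\<Sum>I \<in> lower_sets W T P. S (?K I) * ?K (P - I)) =
      (\<Sum>I \<in> lower_sets W T P. \<Sum>p \<in> C \<times> C. of_int (?c I (fst p) * ?c (P - I) (snd p)) * (S (M (fst p)) * M (snd p)))"
  proof (rule sum.cong)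
    fix I assume "I \<in> lower_sets W T P"
    then have I: "I \<subseteq> P" "P - I \<subseteq> P" by (auto simp: lower_sets_def)
    have "S (?K I) * ?K (P - I) = (\<Sum>\<gamma>\<in>C. of_int (?c I \<gamma>) * S (M \<gamma>)) * (\<Sum>\<gamma>\<in>C. of_int (?c (P - I) \<gamma>) * M \<gamma>)"
      using Sexp[OF I(1)] exp[OF I(2)] by (rule arg_cong2[where f = times])
    also have "\<dots> = (\<Sum>p \<in> C \<times> C. of_int (?c I (fst p) * ?c (P - I) (snd p)) * (S (M (fst p)) * M (snd p)))"
      unfolding sum_product sum.cartesian_product by (intro sum.cong) (auto simp: mult_ac)
    finally show "S (?K I) * ?K (P - I) = \<dots>" .
  qed simp
  also have "\<dots> = (\<Sum>p \<in> C \<times> C. \<Sum>I \<in> lower_sets W T P. of_int (?c I (fst p) * ?c (P - I) (snd p)) * (S (M (fst p)) * M (snd p)))"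
    by (rule sum.swap)
  also have "\<dots> = (\<Sum>p \<in> C \<times> C. of_int (?c P (fst p @ snd p)) * (S (M (fst p)) * M (snd p)))"
  proof (rule sum.cong)
    fix p assume "p \<in> C \<times> C"
    then have p: "fst p \<in> compositions" "snd p \<in> compositions" using C by auto
    have "?c P (fst p @ snd p) = (\<Sum>I \<in> lower_sets W T P. ?c I (fst p) * ?c (P - I) (snd p))"
      by (rule coeff_filling_gf_append[OF fin w p, symmetric])
    then show "(\<Sum>I \<in> lower_sets W T P. of_int (?c I (fst p) * ?c (P - I) (snd p)) * (S (M (fst p)) * M (snd p))) =
        of_int (?c P (fst p @ snd p)) * (S (M (fst p)) * M (snd p))"
      by (simp only: of_int_sum sum_distrib_right)
  qed simp
  also have "\<dots> = (\<Sum>p \<in> {p. fst p @ snd p \<in> D}. of_int (?c P (fst p @ snd p)) * (S (M (fst p)) * M (snd p)))"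
  proof (rule sum.mono_neutral_right)
    show "finite (C \<times> C)" using \<open>finite C\<close> by simp
    show "{p. fst p @ snd p \<in> D} \<subseteq> C \<times> C"
    proof
      fix p assume "p \<in> {p. fst p @ snd p \<in> D}"
      then have "take (length (fst p)) (fst p @ snd p) \<in> C \<and> drop (length (fst p)) (fst p @ snd p) \<in> C"
        by (intro cut) simp_all
      then show "p \<in> C \<times> C" by (simp add: mem_Times_iff)
    qed
    have "?c P (fst p @ snd p) = 0" if "p \<in> C \<times> C - {p. fst p @ snd p \<in> D}" for p
    proof -
      have "fst p @ snd p \<in> compositions" using that C by (auto simp: compositions_def)
      then show ?thesis using that by (auto simp: D_def support_def)
    qed
    then show "\<forall>p \<in> C \<times> C - {p. fst p @ snd p \<in> D}.
        of_int (?c P (fst p @ snd p)) * (S (M (fst p)) * M (snd p)) = 0" by simp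
  qed
  also have "\<dots> = (\<Sum>(\<delta>, k) \<in> Sigma D (\<lambda>\<delta>. {..length \<delta>}). of_int (?c P \<delta>) * (S (M (take k \<delta>)) * M (drop k \<delta>)))"
    by (rule sum.reindex_bij_witness[of _ "\<lambda>(\<delta>, k). (take k \<delta>, drop k \<delta>)" "\<lambda>p. (fst p @ snd p, length (fst p))"]) auto
  also have "\<dots> = (\<Sum>\<delta>\<in>D. \<Sum>k\<le>length \<delta>. of_int (?c P \<delta>) * (S (M (take k \<delta>)) * M (drop k \<delta>)))"
    by (rule sum.Sigma[symmetric]) (use D(1) in auto)
  also have "\<dots> = 0"
  proof (rule sum.neutral, rule ballI)
    fix \<delta> assume \<delta>: "\<delta> \<in> D"
    have "\<delta> \<noteq> []"
    proof
      assume "\<delta> = []"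
      then have "?c P [] \<noteq> 0" using \<delta> by (simp add: D_def support_def)
      then have "{m \<in> admissible W T P. weight w P m = packed_mono []} \<noteq> {}"
        unfolding coeff_filling_gf by (metis card.empty of_nat_0)
      then obtain m where "weight w P m = packed_mono []" by blast
      moreover have "keys (weight w P m) = m ` P" by (rule keys_weight[OF fin w])
      ultimately show False using ne keys_packed_mono[of "[]"] by (simp add: compositions_def)
    qed
    moreover have "\<delta> \<in> compositions" using \<delta> D by blast
    ultimately have "(\<Sum>k\<le>length \<delta>. S (M (take k \<delta>)) * M (drop k \<delta>)) = 0"
      using S by (simp add: is_antipode_def)
    then show "(\<Sum>k\<le>length \<delta>. of_int (?c P \<delta>) * (S (M (take k \<delta>)) * M (drop k \<delta>))) = 0"
      by (simp flip: sum_distrib_left)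
  qed
  finally show ?thesis .
qed

lemma filling_gf_mult:
  assumes "finite I" "finite J" "I \<inter> J = {}" "\<And>b. b \<in> I \<union> J \<Longrightarrow> 1 \<le> w b"
  shows "filling_gf W T w I * filling_gf W' T' w J = monomial_sum
    {m \<in> I \<union> J \<rightarrow>\<^sub>E {1..}. restrict m I \<in> admissible W T I \<and> restrict m J \<in> admissible W' T' J} (weight w (I \<union> J))"
proof -
  let ?A = "admissible W T I" and ?B = "admissible W' T' J"
  let ?C = "{m \<in> I \<union> J \<rightarrow>\<^sub>E {1..}. restrict m I \<in> ?A \<and> restrict m J \<in> ?B}"
  have "filling_gf W T w I * filling_gf W' T' w J = monomial_sum (?A \<times> ?B) (\<lambda>(m, m'). weight w I m + weight w J m')"
    unfolding filling_gf_def
    by (rule monomial_sum_mult) (use assms in \<open>auto intro!: finite_fibres_admissible\<close>)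
  also have "\<dots> = monomial_sum ?C (weight w (I \<union> J))"
  proof (rule monomial_sum_reindex[symmetric])
    show "bij_betw (\<lambda>m. (restrict m I, restrict m J)) ?C (?A \<times> ?B)"
      by (rule bij_betw_restrict_pair[OF assms(3)]) (auto simp: admissible_def)
    fix m
    have "weight w I (restrict m I) = weight w I m" "weight w J (restrict m J) = weight w J m"
      by (rule weight_cong; simp)+
    then show "(\<lambda>(m, m'). weight w I m + weight w J m') (restrict m I, restrict m J) = weight w (I \<union> J) m"
      using weight_Un[OF assms(1-3)] by simp
  qed
  finally show ?thesis .
qed

lemma sum_sign_toggle:
  assumes "finite \<I>" "\<And>I. I \<in> \<I> \<Longrightarrow> finite I" "\<And>I. x \<notin> I \<Longrightarrow> I \<in> \<I> \<longleftrightarrow> insert x I \<in> \<I>"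
  shows "(\<Sum>I\<in>\<I>. (- 1) ^ card I) = (0 :: int)"
proof -
  let ?t = "\<lambda>I. if x \<in> I then I - {x} else insert x I"
  have t: "?t I \<in> \<I>" if "I \<in> \<I>" for I
    using that assms(3)[of "I - {x}"] assms(3)[of I] by (auto simp: insert_absorb)
  have "(\<Sum>I\<in>\<I>. (- 1) ^ card I) = (\<Sum>I\<in>\<I>. - ((- 1) ^ card I) :: int)"
  proof (rule sum.reindex_bij_witness[of _ ?t ?t])
    fix I assume I: "I \<in> \<I>"
    show "?t I \<in> \<I>" by (rule t[OF I])
    show "?t (?t I) = I" by auto
    show "?t I \<in> \<I>" by (rule t[OF I])
    show "?t (?t I) = I" by auto
    show "- ((- 1) ^ card (?t I)) = ((- 1) ^ card I :: int)"
    proof (cases "x \<in> I")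
      case True
      then show ?thesis
        unfolding card_Suc_Diff1[OF assms(2)[OF I] True, symmetric] by simp
    qed (use assms(2)[OF I] in simp)
  qed
  then show ?thesis by (simp add: sum_negf)
qed

text \<open>
  The summand \<open>I\<close> of the recursion counts the fillings \<open>u\<close> of \<open>P\<close> that satisfy the reversed
  inequalities on \<open>I\<close> and the original ones on \<open>P - I\<close>.
\<close>
definition reconciled :: "('b \<Rightarrow> 'b \<Rightarrow> bool) \<Rightarrow> ('b \<Rightarrow> 'b \<Rightarrow> bool) \<Rightarrow> 'b set \<Rightarrow> ('b \<Rightarrow> nat) \<Rightarrow> 'b set set" where
  "reconciled W T P u = {I \<in> lower_sets W T P.
     (\<forall>b \<in> I. \<forall>b' \<in> I. (W b b' \<longrightarrow> u b' < u b) \<and> (T b b' \<longrightarrow> u b' \<le> u b)) \<and>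
     (\<forall>b \<in> P - I. \<forall>b' \<in> P - I. (W b b' \<longrightarrow> u b \<le> u b') \<and> (T b b' \<longrightarrow> u b < u b'))}"

text \<open>
  Choose \<open>x\<close> with the least value \<open>u x\<close> and, among those, with the least \<open>h x\<close>. Then \<open>x\<close> can be moved
  between \<open>I\<close> and \<open>P - I\<close>: the least value is allowed at the bottom of \<open>P - I\<close> as well as at the top
  of \<open>I\<close>, except that ties might break a strict inequality. They cannot, since the boxes that come
  before \<open>x\<close> in \<open>W\<close> or after \<open>x\<close> in \<open>T\<close> have a smaller \<open>h\<close>, and therefore a larger value.
\<close>
lemma sum_reconciled:
  fixes h :: "'b \<Rightarrow> int"
  assumes fin: "finite P" and ne: "P \<noteq> {}"
    and hW: "\<And>b b'. b \<in> P \<Longrightarrow> b' \<in> P \<Longrightarrow> W b b' \<Longrightarrow> h b < h b'"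
    and hT: "\<And>b b'. b \<in> P \<Longrightarrow> b' \<in> P \<Longrightarrow> T b b' \<Longrightarrow> h b' < h b"
  shows "(\<Sum>I \<in> reconciled W T P u. (- 1) ^ card I) = (0 :: int)"
proof -
  obtain y where y: "y \<in> P" "\<And>b. b \<in> P \<Longrightarrow> u y \<le> u b"
    using ex_min_if_finite[of "u ` P"] fin ne by (auto simp: not_less)
  let ?X = "{b \<in> P. u b = u y}"
  have "finite (h ` ?X)" "h ` ?X \<noteq> {}" using fin y(1) by auto
  then obtain x where x: "x \<in> P" "u x = u y" "\<And>b. b \<in> P \<Longrightarrow> u b = u y \<Longrightarrow> h x \<le> h b"
    using ex_min_if_finite[of "h ` ?X"] by (auto simp: not_less)
  have ux: "u x \<le> u b" if "b \<in> P" for b using x(2) y(2)[OF that] by simp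
  have hx: "u x < u b" if "b \<in> P" "h b < h x" for b
    using ux[OF that(1)] x(2) x(3)[OF that(1)] that(2) by fastforce
  have toW: "u x < u b" if "b \<in> P" "W b x" for b using hx[OF that(1)] hW[OF that(1) x(1) that(2)] by simp
  have fromT: "u x < u b" if "b \<in> P" "T x b" for b using hx[OF that(1)] hT[OF x(1) that(1,2)] by simp
  have irrefl: "\<not> W x x" "\<not> T x x" using hW[OF x(1) x(1)] hT[OF x(1) x(1)] by auto
  show ?thesis
  proof (rule sum_sign_toggle[where x = x])
    show "finite (reconciled W T P u)" using fin by (auto simp: reconciled_def lower_sets_def)
    show "finite I" if "I \<in> reconciled W T P u" for I
      using that fin by (auto simp: reconciled_def lower_sets_def intro: finite_subset)
    fix I assume xI: "x \<notin> I"
    show "I \<in> reconciled W T P u \<longleftrightarrow> insert x I \<in> reconciled W T P u"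
    proof
      assume I: "I \<in> reconciled W T P u"
      then have IP: "I \<subseteq> P" and
        no: "\<And>b b'. b \<in> P - I \<Longrightarrow> b' \<in> I \<Longrightarrow> \<not> W b b' \<and> \<not> T b b'" and
        inI: "\<And>b b'. b \<in> I \<Longrightarrow> b' \<in> I \<Longrightarrow> (W b b' \<longrightarrow> u b' < u b) \<and> (T b b' \<longrightarrow> u b' \<le> u b)" and
        outI: "\<And>b b'. b \<in> P - I \<Longrightarrow> b' \<in> P - I \<Longrightarrow> (W b b' \<longrightarrow> u b \<le> u b') \<and> (T b b' \<longrightarrow> u b < u b')"
        by (auto simp: reconciled_def lower_sets_def)
      have x': "x \<in> P - I" using x(1) xI by simp
      show "insert x I \<in> reconciled W T P u"
        unfolding reconciled_def lower_sets_def
      proof (intro CollectI conjI ballI)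
        show "insert x I \<in> Pow P" using IP x(1) by simp
        fix b b' assume b: "b \<in> P - insert x I" "b' \<in> insert x I"
        show "\<not> W b b'" using b no[of b b'] toW[of b] outI[of b x] x' by fastforce
        show "\<not> T b b'" using b no[of b b'] ux[of b] outI[of b x] x' by fastforce
      next
        fix b b' assume b: "b \<in> insert x I" "b' \<in> insert x I"
        show "W b b' \<longrightarrow> u b' < u b" using b inI[of b b'] no[of x b'] toW[of b] x' irrefl IP by auto
        show "T b b' \<longrightarrow> u b' \<le> u b" using b inI[of b b'] no[of x b'] ux[of b] x' irrefl IP by auto
      next
        fix b b' assume b: "b \<in> P - insert x I" "b' \<in> P - insert x I"
        show "W b b' \<longrightarrow> u b \<le> u b'" "T b b' \<longrightarrow> u b < u b'" using b outI[of b b'] by auto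
      qed
    next
      assume I: "insert x I \<in> reconciled W T P u"
      then have IP: "I \<subseteq> P" and
        no: "\<And>b b'. b \<in> P - insert x I \<Longrightarrow> b' \<in> insert x I \<Longrightarrow> \<not> W b b' \<and> \<not> T b b'" and
        inI: "\<And>b b'. b \<in> insert x I \<Longrightarrow> b' \<in> insert x I \<Longrightarrow> (W b b' \<longrightarrow> u b' < u b) \<and> (T b b' \<longrightarrow> u b' \<le> u b)" and
        outI: "\<And>b b'. b \<in> P - insert x I \<Longrightarrow> b' \<in> P - insert x I \<Longrightarrow> (W b b' \<longrightarrow> u b \<le> u b') \<and> (T b b' \<longrightarrow> u b < u b')"
        unfolding reconciled_def lower_sets_def by blast+
      show "I \<in> reconciled W T P u"
        unfolding reconciled_def lower_sets_def
      proof (intro CollectI conjI ballI)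
        show "I \<in> Pow P" using IP by simp
        fix b b' assume b: "b \<in> P - I" "b' \<in> I"
        show "\<not> W b b'" using b no[of b b'] inI[of x b'] ux[of b'] IP by fastforce
        show "\<not> T b b'" using b no[of b b'] inI[of x b'] fromT[of b'] IP by fastforce
      next
        fix b b' assume b: "b \<in> I" "b' \<in> I"
        show "W b b' \<longrightarrow> u b' < u b" "T b b' \<longrightarrow> u b' \<le> u b" using b inI[of b b'] by auto
      next
        fix b b' assume b: "b \<in> P - I" "b' \<in> P - I"
        show "W b b' \<longrightarrow> u b \<le> u b'" using b outI[of b b'] no[of b x] ux[of b'] by fastforce
        show "T b b' \<longrightarrow> u b < u b'" using b outI[of b b'] no[of b x] fromT[of b'] irrefl by fastforce
      qed
    qed
  qed
qed

lemma dual_filling_gf_convolution: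
  fixes h :: "'b \<Rightarrow> int"
  assumes fin: "finite P" and w: "\<And>b. b \<in> P \<Longrightarrow> 1 \<le> w b" and ne: "P \<noteq> {}"
    and hW: "\<And>b b'. b \<in> P \<Longrightarrow> b' \<in> P \<Longrightarrow> W b b' \<Longrightarrow> h b < h b'"
    and hT: "\<And>b b'. b \<in> P \<Longrightarrow> b' \<in> P \<Longrightarrow> T b b' \<Longrightarrow> h b' < h b"
  shows "(\<Sum>I \<in> lower_sets W T P. (- 1) ^ card I *
    (filling_gf (\<lambda>b b'. T b' b) (\<lambda>b b'. W b' b) w I * filling_gf W T w (P - I))) = 0"
proof (rule series_eqI)
  fix \<mu>
  let ?U = "{u \<in> P \<rightarrow>\<^sub>E {1..}. weight w P u = \<mu>}"
  let ?D = "filling_gf (\<lambda>b b'. T b' b) (\<lambda>b b'. W b' b) w"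
  have U: "finite ?U" by (rule finite_weight_fibre[OF fin w])
  have L: "finite (lower_sets W T P)" using fin by (auto simp: lower_sets_def)
  have c: "coeff (?D I * filling_gf W T w (P - I)) \<mu> = (\<Sum>u\<in>?U. if I \<in> reconciled W T P u then 1 else 0)"
    if I: "I \<in> lower_sets W T P" for I
  proof -
    have IP: "I \<subseteq> P" "I \<union> (P - I) = P" using I by (auto simp: lower_sets_def)
    have "?D I * filling_gf W T w (P - I) = monomial_sum
        {m \<in> P \<rightarrow>\<^sub>E {1..}. restrict m I \<in> admissible (\<lambda>b b'. T b' b) (\<lambda>b b'. W b' b) I \<and>
          restrict m (P - I) \<in> admissible W T (P - I)} (weight w P)"
      using filling_gf_mult[of I "P - I" w "\<lambda>b b'. T b' b" "\<lambda>b b'. W b' b" W T]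
        fin w finite_subset[OF IP(1) fin] unfolding IP(2) by blast
    then have "coeff (?D I * filling_gf W T w (P - I)) \<mu> = int (card {u \<in> ?U.
        restrict u I \<in> admissible (\<lambda>b b'. T b' b) (\<lambda>b b'. W b' b) I \<and>
          restrict u (P - I) \<in> admissible W T (P - I)})"
      by (simp add: coeff_monomial_sum conj_ac cong: conj_cong)
    also have "{u \<in> ?U. restrict u I \<in> admissible (\<lambda>b b'. T b' b) (\<lambda>b b'. W b' b) I \<and>
          restrict u (P - I) \<in> admissible W T (P - I)} = {u \<in> ?U. I \<in> reconciled W T P u}"
    proof (rule Collect_cong)
      fix u
      have "restrict u I \<in> I \<rightarrow>\<^sub>E {1..}" "restrict u (P - I) \<in> P - I \<rightarrow>\<^sub>E {1..}" if "u \<in> ?U"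
        using that IP(1) by auto
      then show "u \<in> ?U \<and> restrict u I \<in> admissible (\<lambda>b b'. T b' b) (\<lambda>b b'. W b' b) I \<and>
          restrict u (P - I) \<in> admissible W T (P - I) \<longleftrightarrow> u \<in> ?U \<and> I \<in> reconciled W T P u"
        using I unfolding admissible_def reconciled_def by simp blast
    qed
    finally show ?thesis using card_filter_eq_sum[OF U] by simp
  qed
  have "coeff (\<Sum>I \<in> lower_sets W T P. (- 1) ^ card I * (?D I * filling_gf W T w (P - I))) \<mu> =
      (\<Sum>I \<in> lower_sets W T P. (- 1) ^ card I * (\<Sum>u\<in>?U. if I \<in> reconciled W T P u then 1 else 0))"
    unfolding coeff_sum coeff_sign_mult using c by (intro sum.cong) simp_all
  also have "\<dots> = (\<Sum>I \<in> lower_sets W T P. \<Sum>u\<in>?U. if I \<in> reconciled W T P u then (- 1) ^ card I else 0)"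
    unfolding sum_distrib_left by (intro sum.cong) auto
  also have "\<dots> = (\<Sum>u\<in>?U. \<Sum>I \<in> lower_sets W T P. if I \<in> reconciled W T P u then (- 1) ^ card I else 0)"
    by (rule sum.swap)
  also have "\<dots> = (\<Sum>u\<in>?U. \<Sum>I \<in> reconciled W T P u. (- 1) ^ card I)"
  proof (rule sum.cong)
    fix u
    have "{I \<in> lower_sets W T P. I \<in> reconciled W T P u} = reconciled W T P u" by (auto simp: reconciled_def)
    then show "(\<Sum>I \<in> lower_sets W T P. if I \<in> reconciled W T P u then (- 1) ^ card I else (0 :: int)) =
        (\<Sum>I \<in> reconciled W T P u. (- 1) ^ card I)"
      using sum.inter_filter[OF L, of "\<lambda>I. (- 1) ^ card I :: int" "\<lambda>I. I \<in> reconciled W T P u"] by simp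
  qed simp
  also have "\<dots> = 0"
    using sum_reconciled[OF fin ne, of W h T] hW hT by simp
  finally show "coeff (\<Sum>I \<in> lower_sets W T P. (- 1) ^ card I * (?D I * filling_gf W T w (P - I))) \<mu> = coeff 0 \<mu>"
    by simp
qed

text \<open>
  Both sides satisfy the same recursion, in which the summand \<open>I = P\<close> is the function itself. For a
  skew diagram, with \<open>W\<close> along the rows and \<open>T\<close> along the columns, \<open>h\<close> is the content.
\<close>
theorem antipode_filling_gf:
  fixes h :: "'b \<Rightarrow> int"
  assumes "finite P" and "\<And>b. b \<in> P \<Longrightarrow> 1 \<le> w b"
    and "\<And>b b'. b \<in> P \<Longrightarrow> b' \<in> P \<Longrightarrow> W b b' \<Longrightarrow> h b < h b'"
    and "\<And>b b'. b \<in> P \<Longrightarrow> b' \<in> P \<Longrightarrow> T b b' \<Longrightarrow> h b' < h b"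
  shows "antipode (filling_gf W T w P) = (- 1) ^ card P * filling_gf (\<lambda>b b'. T b' b) (\<lambda>b b'. W b' b) w P"
  using assms
proof (induction "card P" arbitrary: P rule: less_induct)
  case less
  let ?K = "filling_gf W T w" and ?D = "filling_gf (\<lambda>b b'. T b' b) (\<lambda>b b'. W b' b) w"
  have empty: "filling_gf W T w {} = 1" for W T :: "'b \<Rightarrow> 'b \<Rightarrow> bool"
  proof (rule series_eqI)
    fix \<mu>
    have "{m \<in> admissible W T {}. weight w {} m = \<mu>} = (if \<mu> = 0 then {\<lambda>_. undefined} else {})"
      by (auto simp: admissible_def weight_def)
    then show "coeff (filling_gf W T w {}) \<mu> = coeff 1 \<mu>" by (simp add: coeff_filling_gf coeff_one)
  qed
  have P: "P \<in> lower_sets W T P" "finite (lower_sets W T P)" using less.prems(1) by (auto simp: lower_sets_def)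
  let ?L = "lower_sets W T P - {P}"
  show ?case
  proof (cases "P = {}")
    case True
    have "\<forall>\<gamma> \<in> compositions. (\<Sum>k\<le>length \<gamma>. antipode (M (take k \<gamma>)) * M (drop k \<gamma>)) = (if \<gamma> = [] then 1 else 0)"
      using is_antipode_antipode unfolding is_antipode_def by blast
    from bspec[OF this, of "[]"] have "antipode (M []) * M [] = 1" by (simp add: compositions_def)
    then show ?thesis using True by (simp add: empty M_chain_sum chain_sum_Nil)
  next
    case False
    have K: "antipode (?K P) + (\<Sum>I \<in> ?L. antipode (?K I) * ?K (P - I)) = 0"
      using antipode_filling_gf_convolution[OF is_antipode_antipode less.prems(1,2) False, where W = W and T = T]
        sum.remove[OF P(2,1), of "\<lambda>I. antipode (?K I) * ?K (P - I)"] by (simp add: empty)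
    have D: "(- 1) ^ card P * ?D P + (\<Sum>I \<in> ?L. (- 1) ^ card I * (?D I * ?K (P - I))) = 0"
      using dual_filling_gf_convolution[OF less.prems(1,2) False less.prems(3,4)]
        sum.remove[OF P(2,1), of "\<lambda>I. (- 1) ^ card I * (?D I * ?K (P - I))"] by (simp add: empty)
    have "antipode (?K I) * ?K (P - I) = (- 1) ^ card I * (?D I * ?K (P - I))" if "I \<in> ?L" for I
    proof -
      have "I \<subset> P" using that by (auto simp: lower_sets_def)
      then have I: "card I < card P" "finite I" "\<And>b. b \<in> I \<Longrightarrow> b \<in> P"
        using less.prems(1) by (auto simp: psubset_card_mono intro: finite_subset)
      have "antipode (?K I) = (- 1) ^ card I * ?D I"
        using less.hyps[OF I(1,2)] less.prems(2-4)[OF I(3)] I(3) by blast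
      then show ?thesis by (simp only: mult.assoc)
    qed
    then have "(\<Sum>I \<in> ?L. antipode (?K I) * ?K (P - I)) = (\<Sum>I \<in> ?L. (- 1) ^ card I * (?D I * ?K (P - I)))"
      by (rule sum.cong[OF refl])
    with K D have "antipode (?K P) + (\<Sum>I \<in> ?L. (- 1) ^ card I * (?D I * ?K (P - I))) =
        (- 1) ^ card P * ?D P + (\<Sum>I \<in> ?L. (- 1) ^ card I * (?D I * ?K (P - I)))" by (simp only:)
    then show ?thesis by (rule add_right_imp_eq)
  qed
qed

section \<open>Swapping tails of rows\<close>

text \<open>
  Row \<open>i\<close> has the contents \<open>x i + 1, \<dots>, y (\<sigma> i)\<close> for a permutation \<open>\<sigma>\<close>. Values are related by \<open>rel\<close>
  along a row, where \<open>rel\<close> is one of \<open>\<le>\<close> and \<open><\<close>; \<open>rel_swap\<close> is a form of transitivity that holds for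
  both. The exponent of a box is \<open>a\<close> at its content.
\<close>
locale row_family =
  fixes rel :: "nat \<Rightarrow> nat \<Rightarrow> bool" and r :: nat and x y :: "nat \<Rightarrow> int" and a :: "int \<Rightarrow> nat"
  assumes rel_trans: "rel u v \<Longrightarrow> rel v w \<Longrightarrow> rel u w"
    and rel_swap: "\<not> rel u v \<Longrightarrow> rel u w \<Longrightarrow> rel v w"
    and x_less: "1 \<le> i \<Longrightarrow> i < r \<Longrightarrow> x (Suc i) < x i"
    and y_less: "1 \<le> i \<Longrightarrow> i < r \<Longrightarrow> y (Suc i) < y i"
    and x_le_y: "1 \<le> i \<Longrightarrow> i \<le> r \<Longrightarrow> x i \<le> y i"
    and a_pos: "1 \<le> a c"
begin

definition valid_perms :: "(nat \<Rightarrow> nat) set" where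
  "valid_perms = {\<sigma>. \<sigma> permutes {1..r} \<and> (\<forall>i \<in> {1..r}. x i \<le> y (\<sigma> i))}"

definition rows :: "nat \<Rightarrow> nat \<Rightarrow> (int \<Rightarrow> nat) set" where
  "rows i j = {f \<in> {x i<..y j} \<rightarrow>\<^sub>E {1..}. \<forall>c d. x i < c \<and> c < d \<and> d \<le> y j \<longrightarrow> rel (f c) (f d)}"

definition families :: "((nat \<Rightarrow> nat) \<times> (nat \<Rightarrow> int \<Rightarrow> nat)) set" where
  "families = (SIGMA \<sigma> : valid_perms. PiE {1..r} (\<lambda>i. rows i (\<sigma> i)))"

definition family_weight :: "(nat \<Rightarrow> nat) \<times> (nat \<Rightarrow> int \<Rightarrow> nat) \<Rightarrow> mono" where
  "family_weight = (\<lambda>(\<sigma>, F). \<Sum>i\<in>{1..r}. weight a {x i<..y (\<sigma> i)} (F i))"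

text \<open>
  The box of row \<open>Suc i\<close> with content \<open>c - 1\<close> lies directly below the box of row \<open>i\<close> with content
  \<open>c\<close>. If row \<open>i\<close> has ended before content \<open>c\<close>, then it is thought of as continued by infinite values,
  and the pair is a violation, too.
\<close>
definition violations :: "(nat \<Rightarrow> nat) \<times> (nat \<Rightarrow> int \<Rightarrow> nat) \<Rightarrow> (int \<times> nat) set" where
  "violations = (\<lambda>(\<sigma>, F). {(c, i). 1 \<le> i \<and> i < r \<and> x i < c \<and> c - 1 \<le> y (\<sigma> (Suc i)) \<and>
     (c \<le> y (\<sigma> i) \<longrightarrow> rel (F (Suc i) (c - 1)) (F i c))})"

text \<open>
  Contents come first and rows second in this order, because an exchange of tails at content \<open>c\<close> only
  affects contents from \<open>c\<close> on.
\<close>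
definition first_in :: "(int \<times> nat) set \<Rightarrow> int \<times> nat \<Rightarrow> bool" where
  "first_in V q \<longleftrightarrow> q \<in> V \<and> (\<forall>q' \<in> V. fst q < fst q' \<or> fst q = fst q' \<and> snd q \<le> snd q')"

definition tail :: "int \<Rightarrow> (int \<Rightarrow> nat) \<Rightarrow> (int \<Rightarrow> nat) \<Rightarrow> int \<Rightarrow> nat" where
  "tail c f g = (\<lambda>d. if d < c then f d else g d)"

definition swap_tails :: "int \<times> nat \<Rightarrow> (nat \<Rightarrow> nat) \<times> (nat \<Rightarrow> int \<Rightarrow> nat) \<Rightarrow> (nat \<Rightarrow> nat) \<times> (nat \<Rightarrow> int \<Rightarrow> nat)" where
  "swap_tails = (\<lambda>(c, i) (\<sigma>, F). (\<sigma> \<circ> transpose i (Suc i),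
     F(i := tail c (F i) (F (Suc i)), Suc i := tail c (F (Suc i)) (F i))))"

lemma first_in_unique: "first_in V q \<Longrightarrow> first_in V q' \<Longrightarrow> q = q'"
  unfolding first_in_def by (metis antisym less_asym less_irrefl prod_eqI)

lemma first_in_exists:
  assumes "finite V" "V \<noteq> {}"
  obtains q where "first_in V q"
proof -
  have c: "Min (fst ` V) \<in> fst ` V" using assms by simp
  let ?I = "{i. (Min (fst ` V), i) \<in> V}"
  have "?I \<subseteq> snd ` V" by force
  then have fin: "finite ?I" using assms(1) by (meson finite_imageI finite_subset)
  have i: "Min ?I \<in> ?I" using c by (intro Min_in[OF fin]) auto
  have "first_in V (Min (fst ` V), Min ?I)"
    unfolding first_in_def
  proof (intro conjI ballI)
    show "(Min (fst ` V), Min ?I) \<in> V" using i by simp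
    fix q assume q: "q \<in> V"
    have le: "Min (fst ` V) \<le> fst q" using q assms(1) by simp
    show "fst (Min (fst ` V), Min ?I) < fst q \<or> fst (Min (fst ` V), Min ?I) = fst q \<and> snd (Min (fst ` V), Min ?I) \<le> snd q"
    proof (cases "Min (fst ` V) = fst q")
      case True
      then have "snd q \<in> ?I" using q by simp
      then show ?thesis using True Min_le[OF fin] by simp
    qed (use le in auto)
  qed
  then show ?thesis by (rule that)
qed

lemma rowsD:
  assumes "f \<in> rows i j"
  shows "x i < c \<Longrightarrow> c < d \<Longrightarrow> d \<le> y j \<Longrightarrow> rel (f c) (f d)"
    and "x i < c \<Longrightarrow> c \<le> y j \<Longrightarrow> 1 \<le> f c"
    and "c \<le> x i \<Longrightarrow> f c = undefined" and "y j < c \<Longrightarrow> f c = undefined"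
  using assms unfolding rows_def by (auto simp: PiE_iff extensional_def)

lemma rowsI:
  assumes "\<And>c d. x i < c \<Longrightarrow> c < d \<Longrightarrow> d \<le> y j \<Longrightarrow> rel (f c) (f d)"
    and "\<And>c. x i < c \<Longrightarrow> c \<le> y j \<Longrightarrow> 1 \<le> f c"
    and "\<And>c. c \<le> x i \<Longrightarrow> f c = undefined" and "\<And>c. y j < c \<Longrightarrow> f c = undefined"
  shows "f \<in> rows i j"
  using assms unfolding rows_def by (auto simp: PiE_iff extensional_def not_le not_less)

lemma weight_tail:
  assumes "x0 < c" "c - 1 \<le> y0"
  shows "weight a {x0<..y0} (tail c f g) = weight a {x0<..<c} f + weight a {c..y0} g"
proof -
  have "{x0<..y0} = {x0<..<c} \<union> {c..y0}" using assms by auto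
  then have "weight a {x0<..y0} (tail c f g) = weight a {x0<..<c} (tail c f g) + weight a {c..y0} (tail c f g)"
    by (simp only:) (rule weight_Un, auto)
  also have "weight a {x0<..<c} (tail c f g) = weight a {x0<..<c} f"
    by (rule weight_cong) (simp add: tail_def)
  also have "weight a {c..y0} (tail c f g) = weight a {c..y0} g"
    by (rule weight_cong) (simp add: tail_def)
  finally show ?thesis .
qed

lemma tail_same: "tail c f f = f"
  by (auto simp: tail_def)

lemma swap_tails_involution: "swap_tails q (swap_tails q p) = p"
  by (auto simp: swap_tails_def case_prod_unfold comp_assoc tail_def fun_eq_iff prod_eq_iff)

text \<open>
  Two rows that exchange their tails at the first violation are again rows: the violation itself
  relates the two parts of the new lower row, and the absence of a violation one step earlier relates
  those of the new upper row. The exchange neither creates an earlier violation nor removes the first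
  one, so that repeating it undoes it.
\<close>
lemma
  assumes p: "p \<in> families" and first: "first_in (violations p) q"
  shows swap_tails_families: "swap_tails q p \<in> families"
    and swap_tails_first: "first_in (violations (swap_tails q p)) q"
    and swap_tails_weight: "family_weight (swap_tails q p) = family_weight p"
    and swap_tails_sign: "sign (fst (swap_tails q p)) = - sign (fst p)"
proof -
  obtain \<sigma> F where pF: "p = (\<sigma>, F)" by (cases p)
  obtain c i where q: "q = (c, i)" by (cases q)
  let ?j = "Suc i"
  have \<sigma>: "\<sigma> permutes {1..r}" and valid: "\<And>k. k \<in> {1..r} \<Longrightarrow> x k \<le> y (\<sigma> k)"
    and F: "\<And>k. k \<in> {1..r} \<Longrightarrow> F k \<in> rows k (\<sigma> k)" and Fext: "F \<in> extensional {1..r}"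
    using p by (auto simp: pF families_def valid_perms_def PiE_iff)
  have viol: "(c, i) \<in> violations p" and
    min: "\<And>c' i'. (c', i') \<in> violations p \<Longrightarrow> c < c' \<or> c = c' \<and> i \<le> i'"
    using first by (auto simp: first_in_def q)
  have i: "1 \<le> i" "i < r" and xc: "x i < c" and yj: "c - 1 \<le> y (\<sigma> ?j)"
    and rel_c: "c \<le> y (\<sigma> i) \<Longrightarrow> rel (F ?j (c - 1)) (F i c)"
    using viol by (auto simp: violations_def pF)
  have xj: "x ?j < x i" using x_less i by simp
  have ij: "i \<in> {1..r}" "?j \<in> {1..r}" using i by auto
  have not_before: "(c - 1, i) \<notin> violations p" using min by fastforce
  \<comment> \<open>The upper row cannot end before \<open>c - 1\<close>, since it would already have violated there.\<close>
  have yi: "c - 1 \<le> y (\<sigma> i)"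
  proof (rule ccontr)
    assume "\<not> c - 1 \<le> y (\<sigma> i)"
    then have "(c - 1, i) \<in> violations p"
      using valid[OF ij(1)] yj i by (auto simp: violations_def pF)
    then show False using not_before by simp
  qed
  \<comment> \<open>There is no violation at \<open>c - 1\<close>, which relates the upper row before \<open>c\<close> to the lower one after \<open>c\<close>.\<close>
  have joinable: "rel (F i d) (F ?j e)" if d: "x i < d" "d < c" and e: "c \<le> e" "e \<le> y (\<sigma> ?j)" for d e
  proof -
    have c1: "x i < c - 1" using d by simp
    then have "\<not> rel (F ?j (c - 1 - 1)) (F i (c - 1))"
      using not_before yi yj i by (auto simp: violations_def pF)
    moreover have "rel (F ?j (c - 1 - 1)) (F ?j e)"
      using rowsD(1)[OF F[OF ij(2)], of "c - 1 - 1" e] c1 xj e by simp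
    ultimately have last: "rel (F i (c - 1)) (F ?j e)" by (rule rel_swap)
    show ?thesis
    proof (cases "d = c - 1")
      case False
      then have "rel (F i d) (F i (c - 1))" using rowsD(1)[OF F[OF ij(1)], of d "c - 1"] d yi by simp
      then show ?thesis using last rel_trans by blast
    qed (use last in simp)
  qed
  have joinable': "rel (F ?j d) (F i e)" if d: "x ?j < d" "d < c" and e: "c \<le> e" "e \<le> y (\<sigma> i)" for d e
  proof -
    have mid: "rel (F ?j (c - 1)) (F i c)" using rel_c e by simp
    have "rel (F ?j d) (F i c)"
    proof (cases "d = c - 1")
      case False
      then have "rel (F ?j d) (F ?j (c - 1))" using rowsD(1)[OF F[OF ij(2)], of d "c - 1"] d yj by simp
      then show ?thesis using mid rel_trans by blast
    qed (use mid in simp)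
    then show ?thesis
    proof (cases "e = c")
      case False
      then have "rel (F i c) (F i e)" using rowsD(1)[OF F[OF ij(1)], of c e] e xc by simp
      then show ?thesis using \<open>rel (F ?j d) (F i c)\<close> rel_trans by blast
    qed simp
  qed
  have row_i: "tail c (F i) (F ?j) \<in> rows i (\<sigma> ?j)"
  proof (rule rowsI)
    fix d e assume "x i < d" "d < e" "e \<le> y (\<sigma> ?j)"
    then show "rel (tail c (F i) (F ?j) d) (tail c (F i) (F ?j) e)"
      using joinable[of d e] rowsD(1)[OF F[OF ij(1)], of d e] rowsD(1)[OF F[OF ij(2)], of d e] xc xj yi
      by (auto simp: tail_def)
  next
    fix d assume "x i < d" "d \<le> y (\<sigma> ?j)"
    then show "1 \<le> tail c (F i) (F ?j) d"
      using rowsD(2)[OF F[OF ij(1)], of d] rowsD(2)[OF F[OF ij(2)], of d] xj yi by (auto simp: tail_def)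
  next
    fix d assume "d \<le> x i"
    then show "tail c (F i) (F ?j) d = undefined" using rowsD(3)[OF F[OF ij(1)], of d] xc by (simp add: tail_def)
  next
    fix d assume "y (\<sigma> ?j) < d"
    then show "tail c (F i) (F ?j) d = undefined" using rowsD(4)[OF F[OF ij(2)], of d] yj by (simp add: tail_def)
  qed
  have row_j: "tail c (F ?j) (F i) \<in> rows ?j (\<sigma> i)"
  proof (rule rowsI)
    fix d e assume "x ?j < d" "d < e" "e \<le> y (\<sigma> i)"
    then show "rel (tail c (F ?j) (F i) d) (tail c (F ?j) (F i) e)"
      using joinable'[of d e] rowsD(1)[OF F[OF ij(1)], of d e] rowsD(1)[OF F[OF ij(2)], of d e] xc yj
      by (auto simp: tail_def)
  next
    fix d assume "x ?j < d" "d \<le> y (\<sigma> i)"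
    then show "1 \<le> tail c (F ?j) (F i) d"
      using rowsD(2)[OF F[OF ij(1)], of d] rowsD(2)[OF F[OF ij(2)], of d] xc yj by (auto simp: tail_def)
  next
    fix d assume "d \<le> x ?j"
    then show "tail c (F ?j) (F i) d = undefined" using rowsD(3)[OF F[OF ij(2)], of d] xc xj by (simp add: tail_def)
  next
    fix d assume "y (\<sigma> i) < d"
    then show "tail c (F ?j) (F i) d = undefined" using rowsD(4)[OF F[OF ij(1)], of d] yi by (simp add: tail_def)
  qed
  define \<sigma>' where "\<sigma>' = \<sigma> \<circ> transpose i ?j"
  define F' where "F' = F(i := tail c (F i) (F ?j), ?j := tail c (F ?j) (F i))"
  have sw: "swap_tails q p = (\<sigma>', F')" by (simp add: swap_tails_def q pF \<sigma>'_def F'_def)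
  have \<sigma>'_simps: "\<sigma>' i = \<sigma> ?j" "\<sigma>' ?j = \<sigma> i" "\<And>k. k \<noteq> i \<Longrightarrow> k \<noteq> ?j \<Longrightarrow> \<sigma>' k = \<sigma> k"
    by (auto simp: \<sigma>'_def transpose_def)
  have F'_simps: "F' i = tail c (F i) (F ?j)" "F' ?j = tail c (F ?j) (F i)" "\<And>k. k \<noteq> i \<Longrightarrow> k \<noteq> ?j \<Longrightarrow> F' k = F k"
    by (auto simp: F'_def)
  have \<sigma>': "\<sigma>' permutes {1..r}"
    unfolding \<sigma>'_def by (rule permutes_compose[OF permutes_swap_id[OF ij] \<sigma>])
  have "x k \<le> y (\<sigma>' k)" if "k \<in> {1..r}" for k
    using valid[OF that] yi yj xc xj \<sigma>'_simps by (cases "k = i"; cases "k = ?j") auto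
  moreover have "F' k \<in> rows k (\<sigma>' k)" if "k \<in> {1..r}" for k
    using F[OF that] row_i row_j \<sigma>'_simps F'_simps by (cases "k = i"; cases "k = ?j") auto
  moreover have "F' \<in> extensional {1..r}" using Fext ij by (auto simp: F'_def extensional_def)
  ultimately show "swap_tails q p \<in> families"
    using \<sigma>' by (auto simp: sw families_def valid_perms_def PiE_iff)
  have "(c, i) \<in> violations (\<sigma>', F')"
  proof -
    have "rel (F ?j (c - 1)) (F ?j c)" if "c \<le> y (\<sigma> ?j)"
      using rowsD(1)[OF F[OF ij(2)], of "c - 1" c] that xc xj by simp
    then show ?thesis
      using i xc yi by (simp add: violations_def \<sigma>'_simps F'_simps tail_def)
  qed
  moreover have "c < c' \<or> c = c' \<and> i \<le> i'" if v: "(c', i') \<in> violations (\<sigma>', F')" for c' i'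
  proof (rule ccontr)
    assume "\<not> (c < c' \<or> c = c' \<and> i \<le> i')"
    then have before: "c' < c \<or> c' = c \<and> i' < i" by auto
    have i': "1 \<le> i'" "i' < r" "x i' < c'" and y': "c' - 1 \<le> y (\<sigma>' (Suc i'))"
      and rel': "c' \<le> y (\<sigma>' i') \<longrightarrow> rel (F' (Suc i') (c' - 1)) (F' i' c')"
      using v by (auto simp: violations_def)
    have "c' - 1 \<le> y (\<sigma> (Suc i'))"
      using y' before yi yj \<sigma>'_simps by (cases "Suc i' = i"; cases "Suc i' = ?j") auto
    moreover have "F' (Suc i') (c' - 1) = F (Suc i') (c' - 1)"
      using before F'_simps by (cases "Suc i' = i"; cases "Suc i' = ?j") (auto simp: tail_def)
    moreover have "F' i' c' = F i' c'"
      using before F'_simps by (cases "i' = i"; cases "i' = ?j") (auto simp: tail_def)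
    moreover have "c' \<le> y (\<sigma>' i')" if "c' \<le> y (\<sigma> i')"
      using that before yi yj \<sigma>'_simps by (cases "i' = i"; cases "i' = ?j") auto
    ultimately have "(c', i') \<in> violations p" using i' rel' by (simp add: violations_def pF)
    then show False using min before by fastforce
  qed
  ultimately show "first_in (violations (swap_tails q p)) q"
    unfolding sw first_in_def by (auto simp: q)
  have split: "(\<Sum>k\<in>{1..r}. g k) = g i + (g ?j + (\<Sum>k\<in>{1..r} - {i} - {?j}. g k))" for g :: "nat \<Rightarrow> mono"
    using sum.remove[of "{1..r}" i g] sum.remove[of "{1..r} - {i}" ?j g] ij by simp
  have w: "weight a {x i<..y (\<sigma> i)} (F i) = weight a {x i<..<c} (F i) + weight a {c..y (\<sigma> i)} (F i)"
    "weight a {x ?j<..y (\<sigma> ?j)} (F ?j) = weight a {x ?j<..<c} (F ?j) + weight a {c..y (\<sigma> ?j)} (F ?j)"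
    using weight_tail[of "x i" c "y (\<sigma> i)" "F i" "F i"] weight_tail[of "x ?j" c "y (\<sigma> ?j)" "F ?j" "F ?j"]
      xc xj yi yj by (simp_all add: tail_same)
  have w': "weight a {x i<..y (\<sigma>' i)} (F' i) = weight a {x i<..<c} (F i) + weight a {c..y (\<sigma> ?j)} (F ?j)"
    "weight a {x ?j<..y (\<sigma>' ?j)} (F' ?j) = weight a {x ?j<..<c} (F ?j) + weight a {c..y (\<sigma> i)} (F i)"
    unfolding \<sigma>'_simps F'_simps using xc xj yi yj by (auto intro!: weight_tail)
  have "(\<Sum>k\<in>{1..r} - {i} - {?j}. weight a {x k<..y (\<sigma>' k)} (F' k)) =
      (\<Sum>k\<in>{1..r} - {i} - {?j}. weight a {x k<..y (\<sigma> k)} (F k))"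
    by (rule sum.cong) (auto simp: \<sigma>'_simps F'_simps)
  then show "family_weight (swap_tails q p) = family_weight p"
    unfolding sw unfolding pF family_weight_def prod.case split w w' by (simp add: ac_simps)
  have "permutation \<sigma>" using \<sigma> by (auto simp: permutation_permutes)
  then show "sign (fst (swap_tails q p)) = - sign (fst p)"
    unfolding sw by (simp add: pF \<sigma>'_def sign_compose permutation_swap_id sign_swap_id)
qed

lemma finite_violations: "finite (violations p)"
proof (cases p)
  case (Pair \<sigma> F)
  have "violations p \<subseteq> (\<Union>i \<in> {..<r}. {x i..y (\<sigma> (Suc i)) + 1} \<times> {i})"
    by (auto simp: violations_def Pair)
  then show ?thesis by (rule finite_subset) auto
qed

text \<open>
  Without violations no row ends before the row below it, so that \<open>y \<circ> \<sigma>\<close> decreases and \<open>\<sigma>\<close>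
  increases.
\<close>
lemma no_violations_id:
  assumes p: "(\<sigma>, F) \<in> families" and none: "violations (\<sigma>, F) = {}"
  shows "\<sigma> = id"
proof -
  have \<sigma>: "\<sigma> permutes {1..r}" and valid: "\<And>k. k \<in> {1..r} \<Longrightarrow> x k \<le> y (\<sigma> k)"
    using p by (auto simp: families_def valid_perms_def)
  have anti: "y l \<le> y k" if "1 \<le> k" "k \<le> l" "l \<le> r" for k l
    using that(2,3)
  proof (induction rule: dec_induct)
    case (step n)
    then show ?case using y_less[of n] that(1) by simp
  qed simp
  have less: "\<sigma> i < \<sigma> (Suc i)" if "1 \<le> i" "i < r" for i
  proof (rule ccontr)
    assume "\<not> \<sigma> i < \<sigma> (Suc i)"
    moreover have "\<sigma> i \<in> {1..r}" "\<sigma> (Suc i) \<in> {1..r}" using permutes_in_image[OF \<sigma>] that by simp_all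
    ultimately have "y (\<sigma> i) \<le> y (\<sigma> (Suc i))" using anti[of "\<sigma> (Suc i)" "\<sigma> i"] by simp
    then have "(y (\<sigma> i) + 1, i) \<in> violations (\<sigma>, F)"
      using that valid[of i] by (simp add: violations_def)
    then show False using none by simp
  qed
  have "i \<le> \<sigma> i" if "1 \<le> i" "i \<le> r" for i
    using that
  proof (induction rule: dec_induct)
    case base
    then show ?case using permutes_in_image[OF \<sigma>, of 1] by simp
  next
    case (step n)
    then show ?case using less[of n] by simp
  qed
  then show ?thesis using permutes_natset_ge[OF \<sigma>] by simp
qed

lemma chain_sum_rows:
  "chain_sum rel (map a [x i + 1..y j]) = monomial_sum (rows i j) (weight a {x i<..y j})"
proof -
  let ?h = "\<lambda>k. x i + 1 + int k" and ?\<gamma> = "map a [x i + 1..y j]"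
  have bij: "bij_betw ?h {..<length ?\<gamma>} {x i<..y j}"
    by (rule bij_betw_byWitness[where f' = "\<lambda>c. nat (c - x i - 1)"]) auto
  have "chain_sum rel ?\<gamma> = monomial_sum
    {m \<in> {x i<..y j} \<rightarrow>\<^sub>E {1..}. \<forall>k l. k < l \<and> l < length ?\<gamma> \<longrightarrow> rel (m (?h k)) (m (?h l))} (weight a {x i<..y j})"
    by (rule chain_sum_fillings[OF bij]) simp
  also have "{m \<in> {x i<..y j} \<rightarrow>\<^sub>E {1..}. \<forall>k l. k < l \<and> l < length ?\<gamma> \<longrightarrow> rel (m (?h k)) (m (?h l))} = rows i j"
    unfolding rows_def
  proof (rule Collect_cong, rule conj_cong[OF refl])
    fix m :: "int \<Rightarrow> nat"
    show "(\<forall>k l. k < l \<and> l < length ?\<gamma> \<longrightarrow> rel (m (?h k)) (m (?h l))) \<longleftrightarrow>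
        (\<forall>c d. x i < c \<and> c < d \<and> d \<le> y j \<longrightarrow> rel (m c) (m d))" (is "?A \<longleftrightarrow> ?B")
    proof
      assume A: ?A
      show ?B
      proof (intro allI impI)
        fix c d assume cd: "x i < c \<and> c < d \<and> d \<le> y j"
        then have "nat (c - x i - 1) < nat (d - x i - 1)" "nat (d - x i - 1) < length ?\<gamma>" by auto
        then have "rel (m (?h (nat (c - x i - 1)))) (m (?h (nat (d - x i - 1))))" using A by blast
        then show "rel (m c) (m d)" using cd by simp
      qed
    next
      assume B: ?B
      show ?A
      proof (intro allI impI)
        fix k l assume kl: "k < l \<and> l < length ?\<gamma>"
        have "x i < ?h k" "?h k < ?h l" "?h l \<le> y j" using kl by auto
        then show "rel (m (?h k)) (m (?h l))" using B by blast
      qed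
    qed
  qed
  finally show ?thesis .
qed

text \<open>
  The determinant formula. Families with a violation cancel in pairs.
\<close>
theorem signed_sum_rows:
  "(\<Sum>\<sigma> \<in> valid_perms. of_int (sign \<sigma>) * (\<Prod>i \<in> {1..r}. chain_sum rel (map a [x i + 1..y (\<sigma> i)]))) =
    monomial_sum {F \<in> PiE {1..r} (\<lambda>i. rows i i). violations (id, F) = {}} (\<lambda>F. family_weight (id, F))"
proof (rule series_eqI)
  fix \<mu>
  let ?A = "\<lambda>\<sigma>. {F \<in> PiE {1..r} (\<lambda>i. rows i (\<sigma> i)). family_weight (\<sigma>, F) = \<mu>}"
  let ?X = "Sigma valid_perms ?A"
  let ?Z = "{p \<in> ?X. violations p = {}}" and ?V = "{p \<in> ?X. violations p \<noteq> {}}"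
  have finV: "finite valid_perms" unfolding valid_perms_def
    by (rule finite_subset[of _ "{\<sigma>. \<sigma> permutes {1..r}}"]) (auto intro: finite_permutations)
  have fin_rows: "finite_fibres (rows i j) (weight a {x i<..y j})" for i j
    by (rule finite_fibres_weight) (use a_pos in \<open>auto simp: rows_def\<close>)
  have prod: "finite_fibres (PiE {1..r} (\<lambda>i. rows i (\<sigma> i))) (\<lambda>F. family_weight (\<sigma>, F)) \<and>
      (\<Prod>i \<in> {1..r}. chain_sum rel (map a [x i + 1..y (\<sigma> i)])) =
      monomial_sum (PiE {1..r} (\<lambda>i. rows i (\<sigma> i))) (\<lambda>F. family_weight (\<sigma>, F))" for \<sigma>
    unfolding chain_sum_rows family_weight_def prod.case
    by (rule prod_monomial_sum) (auto intro: fin_rows)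
  have finA: "finite (?A \<sigma>)" for \<sigma> using prod[of \<sigma>] by (simp add: finite_fibres_def)
  have X: "?X = {p \<in> families. family_weight p = \<mu>}" by (auto simp: families_def)
  have finX: "finite ?X" using finV finA by blast
  have "coeff (\<Sum>\<sigma> \<in> valid_perms. of_int (sign \<sigma>) * (\<Prod>i \<in> {1..r}. chain_sum rel (map a [x i + 1..y (\<sigma> i)]))) \<mu> =
      (\<Sum>\<sigma> \<in> valid_perms. \<Sum>F \<in> ?A \<sigma>. sign \<sigma>)"
    using prod by (simp add: coeff_monomial_sum mult.commute)
  also have "\<dots> = (\<Sum>p \<in> ?X. sign (fst p))"
    using sum.Sigma[OF finV, of ?A "\<lambda>\<sigma> F. sign \<sigma>"] finA by (simp add: case_prod_unfold)
  also have "\<dots> = (\<Sum>p \<in> ?V. sign (fst p)) + (\<Sum>p \<in> ?Z. sign (fst p))"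
    using sum.union_disjoint[of ?V ?Z "\<lambda>p. sign (fst p)"] finX
    by (subst sum.union_disjoint[symmetric]) (auto intro!: sum.cong)
  also have "(\<Sum>p \<in> ?V. sign (fst p)) = 0"
  proof -
    define q where "q = (\<lambda>p. THE q. first_in (violations p) q)"
    have qI: "q p = q'" if "first_in (violations p) q'" for p q'
      unfolding q_def using that first_in_unique by (intro the_equality) auto
    have q: "first_in (violations p) (q p)" if "p \<in> ?V" for p
    proof -
      have "violations p \<noteq> {}" using that by simp
      then obtain q' where "first_in (violations p) q'"
        using first_in_exists[OF finite_violations] by metis
      then show ?thesis using qI by simp
    qed
    have fam: "p \<in> families" "family_weight p = \<mu>" if "p \<in> ?V" for p
      using that X by blast+
    let ?\<phi> = "\<lambda>p. swap_tails (q p) p"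
    have q': "q (?\<phi> p) = q p" if "p \<in> ?V" for p
      by (rule qI, rule swap_tails_first[OF fam(1)[OF that] q[OF that]])
    have \<phi>: "?\<phi> p \<in> ?V" if "p \<in> ?V" for p
    proof -
      have "?\<phi> p \<in> ?X"
        unfolding X using swap_tails_families[OF fam(1)[OF that] q[OF that]]
          swap_tails_weight[OF fam(1)[OF that] q[OF that]] fam(2)[OF that] by simp
      moreover have "violations (?\<phi> p) \<noteq> {}"
        using swap_tails_first[OF fam(1)[OF that] q[OF that]] by (auto simp: first_in_def)
      ultimately show ?thesis by simp
    qed
    have "(\<Sum>p \<in> ?V. sign (fst p)) = (\<Sum>p \<in> ?V. - sign (fst p))"
    proof (rule sum.reindex_bij_witness[of _ ?\<phi> ?\<phi>])
      fix p assume p: "p \<in> ?V"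
      show "?\<phi> (?\<phi> p) = p" using q'[OF p] by (simp add: swap_tails_involution)
      then show "?\<phi> (?\<phi> p) = p" .
      show "?\<phi> p \<in> ?V" by (rule \<phi>[OF p])
      then show "?\<phi> p \<in> ?V" .
      show "- sign (fst (?\<phi> p)) = sign (fst p)" using swap_tails_sign[OF fam(1)[OF p] q[OF p]] by simp
    qed
    then show ?thesis by (simp add: sum_negf)
  qed
  also have "(\<Sum>p \<in> ?Z. sign (fst p)) = int (card {F \<in> {F \<in> PiE {1..r} (\<lambda>i. rows i i). violations (id, F) = {}}. family_weight (id, F) = \<mu>})"
  proof -
    have id: "id \<in> valid_perms" using x_le_y by (auto simp: valid_perms_def)
    have "?Z = Pair (id :: nat \<Rightarrow> nat) ` {F \<in> {F \<in> PiE {1..r} (\<lambda>i. rows i i). violations (id, F) = {}}. family_weight (id, F) = \<mu>}"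
      (is "_ = Pair (id :: nat \<Rightarrow> nat) ` ?W")
    proof (intro equalityI subsetI)
      fix p assume p: "p \<in> ?Z"
      obtain \<sigma> F where pF: "p = (\<sigma>, F)" by (cases p)
      have "\<sigma> = id" using p no_violations_id[of \<sigma> F] by (auto simp: pF families_def)
      then have "F \<in> ?W" using p by (simp add: pF)
      then show "p \<in> Pair (id :: nat \<Rightarrow> nat) ` ?W" using \<open>\<sigma> = id\<close> pF by blast
    next
      fix p assume "p \<in> Pair (id :: nat \<Rightarrow> nat) ` ?W"
      then obtain F where "p = (id, F)" "F \<in> ?W" by blast
      then show "p \<in> ?Z" using id by simp
    qed
    then show ?thesis by (simp add: sum.reindex inj_on_def sign_id)
  qed
  finally show "coeff (\<Sum>\<sigma> \<in> valid_perms. of_int (sign \<sigma>) * (\<Prod>i \<in> {1..r}. chain_sum rel (map a [x i + 1..y (\<sigma> i)]))) \<mu> =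
      coeff (monomial_sum {F \<in> PiE {1..r} (\<lambda>i. rows i i). violations (id, F) = {}} (\<lambda>F. family_weight (id, F))) \<mu>"
    by (simp add: coeff_monomial_sum)
qed

end

section \<open>Diagrams as regions below a counting function\<close>

lemma initial_segment:
  fixes A :: "nat set"
  assumes "finite A" "0 \<notin> A" "\<And>i k. i \<in> A \<Longrightarrow> 1 \<le> k \<Longrightarrow> k \<le> i \<Longrightarrow> k \<in> A"
  shows "A = {1..card A}"
proof (cases "A = {}")
  case False
  have "A = {1..Max A}"
  proof (intro equalityI subsetI)
    fix i assume i: "i \<in> A"
    then have "i \<noteq> 0" using assms(2) by metis
    then show "i \<in> {1..Max A}" using Max_ge[OF assms(1) i] by simp
  next
    fix i assume "i \<in> {1..Max A}"
    then show "i \<in> A" using assms(3)[OF Max_in[OF assms(1) False], of i] by simp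
  qed
  then show ?thesis by (metis card_atLeastAtMost diff_Suc_1)
qed simp

definition lower_closed :: "box set \<Rightarrow> bool" where
  "lower_closed D \<longleftrightarrow> (\<forall>i j i' j'. (i, j) \<in> D \<and> 1 \<le> i' \<and> i' \<le> i \<and> 1 \<le> j' \<and> j' \<le> j \<longrightarrow> (i', j') \<in> D)"

lemma lower_closedD:
  "lower_closed D \<Longrightarrow> (i, j) \<in> D \<Longrightarrow> 1 \<le> i' \<Longrightarrow> i' \<le> i \<Longrightarrow> 1 \<le> j' \<Longrightarrow> j' \<le> j \<Longrightarrow> (i', j') \<in> D"
  unfolding lower_closed_def by blast

lemma part_antimono:
  assumes "is_partition lam" "1 \<le> i" "i \<le> i'"
  shows "part lam i' \<le> part lam i"
proof (cases "i' \<le> length lam \<and> i \<noteq> i'")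
  case True
  then have "i - 1 < i' - 1" "i' - 1 < length lam" using assms(2,3) by auto
  then have "lam ! (i' - 1) \<le> lam ! (i - 1)"
    using assms(1) sorted_wrt_nth_less unfolding is_partition_def by blast
  then show ?thesis using assms(2,3) True by (simp add: part_def)
qed (use assms in \<open>auto simp: part_def\<close>)

lemma lower_closed_diagram:
  assumes "is_partition lam"
  shows "lower_closed (diagram lam)"
  unfolding lower_closed_def
proof (intro allI impI)
  fix i j i' j' assume ij: "(i, j) \<in> diagram lam \<and> 1 \<le> i' \<and> i' \<le> i \<and> 1 \<le> j' \<and> j' \<le> j"
  then have "part lam i \<le> part lam i'" using part_antimono[OF assms, of i' i] by blast
  then show "(i', j') \<in> diagram lam" using ij by (auto simp: diagram_def)
qed

lemma diagram_rows: "(i, j) \<in> diagram lam \<Longrightarrow> 1 \<le> i \<and> i \<le> length lam \<and> 1 \<le> j \<and> j \<le> part lam i"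
  by (cases "i \<le> length lam") (auto simp: diagram_def part_def)

lemma finite_diagram: "finite (diagram lam)"
proof (rule finite_subset)
  show "diagram lam \<subseteq> (\<Union>i \<in> {1..length lam}. {i} \<times> {..part lam i})"
    using diagram_rows by fastforce
qed simp

lemma partition_of_lower_closed:
  assumes fin: "finite D" and pos: "D \<subseteq> {1..} \<times> {1..}" and low: "lower_closed D"
  shows "\<exists>\<rho>. is_partition \<rho> \<and> diagram \<rho> = D"
proof -
  define row where "row = (\<lambda>i. {j. (i, j) \<in> D})"
  have finrow: "finite (row i)" for i
    by (rule finite_subset[OF _ finite_imageI[OF fin, of snd]]) (force simp: row_def image_def)
  have row: "row i = {1..card (row i)}" for i
    by (rule initial_segment[OF finrow])
      (use pos lower_closedD[OF low, of i _ i] in \<open>auto simp: row_def\<close>)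
  define N where "N = Max (insert 0 (fst ` D))"
  have N: "i \<le> N" if "(i, j) \<in> D" for i j
    unfolding N_def using fin that by (intro Max_ge) (auto intro: rev_image_eqI)
  define \<rho> where "\<rho> = map (\<lambda>i. card (row i)) [1..<Suc N]"
  have len: "length \<rho> = N" by (simp add: \<rho>_def del: upt_Suc)
  have nth: "\<rho> ! k = card (row (Suc k))" if "k < N" for k
    unfolding \<rho>_def using that by (simp add: del: upt_Suc)
  have card0: "card (row i) = 0" if "N < i" for i
  proof -
    have "row i = {}" unfolding row_def using that N[of i] leD by blast
    then show ?thesis by simp
  qed
  have "is_partition \<rho>"
    unfolding is_partition_def sorted_wrt_iff_nth_less
  proof (intro allI impI)
    fix k l assume kl: "k < l" "l < length \<rho>"
    have "row (Suc l) \<subseteq> row (Suc k)"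
    proof
      fix j assume "j \<in> row (Suc l)"
      then show "j \<in> row (Suc k)" using pos kl lower_closedD[OF low, of "Suc l" j "Suc k" j] by (auto simp: row_def)
    qed
    then show "\<rho> ! l \<le> \<rho> ! k" using kl len nth by (auto intro: card_mono[OF finrow])
  qed
  moreover have "diagram \<rho> = D"
  proof (rule set_eqI)
    fix b :: box obtain i j where b: "b = (i, j)" by (cases b)
    have part: "part \<rho> i = card (row i)" if "1 \<le> i"
      using that nth[of "i - 1"] card0[of i] by (auto simp: part_def len)
    have "b \<in> D \<longleftrightarrow> 1 \<le> i \<and> b \<in> D" using pos b by auto
    also have "\<dots> \<longleftrightarrow> 1 \<le> i \<and> j \<in> row i" by (simp add: row_def b)
    also have "\<dots> \<longleftrightarrow> 1 \<le> i \<and> j \<in> {1..card (row i)}" using row[of i] by simp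
    also have "\<dots> \<longleftrightarrow> b \<in> diagram \<rho>" using part by (auto simp: diagram_def b)
    finally show "b \<in> diagram \<rho> \<longleftrightarrow> b \<in> D" by simp
  qed
  ultimately show ?thesis by blast
qed

definition count_ge :: "nat \<Rightarrow> (nat \<Rightarrow> int) \<Rightarrow> int \<Rightarrow> nat" where
  "count_ge r z c = card {l \<in> {1..r}. c \<le> z l}"

text \<open>
  For decreasing \<open>z\<close> this is the diagram of the partition with parts \<open>z i + i\<close>; in general \<open>z\<close> has to
  be sorted first. A diagonal with content \<open>c\<close> is filled down to the row \<open>count_ge r z c\<close>. Thus the
  order of the values of \<open>z\<close> does not matter, and changing one of them has a simple effect.
\<close>
definition region :: "nat \<Rightarrow> (nat \<Rightarrow> int) \<Rightarrow> box set" where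
  "region r z = {(i, j). 1 \<le> i \<and> 1 \<le> j \<and> i \<le> count_ge r z (int j - int i)}"

lemma count_ge_cong: "(\<And>l. l \<in> {1..r} \<Longrightarrow> z l = z' l) \<Longrightarrow> count_ge r z = count_ge r z'"
  unfolding count_ge_def by (rule ext) (metis (mono_tags, lifting) Collect_cong)

lemma region_cong: "(\<And>l. l \<in> {1..r} \<Longrightarrow> z l = z' l) \<Longrightarrow> region r z = region r z'"
  unfolding region_def by (simp only: count_ge_cong[of r z z'])

lemma count_ge_antimono: "c \<le> d \<Longrightarrow> count_ge r z d \<le> count_ge r z c"
  unfolding count_ge_def by (rule card_mono) auto

lemma count_ge_le: "count_ge r z c \<le> r"
proof -
  have "count_ge r z c \<le> card {1..r}" unfolding count_ge_def by (rule card_mono) auto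
  then show ?thesis by simp
qed

lemma count_ge_Suc: "count_ge r z c = count_ge r z (c + 1) + card {l \<in> {1..r}. z l = c}"
proof -
  have "{l \<in> {1..r}. c \<le> z l} = {l \<in> {1..r}. c + 1 \<le> z l} \<union> {l \<in> {1..r}. z l = c}" by auto
  then show ?thesis unfolding count_ge_def by (simp only:) (rule card_Un_disjoint, auto)
qed

text \<open>
  On the diagonals that meet the first \<open>r\<close> rows, the first box outside the region therefore has a
  positive column.
\<close>
lemma count_ge_low:
  assumes "\<And>l. l \<in> {1..r} \<Longrightarrow> - int l \<le> z l"
  shows "min (int r) (- c) \<le> int (count_ge r z c)"
proof -
  have "{1..min r (nat (- c))} \<subseteq> {l \<in> {1..r}. c \<le> z l}" using assms by force
  then have "card {1..min r (nat (- c))} \<le> count_ge r z c" unfolding count_ge_def by (intro card_mono) auto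
  then show ?thesis by auto
qed

lemma card_fibre_le_1:
  fixes z :: "nat \<Rightarrow> int"
  assumes "inj_on z {1..r}"
  shows "card {l \<in> {1..r}. z l = c} \<le> 1"
proof -
  have "l = l'" if "l \<in> {l \<in> {1..r}. z l = c}" "l' \<in> {l \<in> {1..r}. z l = c}" for l l'
    using inj_onD[OF assms, of l l'] that by simp
  moreover have fin: "finite {l \<in> {1..r}. z l = c}" by (rule finite_subset[of _ "{1..r}"]) auto
  ultimately have "card {l \<in> {1..r}. z l = c} \<le> Suc 0" unfolding card_le_Suc0_iff_eq[OF fin] by blast
  then show ?thesis by simp
qed

lemma count_ge_step:
  assumes "inj_on z {1..r}"
  shows "count_ge r z c \<le> count_ge r z (c + 1) + 1"
  using count_ge_Suc[of r z c] card_fibre_le_1[OF assms, of c] by simp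

lemma count_ge_plus_mono:
  assumes "inj_on z {1..r}" "c \<le> d"
  shows "int (count_ge r z c) + c \<le> int (count_ge r z d) + d"
  using assms(2)
proof (induction rule: int_ge_induct)
  case (step d)
  then show ?case using count_ge_step[OF assms(1), of d] by simp
qed simp

lemma count_ge_strict:
  assumes dec: "\<And>i. 1 \<le> i \<Longrightarrow> i < r \<Longrightarrow> z (Suc i) < z i" and i: "1 \<le> i"
  shows "i \<le> count_ge r z c \<longleftrightarrow> i \<le> r \<and> c \<le> z i"
proof -
  let ?A = "{l \<in> {1..r}. c \<le> z l}"
  have anti: "z l \<le> z k" if "1 \<le> k" "k \<le> l" "l \<le> r" for k l
    using that(2,3)
  proof (induction rule: dec_induct)
    case (step n)
    then show ?case using dec[of n] that(1) by simp
  qed simp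
  have "?A = {1..card ?A}"
    by (rule initial_segment) (use anti in \<open>fastforce+\<close>)
  then have "i \<in> ?A \<longleftrightarrow> i \<in> {1..count_ge r z c}" unfolding count_ge_def by simp
  then show ?thesis using i by simp
qed

lemma finite_region: "finite (region r z)"
proof (rule finite_subset)
  show "region r z \<subseteq> {..r} \<times> (\<Union>l\<in>{1..r}. {..nat (z l + int r)})"
  proof
    fix b assume b: "b \<in> region r z"
    obtain i j where ij: "b = (i, j)" by (cases b)
    have "1 \<le> i" "i \<le> count_ge r z (int j - int i)" using b by (auto simp: region_def ij)
    then have "i \<le> r" "{l \<in> {1..r}. int j - int i \<le> z l} \<noteq> {}"
      using count_ge_le[of r z "int j - int i"] by (auto simp: count_ge_def simp del: Collect_empty_eq)
    then obtain l where "l \<in> {1..r}" "int j - int i \<le> z l" by blast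
    then show "b \<in> {..r} \<times> (\<Union>l\<in>{1..r}. {..nat (z l + int r)})" using \<open>i \<le> r\<close> ij by force
  qed
qed simp

lemma lower_closed_region:
  assumes "inj_on z {1..r}"
  shows "lower_closed (region r z)"
  unfolding lower_closed_def
proof (intro allI impI)
  fix i j i' j'
  assume "(i, j) \<in> region r z \<and> 1 \<le> i' \<and> i' \<le> i \<and> 1 \<le> j' \<and> j' \<le> j"
  then have ij: "i \<le> count_ge r z (int j - int i)" "1 \<le> i'" "i' \<le> i" "1 \<le> j'" "j' \<le> j" by (auto simp: region_def)
  have "int (count_ge r z (int j - int i)) + (int j - int i) \<le> int (count_ge r z (int j - int i')) + (int j - int i')"
    using ij by (intro count_ge_plus_mono[OF assms]) simp
  then have "i' \<le> count_ge r z (int j - int i')" using ij by linarith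
  also have "\<dots> \<le> count_ge r z (int j' - int i')" using ij by (intro count_ge_antimono) simp
  finally show "(i', j') \<in> region r z" using ij by (simp add: region_def)
qed

lemma partition_region:
  assumes "inj_on z {1..r}"
  shows "\<exists>\<rho>. is_partition \<rho> \<and> region r z = diagram \<rho>"
  using partition_of_lower_closed[OF finite_region _ lower_closed_region[OF assms]]
  by (force simp: region_def)

lemma diagram_region:
  assumes "is_partition lam" "length lam = r"
  shows "diagram lam = region r (\<lambda>i. int (part lam i) - int i)"
proof (rule set_eqI)
  fix b :: box obtain i j where b: "b = (i, j)" by (cases b)
  have "i \<le> count_ge r (\<lambda>i. int (part lam i) - int i) (int j - int i) \<longleftrightarrow>
      i \<le> r \<and> int j - int i \<le> int (part lam i) - int i" if "1 \<le> i"
  proof (rule count_ge_strict[OF _ that])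
    fix k :: nat assume "1 \<le> k"
    then show "int (part lam (Suc k)) - int (Suc k) < int (part lam k) - int k"
      using part_antimono[OF assms(1), of k "Suc k"] by simp
  qed
  moreover have "part lam i = 0" if "r < i" using that assms(2) by (simp add: part_def)
  ultimately show "b \<in> diagram lam \<longleftrightarrow> b \<in> region r (\<lambda>i. int (part lam i) - int i)"
    by (auto simp: diagram_def region_def b)
qed

subsection \<open>Raising one entry adds a ribbon\<close>

lemma count_ge_upd:
  assumes k: "k \<in> {1..r}" and le: "z k \<le> v"
  shows "count_ge r (z(k := v)) c = count_ge r z c + (if z k < c \<and> c \<le> v then 1 else 0)"
proof -
  let ?A = "{l \<in> {1..r} - {k}. c \<le> z l}"
  have "{l \<in> {1..r}. c \<le> z l} = (if c \<le> z k then insert k ?A else ?A)"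
    "{l \<in> {1..r}. c \<le> (z(k := v)) l} = (if c \<le> v then insert k ?A else ?A)" using k by auto
  then show ?thesis unfolding count_ge_def using le by (auto simp: card_insert_if)
qed

lemma region_upd_diff:
  assumes "k \<in> {1..r}" "z k \<le> v"
  shows "region r (z(k := v)) - region r z =
    {(i, j). 1 \<le> i \<and> 1 \<le> j \<and> z k < int j - int i \<and> int j - int i \<le> v \<and> i = count_ge r z (int j - int i) + 1}"
  unfolding region_def count_ge_upd[of k r z v, OF assms] by (auto split: if_splits)

lemma region_upd_mono:
  assumes "k \<in> {1..r}" "z k \<le> v"
  shows "region r z \<subseteq> region r (z(k := v))"
  unfolding region_def count_ge_upd[of k r z v, OF assms] by auto

text \<open>
  The first box of content \<open>c\<close> that does not belong to the region.
\<close>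
definition strip_box :: "nat \<Rightarrow> (nat \<Rightarrow> int) \<Rightarrow> int \<Rightarrow> box" where
  "strip_box r z c = (count_ge r z c + 1, nat (int (count_ge r z c) + 1 + c))"

text \<open>
  Raising \<open>z k\<close> to \<open>v\<close> increases the counting function by 1 at the contents \<open>z k + 1, \<dots>, v\<close>, which
  adds one box on each of these diagonals.
\<close>
lemma strip_box:
  assumes low: "\<And>l. l \<in> {1..r} \<Longrightarrow> - int l \<le> z l" and k: "k \<in> {1..r}" and le: "z k \<le> v"
  shows "region r (z(k := v)) - region r z = strip_box r z ` {z k<..v}"
    and "c \<in> {z k<..v} \<Longrightarrow> content (strip_box r z c) = c"
proof -
  have pos: "1 \<le> int (count_ge r z c) + 1 + c" if "z k < c" for c
    using count_ge_low[OF low, of r c] low[OF k] k that by auto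
  show c: "content (strip_box r z c) = c" if "c \<in> {z k<..v}" for c
    using pos[of c] that by (simp add: strip_box_def content_def)
  show "region r (z(k := v)) - region r z = strip_box r z ` {z k<..v}"
  proof (intro equalityI subsetI)
    fix b assume b: "b \<in> region r (z(k := v)) - region r z"
    obtain i j where ij: "b = (i, j)" by (cases b)
    have "z k < int j - int i \<and> int j - int i \<le> v \<and> i = count_ge r z (int j - int i) + 1"
      using b unfolding region_upd_diff[of k r z v, OF k le] ij mem_Collect_eq prod.case by blast
    then have c: "z k < int j - int i" "int j - int i \<le> v" "i = count_ge r z (int j - int i) + 1" by blast+
    define n where "n = count_ge r z (int j - int i)"
    have "strip_box r z (int j - int i) = (n + 1, nat (int n + 1 + (int j - int i)))"
      by (simp add: strip_box_def n_def)
    moreover have "i = n + 1" using c(3) by (simp only: n_def)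
    ultimately have "b = strip_box r z (int j - int i)" by (simp add: ij)
    moreover have "int j - int i \<in> {z k<..v}" using c(1,2) by simp
    ultimately show "b \<in> strip_box r z ` {z k<..v}" by (rule image_eqI)
  next
    fix b assume "b \<in> strip_box r z ` {z k<..v}"
    then obtain d where d: "d \<in> {z k<..v}" "b = strip_box r z d" by blast
    obtain i j where ij: "b = (i, j)" by (cases b)
    have e: "int j - int i = d" using c[OF d(1)] unfolding d(2)[symmetric] ij by (simp add: content_def)
    have "i = count_ge r z d + 1" "1 \<le> i" "1 \<le> j"
      using d ij pos[of d] by (auto simp: strip_box_def)
    then show "b \<in> region r (z(k := v)) - region r z"
      unfolding region_upd_diff[of k r z v, OF k le] ij mem_Collect_eq prod.case e using d(1) by auto
  qed
qed

lemma
  assumes low: "\<And>l. l \<in> {1..r} \<Longrightarrow> - int l \<le> z l" and k: "k \<in> {1..r}" and le: "z k \<le> v"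
  shows inj_content_strip: "inj_on content (region r (z(k := v)) - region r z)"
    and content_strip: "content ` (region r (z(k := v)) - region r z) = {z k<..v}"
    and card_strip: "int (card (region r (z(k := v)) - region r z)) = v - z k"
proof -
  have sb: "region r (z(k := v)) - region r z = strip_box r z ` {z k<..v}"
    "\<And>c. c \<in> {z k<..v} \<Longrightarrow> content (strip_box r z c) = c"
    using strip_box[of r z k v] low k le by blast+
  have "(\<lambda>c. content (strip_box r z c)) ` {z k<..v} = (\<lambda>c. c) ` {z k<..v}"
    by (rule image_cong[OF refl sb(2)])
  then show img: "content ` (region r (z(k := v)) - region r z) = {z k<..v}"
    unfolding sb(1) image_image by simp
  show inj: "inj_on content (region r (z(k := v)) - region r z)"
    unfolding sb(1) by (rule inj_on_imageI) (use sb(2) in \<open>simp add: inj_on_def\<close>)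
  show "int (card (region r (z(k := v)) - region r z)) = v - z k"
    using card_image[OF inj] img le by simp
qed

lemma ribbon_strip:
  assumes low: "\<And>l. l \<in> {1..r} \<Longrightarrow> - int l \<le> z l" and k: "k \<in> {1..r}" and less: "z k < v"
    and inj: "inj_on z {1..r}" and inj': "inj_on (z(k := v)) {1..r}"
  shows "ribbon (region r (z(k := v)) - region r z)"
    and "bottom_left_end (region r (z(k := v)) - region r z) (strip_box r z (z k + 1))"
proof -
  let ?\<theta> = "region r (z(k := v)) - region r z" and ?b = "strip_box r z"
  have le: "z k \<le> v" using less by simp
  have sb: "?\<theta> = ?b ` {z k<..v}" "\<And>c. c \<in> {z k<..v} \<Longrightarrow> content (?b c) = c"
    using strip_box[of r z k v] low k le by blast+
  have count': "count_ge r z c + 1 = count_ge r (z(k := v)) c" if "c \<in> {z k<..v}" for c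
    using that unfolding count_ge_upd[of k r z v, OF k le] by simp
  have row_anti: "fst (?b d) \<le> fst (?b c)" if "c \<le> d" for c d
    using count_ge_antimono[OF that] by (simp add: strip_box_def)
  have col_mono: "snd (?b c) \<le> snd (?b d)" if "c \<le> d" for c d
    using count_ge_plus_mono[OF inj that] by (simp add: strip_box_def)
  have skew: "skew_diagram ?\<theta>"
  proof -
    obtain lam where lam: "is_partition lam" "region r (z(k := v)) = diagram lam" using partition_region[OF inj'] by blast
    obtain mu where mu: "is_partition mu" "region r z = diagram mu" using partition_region[OF inj] by blast
    show ?thesis unfolding skew_diagram_def
      using lam mu region_upd_mono[of k r z v, OF k le] by (intro exI[of _ lam] exI[of _ mu]) simp
  qed
  have first: "z k + 1 \<in> {z k<..v}" using less by simp
  have conn: "box_connected ?\<theta>"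
  proof -
    let ?R = "{(x, y). x \<in> ?\<theta> \<and> y \<in> ?\<theta> \<and> adjacent x y}"
    have adj: "adjacent (?b c) (?b (c + 1))" if c: "c \<in> {z k<..v}" "c + 1 \<in> {z k<..v}" for c
    proof -
      have j: "int (snd (?b e)) = int (fst (?b e)) + e" if "e \<in> {z k<..v}" for e
        using sb(2)[OF that] by (simp add: content_def case_prod_unfold)
      have "count_ge r (z(k := v)) (c + 1) \<le> count_ge r (z(k := v)) c" by (rule count_ge_antimono) simp
      then have "fst (?b c) = fst (?b (c + 1)) \<or> fst (?b c) = fst (?b (c + 1)) + 1"
        using count_ge_step[OF inj', of c] count'[OF c(1)] count'[OF c(2)] by (auto simp: strip_box_def)
      then show ?thesis using j[OF c(1)] j[OF c(2)] by (auto simp: adjacent_def case_prod_unfold)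
    qed
    have path: "(?b (z k + 1), ?b c) \<in> ?R\<^sup>*" if "z k + 1 \<le> c" "c \<le> v" for c
      using that
    proof (induction rule: int_ge_induct)
      case (step c)
      then have "c \<in> {z k<..v}" "c + 1 \<in> {z k<..v}" by auto
      then have "(?b c, ?b (c + 1)) \<in> ?R" using adj[of c] unfolding sb(1) by blast
      moreover have "(?b (z k + 1), ?b c) \<in> ?R\<^sup>*" by (rule step.IH) (use step.prems in simp)
      ultimately show ?case by (rule rtrancl_into_rtrancl[rotated])
    qed simp
    have "sym ?R" by (auto simp: sym_def adjacent_def)
    then have sym: "sym (?R\<^sup>*)" by (rule sym_rtrancl)
    show ?thesis unfolding box_connected_def
    proof (intro ballI)
      fix p q assume "p \<in> ?\<theta>" "q \<in> ?\<theta>"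
      then have "(?b (z k + 1), p) \<in> ?R\<^sup>*" "(?b (z k + 1), q) \<in> ?R\<^sup>*"
        using path unfolding sb(1) by auto
      then show "(p, q) \<in> ?R\<^sup>*" using sym by (meson rtrancl_trans symD)
    qed
  qed
  have "\<not> {(i, j), (i, j + 1), (i + 1, j), (i + 1, j + 1)} \<subseteq> ?\<theta>" for i j
  proof
    assume "{(i, j), (i, j + 1), (i + 1, j), (i + 1, j + 1)} \<subseteq> ?\<theta>"
    then have "(i, j) \<in> ?\<theta>" "(i + 1, j + 1) \<in> ?\<theta>" by auto
    then have "(i, j) = (i + 1, j + 1)"
      using inj_onD[OF inj_content_strip[of r z k v, OF low k le], of "(i, j)" "(i + 1, j + 1)"] by (simp add: content_def)
    then show False by simp
  qed
  then show "ribbon ?\<theta>"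
    unfolding ribbon_def using skew conn first by (auto simp: sb(1))
  show "bottom_left_end ?\<theta> (?b (z k + 1))"
    unfolding bottom_left_end_def
  proof (intro conjI ballI)
    show "?b (z k + 1) \<in> ?\<theta>" unfolding sb(1) using first by blast
    fix q assume "q \<in> ?\<theta>"
    then obtain c where "c \<in> {z k<..v}" "q = ?b c" unfolding sb(1) by blast
    then show "case q of (i, j) \<Rightarrow> i \<le> fst (?b (z k + 1)) \<and> snd (?b (z k + 1)) \<le> j"
      using row_anti[of "z k + 1" c] col_mono[of "z k + 1" c] by (simp add: case_prod_unfold)
  qed
qed

text \<open>
  If two boxes had the same content, then the skew diagram would contain a block of four boxes. The
  contents form an interval because neighbouring boxes have contents that differ by 1.
\<close>
lemma ribbon_contents:
  assumes rib: "ribbon \<theta>" and e: "bottom_left_end \<theta> (i0, j0)"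
  shows "inj_on content \<theta>" and "content ` \<theta> = {content (i0, j0)..<content (i0, j0) + int (card \<theta>)}"
proof -
  obtain lam mu where lam: "is_partition lam" "is_partition mu" and \<theta>: "\<theta> = diagram lam - diagram mu"
    using rib by (auto simp: ribbon_def skew_diagram_def)
  have fin: "finite \<theta>" unfolding \<theta> using finite_diagram by simp
  have convex: "(i, j) \<in> \<theta>" if "(i1, j1) \<in> \<theta>" "(i2, j2) \<in> \<theta>" "i1 \<le> i" "i \<le> i2" "j1 \<le> j" "j \<le> j2" for i1 j1 i2 j2 i j
  proof -
    have "1 \<le> i1" "1 \<le> j1" using that(1) diagram_rows unfolding \<theta> by blast+
    moreover have "(i, j) \<in> diagram lam"
      using lower_closedD[OF lower_closed_diagram[OF lam(1)], of i2 j2 i j] that calculation unfolding \<theta> by auto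
    moreover have "(i, j) \<notin> diagram mu"
      using lower_closedD[OF lower_closed_diagram[OF lam(2)], of i j i1 j1] that calculation unfolding \<theta> by auto
    ultimately show ?thesis unfolding \<theta> by blast
  qed
  have distinct_rows: "i2 \<le> i1" if "(i1, j1) \<in> \<theta>" "(i2, j2) \<in> \<theta>" "content (i1, j1) = content (i2, j2)" for i1 j1 i2 j2
  proof (rule ccontr)
    assume "\<not> i2 \<le> i1"
    then have "i1 + 1 \<le> i2" "j1 + 1 \<le> j2" using that(3) by (auto simp: content_def)
    then have "{(i1, j1), (i1, j1 + 1), (i1 + 1, j1), (i1 + 1, j1 + 1)} \<subseteq> \<theta>"
      using convex[OF that(1,2)] that(1) by auto
    then show False using rib unfolding ribbon_def by blast
  qed
  show inj: "inj_on content \<theta>"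
  proof (rule inj_onI)
    fix p q assume pq: "p \<in> \<theta>" "q \<in> \<theta>" "content p = content q"
    obtain i1 j1 i2 j2 where p: "p = (i1, j1)" and q: "q = (i2, j2)" by (cases p, cases q)
    have "i1 = i2" using distinct_rows[of i1 j1 i2 j2] distinct_rows[of i2 j2 i1 j1] pq by (simp add: p q)
    then show "p = q" using pq(3) by (simp add: p q content_def)
  qed
  let ?c0 = "content (i0, j0)"
  have b0: "(i0, j0) \<in> \<theta>" using e by (simp add: bottom_left_end_def)
  have ge: "?c0 \<le> content q" if "q \<in> \<theta>" for q
    using e that by (cases q) (fastforce simp: bottom_left_end_def content_def)
  have all: "c \<in> content ` \<theta>" if "q \<in> \<theta>" "?c0 \<le> c" "c \<le> content q" for c q
  proof -
    have "((i0, j0), q) \<in> {(x, y). x \<in> \<theta> \<and> y \<in> \<theta> \<and> adjacent x y}\<^sup>*"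
      using rib b0 that(1) unfolding ribbon_def box_connected_def by blast
    then show ?thesis using that(2,3)
    proof (induction arbitrary: c rule: rtrancl_induct)
      case base
      then have "c = ?c0" by simp
      then show ?case using b0 by blast
    next
      case (step p q)
      have "content q \<le> content p + 1" using step.hyps(2) by (auto simp: adjacent_def content_def)
      then have "c \<le> content p \<or> c = content q" using step.prems by linarith
      then show ?case using step by auto
    qed
  qed
  let ?m = "Max (content ` \<theta>)"
  have finc: "finite (content ` \<theta>)" using fin by simp
  have "?m \<in> content ` \<theta>" using finc b0 by (intro Max_in) auto
  then obtain q where q: "q \<in> \<theta>" "content q = ?m" by auto
  have seg: "content ` \<theta> = {?c0..?m}"
  proof (intro equalityI subsetI)
    fix c assume "c \<in> content ` \<theta>"
    then show "c \<in> {?c0..?m}" using ge finc by auto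
  next
    fix c assume "c \<in> {?c0..?m}"
    then show "c \<in> content ` \<theta>" using all[OF q(1), of c] q(2) by simp
  qed
  have "card \<theta> = card {?c0..?m}" using card_image[OF inj] unfolding seg[symmetric] by simp
  then have "int (card \<theta>) = ?m + 1 - ?c0" using ge[OF q(1)] q(2) by simp
  then show "content ` \<theta> = {?c0..<?c0 + int (card \<theta>)}" using seg by auto
qed

lemma (in linorder)
  assumes inj: "inj_on f A" and fin: "finite A"
  shows set_sorted_key_list: "set (sorted_key_list_of_set f A) = A"
    and strict_sorted_key_list: "sorted_wrt (<) (map f (sorted_key_list_of_set f A))"
proof -
  interpret folding_insort_key "(\<le>)" "(<)" A f
    by unfold_locales (rule inj)
  show "set (sorted_key_list_of_set f A) = A" by (rule set_sorted_key_list_of_set[OF subset_refl fin])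
  show "sorted_wrt (<) (map f (sorted_key_list_of_set f A))" by (rule strict_sorted_key_list_of_set[OF subset_refl])
qed

lemma read_up_strip:
  assumes inj: "inj_on content \<theta>" and img: "content ` \<theta> = {c..d}" and a: "\<And>b. b \<in> \<theta> \<Longrightarrow> \<delta> b = a (content b)"
  shows "read_up \<delta> \<theta> = map a [c..d]"
proof -
  let ?L = "sorted_key_list_of_set content \<theta>"
  have fin: "finite \<theta>" using inj img by (metis finite_atLeastAtMost_int finite_image_iff)
  have set: "set ?L = \<theta>" by (rule set_sorted_key_list[OF inj fin])
  have "map content ?L = [c..d]"
  proof (rule strict_sorted_equal)
    show "sorted_wrt (<) (map content ?L)" by (rule strict_sorted_key_list[OF inj fin])
    show "set (map content ?L) = set [c..d]" using set img by simp
  qed simp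
  moreover have "map \<delta> ?L = map a (map content ?L)" using a set by simp
  ultimately show ?thesis by (simp add: read_up_def)
qed

section \<open>Rim decompositions and permutations\<close>

locale skew_shape =
  fixes r :: nat and \<kappa> \<tau> :: "nat list"
  assumes partitions: "is_partition \<kappa>" "is_partition \<tau>"
    and lengths: "length \<kappa> = r" "length \<tau> = r"
    and contained: "diagram \<tau> \<subseteq> diagram \<kappa>"
begin

definition x :: "nat \<Rightarrow> int" where "x i = int (part \<tau> i) - int i"
definition y :: "nat \<Rightarrow> int" where "y i = int (part \<kappa> i) - int i"

lemma x_less: "1 \<le> i \<Longrightarrow> x (Suc i) < x i"
  using part_antimono[OF partitions(2), of i "Suc i"] by (simp add: x_def)

lemma y_less: "1 \<le> i \<Longrightarrow> y (Suc i) < y i"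
  using part_antimono[OF partitions(1), of i "Suc i"] by (simp add: y_def)

lemma x_antimono: "1 \<le> i \<Longrightarrow> i < k \<Longrightarrow> x k < x i"
  using part_antimono[OF partitions(2), of i k] by (simp add: x_def)

lemma y_antimono: "1 \<le> i \<Longrightarrow> i < k \<Longrightarrow> y k < y i"
  using part_antimono[OF partitions(1), of i k] by (simp add: y_def)

lemma y_inj: "inj_on y {1..r}"
proof (rule inj_onI)
  fix i k assume "i \<in> {1..r}" "k \<in> {1..r}" "y i = y k"
  then show "i = k" using y_antimono[of i k] y_antimono[of k i] by (cases i k rule: linorder_cases) auto
qed

lemma part_le: "1 \<le> i \<Longrightarrow> part \<tau> i \<le> part \<kappa> i"
proof (cases "part \<tau> i = 0")
  case False
  assume "1 \<le> i"
  then have "(i, part \<tau> i) \<in> diagram \<tau>" using False by (simp add: diagram_def)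
  then show ?thesis using contained by (auto simp: diagram_def)
qed simp

lemma x_le_y: "1 \<le> i \<Longrightarrow> x i \<le> y i"
  using part_le by (simp add: x_def y_def)

lemma x_low: "- int i \<le> x i"
  by (simp add: x_def)

definition perms :: "(nat \<Rightarrow> nat) set" where
  "perms = {\<sigma>. \<sigma> permutes {1..r} \<and> (\<forall>i \<in> {1..r}. x i \<le> y (\<sigma> i))}"

text \<open>
  The shifted parts, in some order, of the partition that is reached after \<open>k\<close> ribbons, when the
  \<open>i\<close>-th ribbon ends at content \<open>v i\<close>.
\<close>
definition stage :: "(nat \<Rightarrow> int) \<Rightarrow> nat \<Rightarrow> nat \<Rightarrow> int" where
  "stage v k l = (if l \<le> k then v l else x l)"

definition rims :: "(nat \<Rightarrow> int) \<Rightarrow> nat \<Rightarrow> box set" where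
  "rims v = (\<lambda>k \<in> {1..r}. region r (stage v k) - region r (stage v (k - 1)))"

lemma stage_upd: "1 \<le> k \<Longrightarrow> stage v k = (stage v (k - 1))(k := v k)"
  by (auto simp: stage_def fun_eq_iff)

lemma stage_at: "1 \<le> k \<Longrightarrow> stage v (k - 1) k = x k"
  by (cases k) (simp_all add: stage_def)

lemma region_stage_0: "region r (stage v 0) = diagram \<tau>"
  unfolding diagram_region[OF partitions(2) lengths(2)]
  by (rule region_cong) (simp add: stage_def x_def)

lemma diagram_\<kappa>: "diagram \<kappa> = region r y"
  unfolding diagram_region[OF partitions(1) lengths(1)]
  by (rule region_cong) (simp add: y_def)

lemma stage_low:
  assumes "\<And>i. i \<in> {1..r} \<Longrightarrow> x i \<le> v i" "l \<in> {1..r}"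
  shows "- int l \<le> stage v k l"
  using assms(1)[OF assms(2)] x_low[of l] by (simp add: stage_def)

lemma rims_strip:
  assumes v: "\<And>i. i \<in> {1..r} \<Longrightarrow> x i \<le> v i" and k: "k \<in> {1..r}"
  shows "inj_on content (rims v k)" "content ` rims v k = {x k<..v k}" "int (card (rims v k)) = v k - x k"
    and "region r (stage v (k - 1)) \<union> rims v k = region r (stage v k)"
proof -
  have k1: "1 \<le> k" using k by simp
  have eq: "rims v k = region r ((stage v (k - 1))(k := v k)) - region r (stage v (k - 1))"
    using k by (simp add: rims_def stage_upd[OF k1, of v])
  have le: "stage v (k - 1) k \<le> v k" using v[OF k] stage_at[OF k1] by simp
  note strip = inj_content_strip[of r "stage v (k - 1)" k "v k", OF stage_low[OF v] k le]
    content_strip[of r "stage v (k - 1)" k "v k", OF stage_low[OF v] k le]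
    card_strip[of r "stage v (k - 1)" k "v k", OF stage_low[OF v] k le]
  show "inj_on content (rims v k)" "content ` rims v k = {x k<..v k}" "int (card (rims v k)) = v k - x k"
    using strip unfolding eq stage_at[OF k1] by blast+
  show "region r (stage v (k - 1)) \<union> rims v k = region r (stage v k)"
    unfolding eq stage_upd[OF k1, of v]
    using region_upd_mono[of k r "stage v (k - 1)" "v k", OF k le] by blast
qed

lemma union_rims:
  assumes v: "\<And>i. i \<in> {1..r} \<Longrightarrow> x i \<le> v i"
  shows "k \<le> r \<Longrightarrow> diagram \<tau> \<union> (\<Union>l \<in> {1..k}. rims v l) = region r (stage v k)"
proof (induction k)
  case (Suc k)
  have "{1..Suc k} = insert (Suc k) {1..k}" by auto
  then have "diagram \<tau> \<union> (\<Union>l \<in> {1..Suc k}. rims v l) = (diagram \<tau> \<union> (\<Union>l \<in> {1..k}. rims v l)) \<union> rims v (Suc k)"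
    by (simp only:) blast
  also have "\<dots> = region r (stage v k) \<union> rims v (Suc k)" using Suc by simp
  also have "\<dots> = region r (stage v (Suc k))" using rims_strip(4)[of v "Suc k", OF v] Suc.prems by simp
  finally show ?case .
qed (simp add: region_stage_0)

lemma permsD:
  assumes "\<sigma> \<in> perms"
  shows "\<sigma> permutes {1..r}" "i \<in> {1..r} \<Longrightarrow> x i \<le> y (\<sigma> i)"
  using assms by (auto simp: perms_def)

lemma region_stage_r:
  assumes "\<sigma> permutes {1..r}"
  shows "region r (stage (\<lambda>i. y (\<sigma> i)) r) = diagram \<kappa>"
proof -
  have "count_ge r (\<lambda>i. y (\<sigma> i)) c = count_ge r y c" for c
  proof -
    have "\<sigma> ` {l \<in> {1..r}. c \<le> y (\<sigma> l)} = {l \<in> {1..r}. c \<le> y l}"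
    proof (intro equalityI subsetI)
      fix l assume l: "l \<in> {l \<in> {1..r}. c \<le> y l}"
      then obtain k where "k \<in> {1..r}" "l = \<sigma> k" using permutes_image[OF assms] by blast
      then show "l \<in> \<sigma> ` {l \<in> {1..r}. c \<le> y (\<sigma> l)}" using l by auto
    next
      fix l assume "l \<in> \<sigma> ` {l \<in> {1..r}. c \<le> y (\<sigma> l)}"
      then show "l \<in> {l \<in> {1..r}. c \<le> y l}" using permutes_in_image[OF assms] by auto
    qed
    then show ?thesis
      unfolding count_ge_def using card_image[OF inj_on_subset[OF permutes_inj[OF assms] subset_UNIV]] by metis
  qed
  then have "region r (\<lambda>i. y (\<sigma> i)) = region r y" by (simp add: region_def)
  then show ?thesis unfolding diagram_\<kappa>
    using region_cong[of r "stage (\<lambda>i. y (\<sigma> i)) r" "\<lambda>i. y (\<sigma> i)"] by (simp add: stage_def)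
qed

lemma stage_inj:
  assumes \<sigma>: "\<sigma> \<in> perms"
  shows "inj_on (stage (\<lambda>i. y (\<sigma> i)) k) {1..r}"
proof -
  have less: "stage (\<lambda>i. y (\<sigma> i)) k l \<noteq> stage (\<lambda>i. y (\<sigma> i)) k l'" if l: "l \<in> {1..r}" "l' \<in> {1..r}" "l < l'" for l l'
  proof -
    consider "l' \<le> k" | "l \<le> k" "k < l'" | "k < l" by linarith
    then show ?thesis
    proof cases
      case 1
      have "\<sigma> l \<noteq> \<sigma> l'" using permutes_inj[OF permsD(1)[OF \<sigma>]] l(3) by (metis injD less_irrefl)
      moreover have "\<sigma> l \<in> {1..r}" "\<sigma> l' \<in> {1..r}" using permutes_in_image[OF permsD(1)[OF \<sigma>]] l by blast+
      ultimately have "y (\<sigma> l) \<noteq> y (\<sigma> l')" using inj_onD[OF y_inj] by blast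
      then show ?thesis using 1 l by (simp add: stage_def)
    next
      case 2
      have "x l' < x l" using l by (intro x_antimono) auto
      then show ?thesis using 2 permsD(2)[OF \<sigma> l(1)] by (simp add: stage_def)
    next
      case 3
      then show ?thesis using l x_antimono[of l l'] by (simp add: stage_def)
    qed
  qed
  show ?thesis
  proof (rule inj_onI)
    fix l l' assume "l \<in> {1..r}" "l' \<in> {1..r}" "stage (\<lambda>i. y (\<sigma> i)) k l = stage (\<lambda>i. y (\<sigma> i)) k l'"
    then show "l = l'" using less[of l l'] less[of l' l] by (cases l l' rule: linorder_cases) auto
  qed
qed

lemma rims_ribbon:
  assumes \<sigma>: "\<sigma> \<in> perms" and k: "k \<in> {1..r}" and ne: "rims (\<lambda>i. y (\<sigma> i)) k \<noteq> {}"
  shows "ribbon (rims (\<lambda>i. y (\<sigma> i)) k)"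
    and "bottom_left_end (rims (\<lambda>i. y (\<sigma> i)) k) (k, part \<tau> k + 1)"
proof -
  let ?v = "\<lambda>i. y (\<sigma> i)"
  let ?z = "stage ?v (k - 1)"
  have k1: "1 \<le> k" using k by simp
  have v: "x i \<le> ?v i" if "i \<in> {1..r}" for i using permsD(2)[OF \<sigma> that] .
  have eq: "rims ?v k = region r (?z(k := ?v k)) - region r ?z"
    using k by (simp add: rims_def stage_upd[OF k1, of ?v])
  have "{x k<..?v k} \<noteq> {}" using rims_strip(2)[of ?v k, OF v k] ne by auto
  then have less: "?z k < ?v k" unfolding stage_at[OF k1] by simp
  have inj: "inj_on ?z {1..r}" "inj_on (?z(k := ?v k)) {1..r}"
    using stage_inj[OF \<sigma>, of "k - 1"] stage_inj[OF \<sigma>, of k] unfolding stage_upd[OF k1, of ?v] by simp_all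
  note rib = ribbon_strip[of r ?z k "?v k", OF stage_low[OF v] k less inj]
  show "ribbon (rims ?v k)" unfolding eq using rib(1) by blast
  have "{l \<in> {1..r}. x k + 1 \<le> ?z l} = {1..k - 1}"
  proof (intro equalityI subsetI)
    fix l assume l: "l \<in> {l \<in> {1..r}. x k + 1 \<le> ?z l}"
    show "l \<in> {1..k - 1}"
    proof (cases "k \<le> l")
      case True
      then have "x l \<le> x k" using x_antimono[of k l] k1 by (cases "k = l") auto
      moreover have "\<not> l \<le> k - 1" using True k1 by linarith
      then have "?z l = x l" by (simp add: stage_def)
      ultimately show ?thesis using l by simp
    next
      case False
      then show ?thesis using l by simp
    qed
  next
    fix l assume l: "l \<in> {1..k - 1}"
    then have "l \<in> {1..r}" "x k < x l" using k x_antimono[of l k] by auto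
    then show "l \<in> {l \<in> {1..r}. x k + 1 \<le> ?z l}" using l v[of l] by (simp add: stage_def)
  qed
  then have "count_ge r ?z (x k + 1) = k - 1" by (simp add: count_ge_def)
  then have "strip_box r ?z (?z k + 1) = (k, part \<tau> k + 1)"
    unfolding stage_at[OF k1] using k1 by (simp add: strip_box_def x_def of_nat_diff)
  then show "bottom_left_end (rims ?v k) (k, part \<tau> k + 1)" unfolding eq using rib(2) by metis
qed

lemma rims_Rim_H:
  assumes \<sigma>: "\<sigma> \<in> perms"
  shows "rims (\<lambda>i. y (\<sigma> i)) \<in> Rim_H r \<kappa> \<tau>"
proof -
  let ?v = "\<lambda>i. y (\<sigma> i)"
  have v: "x i \<le> ?v i" if "i \<in> {1..r}" for i using permsD(2)[OF \<sigma> that] .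
  have un: "diagram \<tau> \<union> (\<Union>l \<in> {1..k}. rims ?v l) = region r (stage ?v k)" if "k \<le> r" for k
    using union_rims[OF v that] by simp
  have sub: "rims ?v l \<subseteq> region r (stage ?v k)" if "1 \<le> l" "l \<le> k" "k \<le> r" for k l
    using un[OF that(3)] that by fastforce
  have top: "region r (stage ?v r) = diagram \<kappa>" by (rule region_stage_r[OF permsD(1)[OF \<sigma>]])
  have out: "rims ?v l \<inter> region r (stage ?v k) = {}" if "k < l" "l \<in> {1..r}" for k l
  proof -
    have "region r (stage ?v k) \<subseteq> region r (stage ?v (l - 1))"
      using un[of k] un[of "l - 1"] that by fastforce
    then show ?thesis using that by (auto simp: rims_def)
  qed
  show ?thesis unfolding Rim_H_def rim_sequences_def
  proof (intro CollectI conjI ballI)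
    show "rims ?v \<in> {1..r} \<rightarrow>\<^sub>E Pow (diagram \<kappa> - diagram \<tau>)"
    proof
      fix k assume k: "k \<in> {1..r}"
      show "rims ?v k \<in> Pow (diagram \<kappa> - diagram \<tau>)"
        using sub[of k r] out[of 0 k] k top region_stage_0[of ?v] by auto
    qed (auto simp: rims_def)
    show "rims ?v k = {} \<or> ribbon (rims ?v k) \<and> bottom_left_end (rims ?v k) (k, part \<tau> k + 1)" if "k \<in> {1..r}" for k
      using rims_ribbon[OF \<sigma> that] by blast
    show "disjoint_family_on (rims ?v) {1..r}"
      unfolding disjoint_family_on_def
    proof (intro ballI impI)
      have less: "rims ?v k \<inter> rims ?v l = {}" if "k \<in> {1..r}" "l \<in> {1..r}" "k < l" for k l
      proof -
        have "rims ?v k \<subseteq> region r (stage ?v k)" using sub[of k k] that by simp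
        then show ?thesis using out[OF that(3,2)] by blast
      qed
      fix k l assume kl: "k \<in> {1..r}" "l \<in> {1..r}" "k \<noteq> l"
      then show "rims ?v k \<inter> rims ?v l = {}"
        using less[of k l] less[of l k] by (cases k l rule: linorder_cases) auto
    qed
    show "\<exists>\<rho>. is_partition \<rho> \<and> diagram \<tau> \<union> (\<Union>l \<in> {1..k}. rims ?v l) = diagram \<rho>" if "k \<in> {1..r}" for k
    proof -
      have "k \<le> r" using that by simp
      show ?thesis unfolding un[OF \<open>k \<le> r\<close>] by (rule partition_region[OF stage_inj[OF \<sigma>]])
    qed
    show "diagram \<tau> \<union> (\<Union>l \<in> {1..r}. rims ?v l) = diagram \<kappa>" 
      unfolding un[OF order_refl] by (rule top)
  qed
qed

lemma perm_eqI:
  assumes "\<sigma> permutes {1..r}" "\<sigma>' permutes {1..r}" "\<And>i. i \<in> {1..r} \<Longrightarrow> y (\<sigma> i) = y (\<sigma>' i)"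
  shows "\<sigma> = \<sigma>'"
proof
  fix i show "\<sigma> i = \<sigma>' i"
  proof (cases "i \<in> {1..r}")
    case True
    then have "\<sigma> i \<in> {1..r}" "\<sigma>' i \<in> {1..r}"
      using permutes_in_image[OF assms(1), of i] permutes_in_image[OF assms(2), of i] by blast+
    then show ?thesis using inj_onD[OF y_inj] assms(3)[OF True] by blast
  next
    case False
    then show ?thesis using permutes_not_in[OF assms(1)] permutes_not_in[OF assms(2)] by metis
  qed
qed

lemma sign_rims:
  assumes \<sigma>: "\<sigma> \<in> perms"
  shows "sign_H r \<kappa> \<tau> (rims (\<lambda>i. y (\<sigma> i))) = sign \<sigma>"
proof -
  have v: "x i \<le> y (\<sigma> i)" if "i \<in> {1..r}" for i using permsD(2)[OF \<sigma> that] .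
  have card: "int (card (rims (\<lambda>i. y (\<sigma> i)) i)) = y (\<sigma> i) - x i" if "i \<in> {1..r}" for i
    using rims_strip(3)[of "\<lambda>i. y (\<sigma> i)", OF v that] by simp
  have "(THE \<sigma>'. \<sigma>' permutes {1..r} \<and> (\<forall>i \<in> {1..r}. int (card (rims (\<lambda>i. y (\<sigma> i)) i)) =
      int (part \<kappa> (\<sigma>' i)) - int (\<sigma>' i) - int (part \<tau> i) + int i)) = \<sigma>"
  proof (rule the_equality)
    show "\<sigma> permutes {1..r} \<and> (\<forall>i \<in> {1..r}. int (card (rims (\<lambda>i. y (\<sigma> i)) i)) =
      int (part \<kappa> (\<sigma> i)) - int (\<sigma> i) - int (part \<tau> i) + int i)"
      using permsD(1)[OF \<sigma>] card by (simp add: x_def y_def)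
    fix \<sigma>' assume \<sigma>': "\<sigma>' permutes {1..r} \<and> (\<forall>i \<in> {1..r}. int (card (rims (\<lambda>i. y (\<sigma> i)) i)) =
      int (part \<kappa> (\<sigma>' i)) - int (\<sigma>' i) - int (part \<tau> i) + int i)"
    show "\<sigma>' = \<sigma>"
    proof (rule perm_eqI)
      fix i assume i: "i \<in> {1..r}"
      then have "y (\<sigma> i) - x i = int (part \<kappa> (\<sigma>' i)) - int (\<sigma>' i) - int (part \<tau> i) + int i"
        unfolding card[OF i, symmetric] using \<sigma>' by blast
      then show "y (\<sigma>' i) = y (\<sigma> i)" by (simp add: x_def y_def)
    qed (use \<sigma>' permsD(1)[OF \<sigma>] in auto)
  qed
  then show ?thesis by (simp add: sign_H_def rim_sign_def)
qed

lemma rims_inj: "inj_on (\<lambda>\<sigma>. rims (\<lambda>i. y (\<sigma> i))) perms"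
proof (rule inj_onI)
  fix \<sigma> \<sigma>' assume \<sigma>: "\<sigma> \<in> perms" "\<sigma>' \<in> perms" and eq: "rims (\<lambda>i. y (\<sigma> i)) = rims (\<lambda>i. y (\<sigma>' i))"
  show "\<sigma> = \<sigma>'"
  proof (rule perm_eqI[OF permsD(1)[OF \<sigma>(1)] permsD(1)[OF \<sigma>(2)]])
    fix i assume i: "i \<in> {1..r}"
    have "int (card (rims (\<lambda>i. y (\<sigma> i)) i)) = y (\<sigma> i) - x i"
      by (rule rims_strip(3)[of "\<lambda>i. y (\<sigma> i)", OF permsD(2)[OF \<sigma>(1)] i])
    moreover have "int (card (rims (\<lambda>i. y (\<sigma>' i)) i)) = y (\<sigma>' i) - x i"
      by (rule rims_strip(3)[of "\<lambda>i. y (\<sigma>' i)", OF permsD(2)[OF \<sigma>(2)] i])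
    ultimately show "y (\<sigma> i) = y (\<sigma>' i)" unfolding eq by linarith
  qed
qed

text \<open>
  Each diagonal that the ribbon meets is extended by exactly one box: by the first box outside the
  region, since the union is closed towards the upper left.
\<close>
lemma Rim_H_step:
  assumes low: "\<And>l. l \<in> {1..r} \<Longrightarrow> - int l \<le> z l" and k: "k \<in> {1..r}" and zk: "z k = x k"
    and closed: "lower_closed (region r z \<union> \<theta>)" and disj: "\<theta> \<inter> region r z = {}"
    and rib: "ribbon \<theta>" and e: "bottom_left_end \<theta> (k, part \<tau> k + 1)"
  shows "region r z \<union> \<theta> = region r (z(k := x k + int (card \<theta>)))"
proof -
  let ?v = "x k + int (card \<theta>)"
  have le: "z k \<le> ?v" by (simp add: zk)
  have c0: "content (k, part \<tau> k + 1) = x k + 1" by (simp add: content_def x_def)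
  have inj: "inj_on content \<theta>" and img: "content ` \<theta> = {x k<..?v}"
    using ribbon_contents[OF rib e] unfolding c0 by auto
  have pos: "1 \<le> i \<and> 1 \<le> j" if "(i, j) \<in> \<theta>" for i j
    using rib that diagram_rows unfolding ribbon_def skew_diagram_def by blast
  have row: "i = count_ge r z (int j - int i) + 1" if ij: "(i, j) \<in> \<theta>" for i j
  proof (rule ccontr)
    let ?n = "count_ge r z (int j - int i)"
    assume ne: "i \<noteq> ?n + 1"
    have "(i, j) \<notin> region r z" using disj ij by blast
    then have "?n < i" using pos[OF ij] by (simp add: region_def)
    then have i: "?n + 2 \<le> i" using ne by simp
    have "content (i, j) \<in> {x k<..?v}" using img ij by blast
    then have "x k < int j - int i" by (simp add: content_def)
    then have "- int k < int j - int i" using x_low[of k] by linarith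
    then have "- (int j - int i) \<le> int ?n" using count_ge_low[OF low, of r "int j - int i"] k by auto
    then have j: "2 \<le> j" using i by linarith
    have c: "int (j - 1) - int (i - 1) = int j - int i" using i j by auto
    have "(i - 1, j - 1) \<in> region r z \<union> \<theta>"
      using lower_closedD[OF closed, of i j "i - 1" "j - 1"] ij i j by auto
    moreover have "\<not> i - 1 \<le> ?n" using i by linarith
    then have "(i - 1, j - 1) \<notin> region r z" by (simp add: region_def c del: One_nat_def)
    ultimately have "(i - 1, j - 1) \<in> \<theta>" by blast
    then have "(i - 1, j - 1) = (i, j)" using inj_onD[OF inj, of "(i - 1, j - 1)" "(i, j)"] ij c by (simp add: content_def)
    then show False using i by auto
  qed
  have "region r (z(k := ?v)) - region r z = \<theta>"
  proof (intro equalityI subsetI)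
    fix b assume b: "b \<in> \<theta>"
    obtain i j where ij: "b = (i, j)" by (cases b)
    have "content b \<in> {x k<..?v}" using img b by blast
    then have "x k < int j - int i" "int j - int i \<le> ?v" by (simp_all add: content_def ij)
    then show "b \<in> region r (z(k := ?v)) - region r z"
      unfolding region_upd_diff[of k r z ?v, OF k le] ij mem_Collect_eq prod.case zk
      using row[of i j] pos[of i j] b ij by blast
  next
    fix b assume b: "b \<in> region r (z(k := ?v)) - region r z"
    obtain i j where ij: "b = (i, j)" by (cases b)
    have b': "x k < int j - int i \<and> int j - int i \<le> ?v \<and> i = count_ge r z (int j - int i) + 1"
      using b unfolding region_upd_diff[of k r z ?v, OF k le] ij mem_Collect_eq prod.case zk by blast
    then have "int j - int i \<in> content ` \<theta>" unfolding img by simp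
    then obtain i' j' where ij': "(i', j') \<in> \<theta>" "int j' - int i' = int j - int i" by (auto simp: content_def)
    then have "i' = i" using row[OF ij'(1)] b' by (simp only:)
    then show "b \<in> \<theta>" using ij' ij by simp
  qed
  then show ?thesis using region_upd_mono[of k r z ?v, OF k le] by blast
qed

text \<open>
  When the ribbons are added one after the other, \<open>Rim_H_step\<close> identifies each of them from its size.
\<close>
lemma Rim_H_rims:
  assumes \<Theta>: "\<Theta> \<in> Rim_H r \<kappa> \<tau>"
  defines "v \<equiv> \<lambda>i. x i + int (card (\<Theta> i))"
  shows "\<Theta> = rims v" and "region r (stage v r) = diagram \<kappa>"
proof -
  have ext: "\<Theta> \<in> {1..r} \<rightarrow>\<^sub>E Pow (diagram \<kappa> - diagram \<tau>)"
    and rib: "\<And>k. k \<in> {1..r} \<Longrightarrow> \<Theta> k = {} \<or> ribbon (\<Theta> k) \<and> bottom_left_end (\<Theta> k) (k, part \<tau> k + 1)"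
    and disj: "disjoint_family_on \<Theta> {1..r}"
    and part: "\<And>k. k \<in> {1..r} \<Longrightarrow> \<exists>\<rho>. is_partition \<rho> \<and> diagram \<tau> \<union> (\<Union>l \<in> {1..k}. \<Theta> l) = diagram \<rho>"
    and all: "diagram \<tau> \<union> (\<Union>l \<in> {1..r}. \<Theta> l) = diagram \<kappa>"
    using \<Theta> unfolding Rim_H_def rim_sequences_def mem_Collect_eq by simp_all
  have v: "x i \<le> v i" for i by (simp add: v_def)
  have new: "\<Theta> (Suc k) \<inter> (diagram \<tau> \<union> (\<Union>l \<in> {1..k}. \<Theta> l)) = {}" if "Suc k \<le> r" for k
  proof -
    have "\<Theta> (Suc k) \<inter> \<Theta> l = {}" if "l \<in> {1..k}" for l
      using disj \<open>Suc k \<le> r\<close> that unfolding disjoint_family_on_def by auto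
    moreover have "\<Theta> (Suc k) \<inter> diagram \<tau> = {}" using PiE_mem[OF ext, of "Suc k"] that by auto
    ultimately show ?thesis by blast
  qed
  have un: "diagram \<tau> \<union> (\<Union>l \<in> {1..k}. \<Theta> l) = region r (stage v k)" if "k \<le> r" for k
    using that
  proof (induction k)
    case 0
    then show ?case by (simp add: region_stage_0)
  next
    case (Suc k)
    have k: "Suc k \<in> {1..r}" using Suc.prems by simp
    have step: "diagram \<tau> \<union> (\<Union>l \<in> {1..Suc k}. \<Theta> l) = region r (stage v k) \<union> \<Theta> (Suc k)"
    proof -
      have "{1..Suc k} = insert (Suc k) {1..k}" by auto
      then show ?thesis using Suc by (auto simp del: atLeastAtMost_iff)
    qed
    have st: "stage v (Suc k) = (stage v k)(Suc k := v (Suc k))" using stage_upd[of "Suc k" v] by simp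
    show ?case
    proof (cases "\<Theta> (Suc k) = {}")
      case True
      then have "v (Suc k) = stage v k (Suc k)" by (simp add: v_def stage_def)
      then have "stage v (Suc k) = stage v k" unfolding st by (simp only: fun_upd_triv)
      then show ?thesis using step True by simp
    next
      case False
      obtain \<rho> where "is_partition \<rho>" "region r (stage v k) \<union> \<Theta> (Suc k) = diagram \<rho>"
        using part[OF k] step by metis
      then have closed: "lower_closed (region r (stage v k) \<union> \<Theta> (Suc k))"
        using lower_closed_diagram by metis
      have d: "\<Theta> (Suc k) \<inter> region r (stage v k) = {}" using new[of k] Suc by simp
      have "region r (stage v k) \<union> \<Theta> (Suc k) = region r ((stage v k)(Suc k := x (Suc k) + int (card (\<Theta> (Suc k)))))"
        by (rule Rim_H_step[OF stage_low k _ closed d]) (use v rib[OF k] False in \<open>auto simp: stage_def\<close>)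
      moreover have "v (Suc k) = x (Suc k) + int (card (\<Theta> (Suc k)))" by (simp add: v_def)
      ultimately show ?thesis unfolding step st by (simp only:)
    qed
  qed
  show "region r (stage v r) = diagram \<kappa>" using un[of r] all by simp
  show "\<Theta> = rims v"
  proof
    fix k show "\<Theta> k = rims v k"
    proof (cases "k \<in> {1..r}")
      case True
      then obtain l where l: "k = Suc l" "Suc l \<le> r" by (cases k) auto
      have "{1..Suc l} = insert (Suc l) {1..l}" by auto
      then have "region r (stage v (Suc l)) - region r (stage v l) = \<Theta> (Suc l)"
        using un[of "Suc l"] un[of l] new[of l] l by (auto simp del: atLeastAtMost_iff)
      then show ?thesis using l True by (simp add: rims_def)
    next
      case False
      then show ?thesis unfolding rims_def restrict_def using PiE_arb[OF ext False] by (simp only: if_False)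
    qed
  qed
qed

text \<open>
  The region determines the counting function and hence the values of \<open>z\<close> with their multiplicities.
\<close>
lemma same_region_perm:
  assumes low: "\<And>l. l \<in> {1..r} \<Longrightarrow> - int l \<le> z l" and eq: "region r z = diagram \<kappa>"
  shows "\<exists>\<sigma>. \<sigma> permutes {1..r} \<and> (\<forall>i \<in> {1..r}. y (\<sigma> i) = z i)"
proof -
  have le: "count_ge r z1 c \<le> count_ge r z2 c"
    if "region r z1 = region r z2" and low: "\<And>l. l \<in> {1..r} \<Longrightarrow> - int l \<le> z2 l" for z1 z2 c
  proof (cases "1 \<le> count_ge r z1 c \<and> 1 \<le> int (count_ge r z1 c) + c")
    case True
    let ?n = "count_ge r z1 c"
    let ?j = "nat (int ?n + c)"
    have j: "1 \<le> ?j" "int ?j - int ?n = c" using True by linarith+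
    have "(?n, ?j) \<in> region r z1" unfolding region_def mem_Collect_eq prod.case j(2) using True j(1) by blast
    then have "(?n, ?j) \<in> region r z2" using that(1) by simp
    then show ?thesis unfolding region_def mem_Collect_eq prod.case j(2) by blast
  next
    case False
    then show ?thesis using count_ge_low[OF low, of r c] count_ge_le[of r z1 c] by auto
  qed
  have ylow: "- int l \<le> y l" for l by (simp add: y_def)
  have eq': "region r z = region r y" using eq diagram_\<kappa> by simp
  \<comment> \<open>Equal regions only give equal counts on the part of a diagonal with positive columns; elsewhere
    \<open>count_ge_low\<close> gives the inequality.\<close>
  have "count_ge r z c = count_ge r y c" for c
    using le[OF eq' ylow, of c] le[OF eq'[symmetric] low, of c] by simp
  then have fibre: "card {l \<in> {1..r}. z l = c} = card {l \<in> {1..r}. y l = c}" for c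
    using count_ge_Suc[of r z c] count_ge_Suc[of r y c] by simp
  have fin: "finite {l \<in> {1..r}. z l = c}" for c by simp
  have zinj: "inj_on z {1..r}"
  proof (rule inj_onI)
    fix l l' assume l: "l \<in> {1..r}" "l' \<in> {1..r}" "z l = z l'"
    have "card {k \<in> {1..r}. z k = z l'} \<le> Suc 0" using fibre[of "z l'"] card_fibre_le_1[OF y_inj] by simp
    then show "l = l'" unfolding card_le_Suc0_iff_eq[OF fin] using l by blast
  qed
  have ex: "\<exists>m. m \<in> {1..r} \<and> y m = z l" if "l \<in> {1..r}" for l
  proof -
    have "card {k \<in> {1..r}. z k = z l} \<noteq> 0" using that by (auto simp: card_eq_0_iff)
    then have "{k \<in> {1..r}. y k = z l} \<noteq> {}" unfolding fibre by (metis card.empty)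
    then show ?thesis by blast
  qed
  define \<sigma> where "\<sigma> = (\<lambda>l. if l \<in> {1..r} then SOME m. m \<in> {1..r} \<and> y m = z l else l)"
  have \<sigma>: "\<sigma> l \<in> {1..r} \<and> y (\<sigma> l) = z l" if "l \<in> {1..r}" for l
    using someI_ex[OF ex[OF that]] that by (simp only: \<sigma>_def if_True)
  have "inj_on \<sigma> {1..r}"
  proof (rule inj_onI)
    fix l l' assume "l \<in> {1..r}" "l' \<in> {1..r}" "\<sigma> l = \<sigma> l'"
    then show "l = l'" using \<sigma> inj_onD[OF zinj] by metis
  qed
  moreover have "\<sigma> ` {1..r} \<subseteq> {1..r}" using \<sigma> by blast
  ultimately have "bij_betw \<sigma> {1..r} {1..r}"
    unfolding bij_betw_def using endo_inj_surj[of "{1..r}" \<sigma>] by simp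
  then have "\<sigma> permutes {1..r}" by (rule bij_imp_permutes) (simp only: \<sigma>_def if_False)
  then show ?thesis using \<sigma> by blast
qed

lemma Rim_H_eq: "Rim_H r \<kappa> \<tau> = (\<lambda>\<sigma>. rims (\<lambda>i. y (\<sigma> i))) ` perms"
proof (intro equalityI subsetI)
  fix \<Theta> assume \<Theta>: "\<Theta> \<in> Rim_H r \<kappa> \<tau>"
  let ?v = "\<lambda>i. x i + int (card (\<Theta> i))"
  have top: "region r ?v = diagram \<kappa>"
    using Rim_H_rims(2)[OF \<Theta>] region_cong[of r "stage ?v r" ?v] by (simp add: stage_def)
  have "- int l \<le> ?v l" for l using x_low[of l] by simp
  then obtain \<sigma> where \<sigma>: "\<sigma> permutes {1..r}" "\<And>i. i \<in> {1..r} \<Longrightarrow> y (\<sigma> i) = ?v i"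
    using same_region_perm[of ?v, OF _ top] by blast
  have "\<sigma> \<in> perms" using \<sigma> by (simp add: perms_def)
  moreover have "region r (stage (\<lambda>i. y (\<sigma> i)) k) = region r (stage ?v k)" for k
    using \<sigma>(2) by (intro region_cong) (simp add: stage_def)
  then have "rims (\<lambda>i. y (\<sigma> i)) = rims ?v" by (simp add: rims_def)
  then have "\<Theta> = rims (\<lambda>i. y (\<sigma> i))" using Rim_H_rims(1)[OF \<Theta>] by simp
  ultimately show "\<Theta> \<in> (\<lambda>\<sigma>. rims (\<lambda>i. y (\<sigma> i))) ` perms" by blast
qed (use rims_Rim_H in blast)

text \<open>
  The ribbon \<open>i\<close> has the contents \<open>x i + 1, \<dots>, y (\<sigma> i)\<close>, and reading it upwards means reading it by
  increasing content.
\<close>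
theorem Rim_H_sum:
  assumes \<delta>: "\<And>b. b \<in> diagram \<kappa> - diagram \<tau> \<Longrightarrow> \<delta> b = a (content b)"
  shows "(\<Sum>\<Theta> \<in> Rim_H r \<kappa> \<tau>. of_int (sign_H r \<kappa> \<tau> \<Theta>) * (\<Prod>i \<in> {1..r}. chain_sum rel (read_up \<delta> (\<Theta> i)))) =
    (\<Sum>\<sigma> \<in> perms. of_int (sign \<sigma>) * (\<Prod>i \<in> {1..r}. chain_sum rel (map a [x i + 1..y (\<sigma> i)])))"
  unfolding Rim_H_eq sum.reindex[OF rims_inj] comp_def
proof (rule sum.cong[OF refl])
  fix \<sigma> assume \<sigma>: "\<sigma> \<in> perms"
  have "read_up \<delta> (rims (\<lambda>i. y (\<sigma> i)) i) = map a [x i + 1..y (\<sigma> i)]" if i: "i \<in> {1..r}" for i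
  proof (rule read_up_strip)
    show "inj_on content (rims (\<lambda>i. y (\<sigma> i)) i)"
      using rims_strip(1)[of "\<lambda>i. y (\<sigma> i)", OF permsD(2)[OF \<sigma>] i] by simp
    show "content ` rims (\<lambda>i. y (\<sigma> i)) i = {x i + 1..y (\<sigma> i)}"
      using rims_strip(2)[of "\<lambda>i. y (\<sigma> i)", OF permsD(2)[OF \<sigma>] i] by auto
    fix b assume "b \<in> rims (\<lambda>i. y (\<sigma> i)) i"
    moreover have "rims (\<lambda>i. y (\<sigma> i)) i \<subseteq> diagram \<kappa> - diagram \<tau>"
      using rims_Rim_H[OF \<sigma>] i unfolding Rim_H_def rim_sequences_def by (auto dest: PiE_mem)
    ultimately show "\<delta> b = a (content b)" using \<delta> by blast
  qed
  then show "of_int (sign_H r \<kappa> \<tau> (rims (\<lambda>i. y (\<sigma> i)))) *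
      (\<Prod>i \<in> {1..r}. chain_sum rel (read_up \<delta> (rims (\<lambda>i. y (\<sigma> i)) i))) =
      of_int (sign \<sigma>) * (\<Prod>i \<in> {1..r}. chain_sum rel (map a [x i + 1..y (\<sigma> i)]))"
    using sign_rims[OF \<sigma>] by (metis (no_types, lifting) prod.cong)
qed

end

section \<open>Rim expansions of Schur type functions\<close>

text \<open>
  On a skew diagram, \<open>\<le>\<close> gives the semistandard tableaux and \<open><\<close> their transposes, with strict rows and
  weak columns.
\<close>
definition tableaux :: "(nat \<Rightarrow> nat \<Rightarrow> bool) \<Rightarrow> box set \<Rightarrow> (box \<Rightarrow> nat) set" where
  "tableaux rel \<nu> = {m \<in> fillings \<nu>.
     (\<forall>i j j'. (i, j) \<in> \<nu> \<and> (i, j') \<in> \<nu> \<and> j < j' \<longrightarrow> rel (m (i, j)) (m (i, j'))) \<and>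
     (\<forall>i j. (i, j) \<in> \<nu> \<and> (Suc i, j) \<in> \<nu> \<longrightarrow> \<not> rel (m (Suc i, j)) (m (i, j)))}"

context skew_shape
begin

definition boxes :: "box set" where "boxes = diagram \<kappa> - diagram \<tau>"

lemma mem_boxes: "(i, j) \<in> boxes \<longleftrightarrow> i \<in> {1..r} \<and> x i < int j - int i \<and> int j - int i \<le> y i"
proof (cases "i \<in> {1..r}")
  case True
  then show ?thesis by (auto simp: boxes_def diagram_def x_def y_def)
next
  case False
  then show ?thesis using diagram_rows[of i j \<kappa>] lengths by (auto simp: boxes_def)
qed

lemma nat_col: "x i < c \<Longrightarrow> int (nat (c + int i)) - int i = c"
  using x_low[of i] by simp

lemma weight_boxes:
  assumes \<delta>: "\<And>b. b \<in> boxes \<Longrightarrow> \<delta> b = a (content b)"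
    and m: "\<And>i j. (i, j) \<in> boxes \<Longrightarrow> m (i, j) = F i (int j - int i)"
  shows "weight \<delta> boxes m = (\<Sum>i\<in>{1..r}. weight a {x i<..y i} (F i))"
proof -
  have "(\<Sum>i\<in>{1..r}. weight a {x i<..y i} (F i)) =
      (\<Sum>(i, c) \<in> Sigma {1..r} (\<lambda>i. {x i<..y i}). Poly_Mapping.single (F i c) (a c))"
    unfolding weight_def by (rule sum.Sigma) auto
  also have "\<dots> = (\<Sum>b\<in>boxes. Poly_Mapping.single (m b) (\<delta> b))"
  proof (rule sum.reindex_bij_witness[of _ "\<lambda>(i, j). (i, int j - int i)" "\<lambda>(i, c). (i, nat (c + int i))"])
    fix p assume p: "p \<in> Sigma {1..r} (\<lambda>i. {x i<..y i})"
    obtain i c where ic: "p = (i, c)" by (cases p)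
    have c: "int (nat (c + int i)) - int i = c" using p nat_col by (simp add: ic)
    then show "(\<lambda>(i, j). (i, int j - int i)) ((\<lambda>(i, c). (i, nat (c + int i))) p) = p" by (simp add: ic)
    have box: "(i, nat (c + int i)) \<in> boxes" unfolding mem_boxes c using p by (auto simp: ic)
    then show "(\<lambda>(i, c). (i, nat (c + int i))) p \<in> boxes" by (simp add: ic)
    have "\<delta> (i, nat (c + int i)) = a c" using \<delta>[OF box] c by (simp add: content_def)
    moreover have "m (i, nat (c + int i)) = F i c" using m[OF box] c by simp
    ultimately show "Poly_Mapping.single (m ((\<lambda>(i, c). (i, nat (c + int i))) p)) (\<delta> ((\<lambda>(i, c). (i, nat (c + int i))) p)) =
        (\<lambda>(i, c). Poly_Mapping.single (F i c) (a c)) p" by (simp add: ic)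
  next
    fix b assume b: "b \<in> boxes"
    obtain i j where ij: "b = (i, j)" by (cases b)
    show "(\<lambda>(i, c). (i, nat (c + int i))) ((\<lambda>(i, j). (i, int j - int i)) b) = b" by (simp add: ij)
    show "(\<lambda>(i, j). (i, int j - int i)) b \<in> Sigma {1..r} (\<lambda>i. {x i<..y i})"
      using b unfolding ij mem_boxes by simp
  qed
  finally show ?thesis by (simp add: weight_def)
qed

text \<open>
  Rows without violations are the same as tableaux, when the box \<open>(i, j)\<close> is given the value of row
  \<open>i\<close> at content \<open>j - i\<close>.
\<close>
theorem rim_expansion:
  assumes rel: "\<And>u v w. rel u v \<Longrightarrow> rel v w \<Longrightarrow> rel u w" "\<And>u v w. \<not> rel u v \<Longrightarrow> rel u w \<Longrightarrow> rel v w"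
    and a: "\<And>c. 1 \<le> a c" and \<delta>: "\<And>b. b \<in> boxes \<Longrightarrow> \<delta> b = a (content b)"
  shows "(\<Sum>\<Theta> \<in> Rim_H r \<kappa> \<tau>. of_int (sign_H r \<kappa> \<tau> \<Theta>) * (\<Prod>i \<in> {1..r}. chain_sum rel (read_up \<delta> (\<Theta> i)))) =
    monomial_sum (tableaux rel boxes) (weight \<delta> boxes)"
proof -
  interpret row_family rel r x y a
    by unfold_locales (use rel a x_less y_less x_le_y in blast)+
  let ?G = "{F \<in> PiE {1..r} (\<lambda>i. rows i i). violations (id, F) = {}}"
  let ?h = "\<lambda>F. \<lambda>(i, j) \<in> boxes. F i (int j - int i)"
  let ?g = "\<lambda>m. \<lambda>i \<in> {1..r}. \<lambda>c \<in> {x i<..y i}. m (i, nat (c + int i))"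
  have h: "?h F (i, j) = F i (int j - int i)" if "(i, j) \<in> boxes" for F :: "nat \<Rightarrow> int \<Rightarrow> nat" and i j
    using that by simp
  have box: "(i, nat (c + int i)) \<in> boxes" if "i \<in> {1..r}" "x i < c" "c \<le> y i" for i c
    unfolding mem_boxes nat_col[OF that(2)] using that by simp
  have g: "?g m i c = m (i, nat (c + int i))" if "i \<in> {1..r}" "x i < c" "c \<le> y i" for m :: "box \<Rightarrow> nat" and i c
    using that by simp
  have viol: "violations (id, F) = {} \<longleftrightarrow> (\<forall>i j. (i, j) \<in> boxes \<and> (Suc i, j) \<in> boxes \<longrightarrow>
      \<not> rel (F (Suc i) (int j - int (Suc i))) (F i (int j - int i)))" for F :: "nat \<Rightarrow> int \<Rightarrow> nat"
  proof
    assume none: "violations (id, F) = {}"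
    show "\<forall>i j. (i, j) \<in> boxes \<and> (Suc i, j) \<in> boxes \<longrightarrow>
      \<not> rel (F (Suc i) (int j - int (Suc i))) (F i (int j - int i))"
    proof (intro allI impI notI)
      fix i j assume b: "(i, j) \<in> boxes \<and> (Suc i, j) \<in> boxes"
        and "rel (F (Suc i) (int j - int (Suc i))) (F i (int j - int i))"
      then have "(int j - int i, i) \<in> violations (id, F)"
        by (auto simp: violations_def mem_boxes algebra_simps)
      then show False using none by simp
    qed
  next
    assume all: "\<forall>i j. (i, j) \<in> boxes \<and> (Suc i, j) \<in> boxes \<longrightarrow>
      \<not> rel (F (Suc i) (int j - int (Suc i))) (F i (int j - int i))"
    show "violations (id, F) = {}"
    proof (rule ccontr)
      assume "violations (id, F) \<noteq> {}"
      then obtain c i where "(c, i) \<in> violations (id, F)" by (metis ex_in_conv surj_pair)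
      then have i: "1 \<le> i" "i < r" "x i < c" "c - 1 \<le> y (Suc i)" and rel_c: "c \<le> y i \<longrightarrow> rel (F (Suc i) (c - 1)) (F i c)"
        by (auto simp: violations_def)
      have y: "c \<le> y i" using i y_less[of i] by simp
      have x: "x (Suc i) < c - 1" using i x_less[of i] by simp
      let ?j = "nat (c + int i)"
      have j: "int ?j - int i = c" by (rule nat_col[OF i(3)])
      then have j': "int ?j - int (Suc i) = c - 1" by simp
      have "(i, ?j) \<in> boxes" unfolding mem_boxes j using i y by simp
      moreover have "(Suc i, ?j) \<in> boxes" unfolding mem_boxes j' using i x by simp
      ultimately have "\<not> rel (F (Suc i) (int ?j - int (Suc i))) (F i (int ?j - int i))" using all by blast
      then show False unfolding j j' using rel_c y by blast
    qed
  qed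
  have "bij_betw ?h ?G (tableaux rel boxes)"
  proof (rule bij_betw_byWitness[where f' = ?g])
    show "\<forall>F \<in> ?G. ?g (?h F) = F"
    proof
      fix F assume F: "F \<in> ?G"
      show "?g (?h F) = F"
      proof
        fix i show "?g (?h F) i = F i"
        proof (cases "i \<in> {1..r}")
          case True
          then have Fi: "F i \<in> rows i i" using F by (auto dest: PiE_mem)
          show ?thesis
          proof
            fix c show "?g (?h F) i c = F i c"
            proof (cases "x i < c \<and> c \<le> y i")
              case c: True
              then show ?thesis using h[OF box[OF True, of c], of F] nat_col[of i c] True by simp
            next
              case False
              then show ?thesis using True rowsD(3,4)[OF Fi, of c] by auto
            qed
          qed
        next
          case False
          then show ?thesis using F PiE_arb[of F "{1..r}" "\<lambda>i. rows i i" i] by auto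
        qed
      qed
    qed
    show "\<forall>m \<in> tableaux rel boxes. ?h (?g m) = m"
    proof
      fix m assume m: "m \<in> tableaux rel boxes"
      show "?h (?g m) = m"
      proof
        fix b :: box obtain i j where ij: "b = (i, j)" by (cases b)
        show "?h (?g m) b = m b"
        proof (cases "(i, j) \<in> boxes")
          case True
          then have "i \<in> {1..r}" "x i < int j - int i" "int j - int i \<le> y i" using mem_boxes by blast+
          then show ?thesis unfolding ij h[OF True] using g[of i "int j - int i" m] by simp
        next
          case False
          then show ?thesis using m PiE_arb[of m boxes "\<lambda>_. {1..}" b] ij
            by (auto simp: tableaux_def fillings_def)
        qed
      qed
    qed
    show "?h ` ?G \<subseteq> tableaux rel boxes"
    proof (rule image_subsetI)
      fix F assume F: "F \<in> ?G"
      then have Fi: "F i \<in> rows i i" if "i \<in> {1..r}" for i using that by (auto dest: PiE_mem)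
      show "?h F \<in> tableaux rel boxes"
        unfolding tableaux_def fillings_def
      proof (intro CollectI conjI allI impI)
        show "?h F \<in> boxes \<rightarrow>\<^sub>E {1..}"
        proof
          fix b assume b: "b \<in> boxes"
          obtain i j where ij: "b = (i, j)" by (cases b)
          show "?h F b \<in> {1..}"
            using b rowsD(2)[OF Fi, of i "int j - int i"] unfolding ij by (simp add: mem_boxes)
        qed simp
        fix i j j' assume b: "(i, j) \<in> boxes \<and> (i, j') \<in> boxes \<and> j < j'"
        then have bb: "(i, j) \<in> boxes" "(i, j') \<in> boxes" by blast+
        show "rel (?h F (i, j)) (?h F (i, j'))"
          unfolding h[OF bb(1)] h[OF bb(2)] using b by (intro rowsD(1)[OF Fi]) (auto simp: mem_boxes)
      next
        fix i j assume b: "(i, j) \<in> boxes \<and> (Suc i, j) \<in> boxes"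
        then have bb: "(i, j) \<in> boxes" "(Suc i, j) \<in> boxes" by blast+
        show "\<not> rel (?h F (Suc i, j)) (?h F (i, j))"
          unfolding h[OF bb(1)] h[OF bb(2)] using F viol[of F] b by blast
      qed
    qed
    show "?g ` tableaux rel boxes \<subseteq> ?G"
    proof (rule image_subsetI)
      fix m assume m: "m \<in> tableaux rel boxes"
      have row: "?g m i \<in> rows i i" if i: "i \<in> {1..r}" for i
      proof (rule rowsI)
        fix c d assume cd: "x i < c" "c < d" "d \<le> y i"
        then have "(i, nat (c + int i)) \<in> boxes" "(i, nat (d + int i)) \<in> boxes" using box i by auto
        moreover have "nat (c + int i) < nat (d + int i)" using nat_col[of i c] nat_col[of i d] cd by linarith
        ultimately have "rel (m (i, nat (c + int i))) (m (i, nat (d + int i)))" using m by (simp add: tableaux_def)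
        then show "rel (?g m i c) (?g m i d)" using cd i by simp
      next
        fix c assume c: "x i < c" "c \<le> y i"
        then have "m (i, nat (c + int i)) \<in> {1..}"
          using m box[OF i] unfolding tableaux_def fillings_def by blast
        then show "1 \<le> ?g m i c" using c i by simp
      qed (use i in auto)
      moreover have "\<not> rel (?g m (Suc i) (int j - int (Suc i))) (?g m i (int j - int i))"
        if b: "(i, j) \<in> boxes" "(Suc i, j) \<in> boxes" for i j
      proof -
        have "?g m (Suc i) (int j - int (Suc i)) = m (Suc i, j)" "?g m i (int j - int i) = m (i, j)"
          using b unfolding mem_boxes by simp_all
        moreover have "\<not> rel (m (Suc i, j)) (m (i, j))" using m b by (simp add: tableaux_def)
        ultimately show ?thesis by simp
      qed
      then have "violations (id, ?g m) = {}" unfolding viol by blast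
      ultimately show "?g m \<in> ?G" by (intro CollectI conjI PiE_I) auto
    qed
  qed
  moreover have "weight \<delta> boxes (?h F) = family_weight (id, F)" for F
  proof -
    have "weight \<delta> boxes (?h F) = (\<Sum>i\<in>{1..r}. weight a {x i<..y i} (F i))"
      by (rule weight_boxes) (use \<delta> h in blast)+
    then show ?thesis by (simp add: family_weight_def)
  qed
  ultimately have "monomial_sum ?G (\<lambda>F. family_weight (id, F)) = monomial_sum (tableaux rel boxes) (weight \<delta> boxes)"
    by (intro monomial_sum_reindex[where h = ?h])
  moreover have "perms = valid_perms" by (simp add: perms_def valid_perms_def)
  ultimately show ?thesis
    using Rim_H_sum[of \<delta> a rel] \<delta> signed_sum_rows by (simp add: boxes_def)
qed

lemma boxes_column: "(i, j) \<in> boxes \<Longrightarrow> (i', j) \<in> boxes \<Longrightarrow> i \<le> k \<Longrightarrow> k \<le> i' \<Longrightarrow> (k, j) \<in> boxes"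
  using lower_closedD[OF lower_closed_diagram[OF partitions(1)], of i' j k j]
    lower_closedD[OF lower_closed_diagram[OF partitions(2)], of k j i j] diagram_rows[of i j \<kappa>]
  by (auto simp: boxes_def)

lemma tableaux_le: "tableaux (\<le>) boxes = SSYT boxes"
proof (intro equalityI subsetI)
  fix m assume m: "m \<in> tableaux (\<le>) boxes"
  have col: "m (i, j) < m (i', j)" if "i < i'" "(i, j) \<in> boxes" "(i', j) \<in> boxes" for i i' j
    using that
  proof (induction i' rule: less_Suc_induct)
    case (1 i)
    then show ?case using m by (auto simp: tableaux_def not_le)
  next
    case (2 i k i')
    then have "(k, j) \<in> boxes" using boxes_column[of i j i' k] by simp
    then show ?case using 2 by (meson less_trans)
  qed
  then show "m \<in> SSYT boxes" using m by (simp add: SSYT_def tableaux_def)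
qed (auto simp: SSYT_def tableaux_def not_le)

theorem schur_qsym_Rim_H:
  assumes a: "\<And>c. 1 \<le> a c" and \<delta>: "\<And>b. b \<in> boxes \<Longrightarrow> \<delta> b = a (content b)"
  shows "schur_qsym boxes \<delta> =
    (\<Sum>\<Theta> \<in> Rim_H r \<kappa> \<tau>. of_int (sign_H r \<kappa> \<tau> \<Theta>) * (\<Prod>i \<in> {1..r}. E (read_up \<delta> (\<Theta> i))))"
proof -
  have "schur_qsym boxes \<delta> = monomial_sum (tableaux (\<le>) boxes) (weight \<delta> boxes)"
    unfolding schur_qsym_def tableaux_le weight_def ..
  also have "\<dots> = (\<Sum>\<Theta> \<in> Rim_H r \<kappa> \<tau>. of_int (sign_H r \<kappa> \<tau> \<Theta>) * (\<Prod>i \<in> {1..r}. E (read_up \<delta> (\<Theta> i))))"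
    unfolding E_chain_sum by (rule rim_expansion[symmetric, where a = a]) (use a \<delta> in auto)
  finally show ?thesis .
qed

end

section \<open>Transposition\<close>

definition transpose_boxes :: "box set \<Rightarrow> box set" where
  "transpose_boxes D = prod.swap ` D"

lemma mem_transpose_boxes [simp]: "(i, j) \<in> transpose_boxes D \<longleftrightarrow> (j, i) \<in> D"
  by (auto simp: transpose_boxes_def intro!: image_eqI[of _ _ "(j, i)"])

lemma transpose_boxes_involution [simp]: "transpose_boxes (transpose_boxes D) = D"
  by (auto simp: transpose_boxes_def image_image)

lemma transpose_boxes_empty [simp]: "transpose_boxes D = {} \<longleftrightarrow> D = {}"
  by (simp add: transpose_boxes_def)

lemma transpose_boxes_Diff: "transpose_boxes (A - B) = transpose_boxes A - transpose_boxes B"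
  by auto

lemma transpose_boxes_mono: "A \<subseteq> B \<Longrightarrow> transpose_boxes A \<subseteq> transpose_boxes B"
  by (auto simp: transpose_boxes_def)

lemma card_transpose_boxes: "card (transpose_boxes D) = card D"
  unfolding transpose_boxes_def by (rule card_image) simp

lemma transpose_partition:
  assumes "is_partition \<rho>"
  shows "\<exists>\<rho>'. is_partition \<rho>' \<and> diagram \<rho>' = transpose_boxes (diagram \<rho>)"
proof (rule partition_of_lower_closed)
  show "finite (transpose_boxes (diagram \<rho>))" by (simp add: transpose_boxes_def finite_diagram)
  show "transpose_boxes (diagram \<rho>) \<subseteq> {1..} \<times> {1..}" using diagram_rows by fastforce
  show "lower_closed (transpose_boxes (diagram \<rho>))"
    using lower_closedD[OF lower_closed_diagram[OF assms]] unfolding lower_closed_def mem_transpose_boxes by blast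
qed

lemma transpose_skew_diagram:
  assumes "skew_diagram \<theta>"
  shows "skew_diagram (transpose_boxes \<theta>)"
proof -
  obtain lam mu where lm: "is_partition lam" "is_partition mu" "diagram mu \<subseteq> diagram lam" "\<theta> = diagram lam - diagram mu"
    using assms by (auto simp: skew_diagram_def)
  obtain lam' where l: "is_partition lam'" "diagram lam' = transpose_boxes (diagram lam)" using transpose_partition[OF lm(1)] by blast
  obtain mu' where m: "is_partition mu'" "diagram mu' = transpose_boxes (diagram mu)" using transpose_partition[OF lm(2)] by blast
  show ?thesis unfolding skew_diagram_def
    using l m lm(3,4) transpose_boxes_mono[OF lm(3)] transpose_boxes_Diff by (intro exI[of _ lam'] exI[of _ mu']) simp
qed

lemma adjacent_swap: "adjacent (prod.swap p) (prod.swap q) \<longleftrightarrow> adjacent p q"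
  by (auto simp: adjacent_def case_prod_unfold)

lemma transpose_connected:
  assumes "box_connected \<theta>"
  shows "box_connected (transpose_boxes \<theta>)"
proof -
  let ?R = "\<lambda>\<theta>. {(x, y). x \<in> \<theta> \<and> y \<in> \<theta> \<and> adjacent x y}"
  have path: "(prod.swap p, prod.swap q) \<in> (?R (transpose_boxes \<theta>))\<^sup>*" if "(p, q) \<in> (?R \<theta>)\<^sup>*" for p q
    using that
  proof (induction rule: rtrancl_induct)
    case (step q q')
    then have "(prod.swap q, prod.swap q') \<in> ?R (transpose_boxes \<theta>)"
      by (auto simp: adjacent_swap transpose_boxes_def)
    then show ?case by (rule rtrancl_into_rtrancl[OF step.IH])
  qed simp
  show ?thesis unfolding box_connected_def
  proof (intro ballI)
    fix p q assume "p \<in> transpose_boxes \<theta>" "q \<in> transpose_boxes \<theta>"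
    then obtain p' q' where "p' \<in> \<theta>" "q' \<in> \<theta>" "p = prod.swap p'" "q = prod.swap q'" by (auto simp: transpose_boxes_def)
    then show "(p, q) \<in> (?R (transpose_boxes \<theta>))\<^sup>*" using path assms unfolding box_connected_def by blast
  qed
qed

lemma transpose_ribbon:
  assumes "ribbon \<theta>"
  shows "ribbon (transpose_boxes \<theta>)"
  unfolding ribbon_def
proof (intro conjI notI)
  show "skew_diagram (transpose_boxes \<theta>)" "box_connected (transpose_boxes \<theta>)" 
    using assms transpose_skew_diagram transpose_connected by (auto simp: ribbon_def)
  show "transpose_boxes \<theta> = {} \<Longrightarrow> False" using assms by (simp add: ribbon_def)
  assume "\<exists>i j. {(i, j), (i, j + 1), (i + 1, j), (i + 1, j + 1)} \<subseteq> transpose_boxes \<theta>"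
  then obtain i j where "{(j, i), (j, i + 1), (j + 1, i), (j + 1, i + 1)} \<subseteq> \<theta>" by auto
  then show False using assms unfolding ribbon_def by blast
qed

lemma transpose_bottom_left_end:
  "bottom_left_end (transpose_boxes \<theta>) (j, i) \<longleftrightarrow> top_right_end \<theta> (i, j)"
  by (fastforce simp: bottom_left_end_def top_right_end_def)

definition transpose_seq :: "nat \<Rightarrow> (nat \<Rightarrow> box set) \<Rightarrow> nat \<Rightarrow> box set" where
  "transpose_seq n \<Theta> = (\<lambda>k \<in> {1..n}. transpose_boxes (\<Theta> k))"

lemma transpose_rim_sequences:
  assumes \<Theta>: "\<Theta> \<in> rim_sequences P n \<kappa> \<tau>"
    and \<kappa>': "diagram \<kappa>' = transpose_boxes (diagram \<kappa>)" and \<tau>': "diagram \<tau>' = transpose_boxes (diagram \<tau>)"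
    and P: "\<And>k \<theta>. k \<in> {1..n} \<Longrightarrow> P k \<theta> \<Longrightarrow> P' k (transpose_boxes \<theta>)"
  shows "transpose_seq n \<Theta> \<in> rim_sequences P' n \<kappa>' \<tau>'"
proof -
  have ext: "\<Theta> \<in> {1..n} \<rightarrow>\<^sub>E Pow (diagram \<kappa> - diagram \<tau>)"
    and rib: "\<And>k. k \<in> {1..n} \<Longrightarrow> \<Theta> k = {} \<or> ribbon (\<Theta> k) \<and> P k (\<Theta> k)"
    and disj: "disjoint_family_on \<Theta> {1..n}"
    and part: "\<And>k. k \<in> {1..n} \<Longrightarrow> \<exists>\<rho>. is_partition \<rho> \<and> diagram \<tau> \<union> (\<Union>l \<in> {1..k}. \<Theta> l) = diagram \<rho>"
    and all: "diagram \<tau> \<union> (\<Union>l \<in> {1..n}. \<Theta> l) = diagram \<kappa>"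
    using \<Theta> unfolding rim_sequences_def mem_Collect_eq by simp_all
  have at: "transpose_seq n \<Theta> k = transpose_boxes (\<Theta> k)" if "k \<in> {1..n}" for k
    using that by (simp add: transpose_seq_def)
  have un: "diagram \<tau>' \<union> (\<Union>l \<in> {1..k}. transpose_seq n \<Theta> l) = transpose_boxes (diagram \<tau> \<union> (\<Union>l \<in> {1..k}. \<Theta> l))"
    if "k \<le> n" for k
  proof -
    have "(\<Union>l \<in> {1..k}. transpose_seq n \<Theta> l) = (\<Union>l \<in> {1..k}. transpose_boxes (\<Theta> l))"
      using that at by (intro SUP_cong) auto
    then show ?thesis unfolding \<tau>' by (simp add: transpose_boxes_def image_Un image_UN)
  qed
  show ?thesis unfolding rim_sequences_def
  proof (intro CollectI conjI ballI)
    show "transpose_seq n \<Theta> \<in> {1..n} \<rightarrow>\<^sub>E Pow (diagram \<kappa>' - diagram \<tau>')"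
    proof
      fix k assume k: "k \<in> {1..n}"
      have "\<Theta> k \<subseteq> diagram \<kappa> - diagram \<tau>" using PiE_mem[OF ext k] by blast
      then show "transpose_seq n \<Theta> k \<in> Pow (diagram \<kappa>' - diagram \<tau>')"
        unfolding at[OF k] \<kappa>' \<tau>' transpose_boxes_Diff[symmetric] by (intro PowI transpose_boxes_mono)
    qed (simp only: transpose_seq_def restrict_def if_False)
    show "transpose_seq n \<Theta> k = {} \<or> ribbon (transpose_seq n \<Theta> k) \<and> P' k (transpose_seq n \<Theta> k)" if "k \<in> {1..n}" for k
      unfolding at[OF that] transpose_boxes_empty using rib[OF that] P[OF that] transpose_ribbon by blast
    show "disjoint_family_on (transpose_seq n \<Theta>) {1..n}"
      unfolding disjoint_family_on_def
    proof (intro ballI impI)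
      fix k l assume kl: "k \<in> {1..n}" "l \<in> {1..n}" "k \<noteq> l"
      then have "\<Theta> k \<inter> \<Theta> l = {}" using disj unfolding disjoint_family_on_def by blast
      then show "transpose_seq n \<Theta> k \<inter> transpose_seq n \<Theta> l = {}"
        unfolding at[OF kl(1)] at[OF kl(2)] by auto
    qed
    show "\<exists>\<rho>. is_partition \<rho> \<and> diagram \<tau>' \<union> (\<Union>l \<in> {1..k}. transpose_seq n \<Theta> l) = diagram \<rho>" if k: "k \<in> {1..n}" for k
    proof -
      obtain \<rho> where \<rho>: "is_partition \<rho>" "diagram \<tau> \<union> (\<Union>l \<in> {1..k}. \<Theta> l) = diagram \<rho>" using part[OF k] by blast
      have "k \<le> n" using k by simp
      show ?thesis unfolding un[OF \<open>k \<le> n\<close>] \<rho>(2) using transpose_partition[OF \<rho>(1)] by metis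
    qed
    show "diagram \<tau>' \<union> (\<Union>l \<in> {1..n}. transpose_seq n \<Theta> l) = diagram \<kappa>'"
      unfolding un[OF order_refl] all \<kappa>' ..
  qed
qed

lemma transpose_seq_involution:
  assumes "\<Theta> \<in> rim_sequences P n \<kappa> \<tau>"
  shows "transpose_seq n (transpose_seq n \<Theta>) = \<Theta>"
proof
  fix k
  have ext: "\<Theta> \<in> {1..n} \<rightarrow>\<^sub>E Pow (diagram \<kappa> - diagram \<tau>)" using assms by (simp add: rim_sequences_def)
  show "transpose_seq n (transpose_seq n \<Theta>) k = \<Theta> k"
  proof (cases "k \<in> {1..n}")
    case False
    then show ?thesis using PiE_arb[OF ext False] by (simp only: transpose_seq_def restrict_def if_False)
  qed (simp add: transpose_seq_def)
qed

text \<open>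
  The conjugate partition, with the number of rows prescribed as \<open>s\<close>.
\<close>
definition conj_list :: "nat \<Rightarrow> nat list \<Rightarrow> nat list" where
  "conj_list s lam = map (conj_part lam) [1..<Suc s]"

lemma length_conj_list: "length (conj_list s lam) = s"
  by (simp add: conj_list_def del: upt_Suc)

lemma part_conj_list: "j \<in> {1..s} \<Longrightarrow> part (conj_list s lam) j = conj_part lam j"
proof -
  assume j: "j \<in> {1..s}"
  then have "j - 1 < s" by auto
  then have k: "j - 1 < length [1..<Suc s]" and nth: "[1..<Suc s] ! (j - 1) = j"
    using nth_upt[of 1 "j - 1" "Suc s"] j by (simp_all del: upt_Suc)
  have "conj_list s lam ! (j - 1) = conj_part lam j"
    unfolding conj_list_def nth_map[OF k] nth ..
  then show ?thesis using j by (simp add: part_def length_conj_list)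
qed

lemma conj_part_antimono: "j \<le> j' \<Longrightarrow> conj_part lam j' \<le> conj_part lam j"
  unfolding conj_part_def by (rule card_mono) auto

lemma is_partition_conj_list: "is_partition (conj_list s lam)"
  unfolding is_partition_def sorted_wrt_iff_nth_less length_conj_list
  by (auto simp: conj_list_def conj_part_antimono simp del: upt_Suc)

lemma conj_part_ge:
  assumes "is_partition lam" "1 \<le> i"
  shows "i \<le> conj_part lam j \<longleftrightarrow> i \<le> length lam \<and> j \<le> part lam i"
proof -
  let ?A = "{i \<in> {1..length lam}. j \<le> part lam i}"
  have "?A = {1..card ?A}"
  proof (rule initial_segment)
    fix i k assume ik: "i \<in> ?A" "1 \<le> k" "k \<le> i"
    then show "k \<in> ?A" using part_antimono[OF assms(1), of k i] by auto
  qed auto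
  then have "i \<in> ?A \<longleftrightarrow> i \<in> {1..conj_part lam j}" unfolding conj_part_def by (rule arg_cong)
  then show ?thesis using assms(2) by simp
qed

lemma diagram_conj_list:
  assumes lam: "is_partition lam" and s: "part lam 1 \<le> s"
  shows "diagram (conj_list s lam) = transpose_boxes (diagram lam)"
proof (rule set_eqI)
  fix b :: box obtain j i where b: "b = (j, i)" by (cases b)
  have "b \<in> diagram (conj_list s lam) \<longleftrightarrow> j \<in> {1..s} \<and> 1 \<le> i \<and> i \<le> conj_part lam j"
    using diagram_rows[of j i "conj_list s lam"] part_conj_list[of j s lam]
    by (auto simp: b diagram_def length_conj_list)
  also have "\<dots> \<longleftrightarrow> j \<in> {1..s} \<and> 1 \<le> i \<and> i \<le> length lam \<and> j \<le> part lam i"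
    using conj_part_ge[OF lam] by blast
  also have "\<dots> \<longleftrightarrow> (i, j) \<in> diagram lam"
  proof
    assume "(i, j) \<in> diagram lam"
    then have d: "1 \<le> i" "i \<le> length lam" "1 \<le> j" "j \<le> part lam i" using diagram_rows by blast+
    moreover have "part lam i \<le> s" using part_antimono[OF lam, of 1 i] s d(1) by simp
    ultimately show "j \<in> {1..s} \<and> 1 \<le> i \<and> i \<le> length lam \<and> j \<le> part lam i" by simp
  qed (simp add: diagram_def)
  finally show "b \<in> diagram (conj_list s lam) \<longleftrightarrow> b \<in> transpose_boxes (diagram lam)" by (simp add: b)
qed

lemma content_swap: "content (prod.swap b) = - content b"
  by (simp add: content_def case_prod_unfold)

text \<open>
  Transposition negates contents and so reverses the reading order.
\<close>
lemma read_up_transpose: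
  assumes inj: "inj_on content \<theta>" and fin: "finite \<theta>"
  shows "read_up (\<lambda>b. \<delta> (prod.swap b)) (transpose_boxes \<theta>) = read_down \<delta> \<theta>"
proof -
  let ?L = "sorted_key_list_of_set content \<theta>" and ?L' = "sorted_key_list_of_set content (transpose_boxes \<theta>)"
  have inj': "inj_on content (transpose_boxes \<theta>)"
    unfolding transpose_boxes_def
    by (rule inj_on_imageI) (use inj in \<open>auto simp: inj_on_def content_swap\<close>)
  have fin': "finite (transpose_boxes \<theta>)" using fin by (simp add: transpose_boxes_def)
  have set: "set ?L = \<theta>" "set ?L' = transpose_boxes \<theta>"
    using set_sorted_key_list[OF inj fin] set_sorted_key_list[OF inj' fin'] by auto
  let ?K = "map prod.swap (rev ?L)"
  have K: "set ?K = transpose_boxes \<theta>" by (simp add: set transpose_boxes_def)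
  have "map content ?L' = map content ?K"
  proof (rule strict_sorted_equal)
    show "sorted_wrt (<) (map content ?L')" by (rule strict_sorted_key_list[OF inj' fin'])
    have "sorted_wrt (<) (map content ?L)" by (rule strict_sorted_key_list[OF inj fin])
    then show "sorted_wrt (<) (map content ?K)"
      by (simp add: sorted_wrt_map sorted_wrt_rev content_swap)
    show "set (map content ?L') = set (map content ?K)" using set K by (metis set_map)
  qed
  moreover have "inj_on content (set ?L' \<union> set ?K)" unfolding K set using inj' by simp
  ultimately have "?L' = ?K" by (rule map_inj_on)
  then show ?thesis by (simp add: read_up_def read_down_def rev_map)
qed

lemma schur_qsym_weight: "schur_qsym \<nu> \<delta> = monomial_sum (SSYT \<nu>) (weight \<delta> \<nu>)"
  unfolding schur_qsym_def weight_def ..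

lemma schur_qsym_transpose:
  assumes skew: "skew_diagram \<nu>"
  shows "schur_qsym \<nu> \<delta> =
    monomial_sum (tableaux (<) (transpose_boxes \<nu>)) (weight (\<lambda>b. \<delta> (prod.swap b)) (transpose_boxes \<nu>))"
proof -
  obtain lam mu where lm: "is_partition lam" "is_partition mu" "\<nu> = diagram lam - diagram mu"
    using skew by (auto simp: skew_diagram_def)
  have convex: "(i, k) \<in> \<nu>" if "(i, j) \<in> \<nu>" "(i, j') \<in> \<nu>" "j \<le> k" "k \<le> j'" for i j j' k
    using lower_closedD[OF lower_closed_diagram[OF lm(1)], of i j' i k]
      lower_closedD[OF lower_closed_diagram[OF lm(2)], of i k i j] diagram_rows[of i j lam] that lm(3) by auto
  have "monomial_sum (tableaux (<) (transpose_boxes \<nu>)) (weight (\<lambda>b. \<delta> (prod.swap b)) (transpose_boxes \<nu>)) =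
      monomial_sum (SSYT \<nu>) (weight \<delta> \<nu>)"
  proof (rule monomial_sum_transport)
    show "bij_betw prod.swap \<nu> (transpose_boxes \<nu>)" by (simp add: bij_betw_def transpose_boxes_def)
    show "tableaux (<) (transpose_boxes \<nu>) \<subseteq> transpose_boxes \<nu> \<rightarrow>\<^sub>E {1..}" "SSYT \<nu> \<subseteq> \<nu> \<rightarrow>\<^sub>E {1..}"
      by (auto simp: tableaux_def SSYT_def fillings_def)
    fix m :: "box \<Rightarrow> nat" assume m: "m \<in> transpose_boxes \<nu> \<rightarrow>\<^sub>E {1..}"
    let ?n = "\<lambda>b\<in>\<nu>. m (prod.swap b)"
    have n: "?n \<in> fillings \<nu>"
      unfolding fillings_def
    proof
      fix b assume b: "b \<in> \<nu>"
      then have "prod.swap b \<in> transpose_boxes \<nu>" by (simp add: transpose_boxes_def)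
      then show "?n b \<in> {1..}" using m b by auto
    qed simp
    show "?n \<in> SSYT \<nu> \<longleftrightarrow> m \<in> tableaux (<) (transpose_boxes \<nu>)"
    proof
      assume t: "m \<in> tableaux (<) (transpose_boxes \<nu>)"
      have "m (j, i) \<le> m (j', i)" if "j < j'" "(i, j) \<in> \<nu>" "(i, j') \<in> \<nu>" for i j j'
        using that
      proof (induction j' rule: less_Suc_induct)
        case (1 j)
        then show ?case using t by (auto simp: tableaux_def not_less)
      next
        case (2 j k j')
        then have "(i, k) \<in> \<nu>" using convex[of i j j' k] by simp
        then show ?case using 2 by (meson order_trans)
      qed
      moreover have "m (j, i) < m (j, i')" if "i < i'" "(i, j) \<in> \<nu>" "(i', j) \<in> \<nu>" for i i' j
        using t that unfolding tableaux_def by simp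
      ultimately show "?n \<in> SSYT \<nu>" using n by (simp add: SSYT_def)
    next
      assume "?n \<in> SSYT \<nu>"
      then show "m \<in> tableaux (<) (transpose_boxes \<nu>)"
        using m by (auto simp: SSYT_def tableaux_def fillings_def not_less)
    qed
  qed simp
  then show ?thesis by (simp add: schur_qsym_weight)
qed

text \<open>
  Transposition turns the rim decompositions by columns into those by rows of the conjugate shape, and
  semistandard tableaux into tableaux with strict rows and weak columns.
\<close>
theorem (in skew_shape) schur_qsym_Rim_E:
  assumes s: "part \<kappa> 1 \<le> s" and a: "\<And>c. 1 \<le> a c" and \<delta>: "\<And>b. b \<in> boxes \<Longrightarrow> \<delta> b = a (content b)"
  shows "schur_qsym boxes \<delta> =
    (\<Sum>\<Theta> \<in> Rim_E s \<kappa> \<tau>. of_int (sign_E s \<kappa> \<tau> \<Theta>) * (\<Prod>i \<in> {1..s}. M (read_down \<delta> (\<Theta> i))))"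
proof -
  let ?\<kappa>' = "conj_list s \<kappa>" and ?\<tau>' = "conj_list s \<tau>" and ?\<delta>' = "\<lambda>b. \<delta> (prod.swap b)"
  have s': "part \<tau> 1 \<le> s" using part_le[of 1] s by simp
  have d: "diagram ?\<kappa>' = transpose_boxes (diagram \<kappa>)" "diagram ?\<tau>' = transpose_boxes (diagram \<tau>)"
    using diagram_conj_list[OF partitions(1) s] diagram_conj_list[OF partitions(2) s'] by auto
  interpret T: skew_shape s ?\<kappa>' ?\<tau>'
  proof
    show "diagram ?\<tau>' \<subseteq> diagram ?\<kappa>'" unfolding d by (rule transpose_boxes_mono[OF contained])
  qed (simp_all add: is_partition_conj_list length_conj_list)
  have Tboxes: "T.boxes = transpose_boxes boxes"
    unfolding T.boxes_def boxes_def d transpose_boxes_Diff ..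
  have skew: "skew_diagram boxes" unfolding skew_diagram_def boxes_def using partitions contained by blast
  have P: "bottom_left_end (transpose_boxes \<theta>) (k, part ?\<tau>' k + 1) \<longleftrightarrow> top_right_end \<theta> (conj_part \<tau> k + 1, k)"
    if "k \<in> {1..s}" for k \<theta>
    unfolding part_conj_list[OF that] transpose_bottom_left_end ..
  have d': "diagram \<kappa> = transpose_boxes (diagram ?\<kappa>')" "diagram \<tau> = transpose_boxes (diagram ?\<tau>')"
    unfolding d by simp_all
  have toH: "transpose_seq s \<Theta> \<in> Rim_H s ?\<kappa>' ?\<tau>'" if "\<Theta> \<in> Rim_E s \<kappa> \<tau>" for \<Theta>
    unfolding Rim_H_def by (rule transpose_rim_sequences[OF that[unfolded Rim_E_def] d]) (simp only: P)
  have toE: "transpose_seq s \<Theta> \<in> Rim_E s \<kappa> \<tau>" if "\<Theta> \<in> Rim_H s ?\<kappa>' ?\<tau>'" for \<Theta>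
    unfolding Rim_E_def
  proof (rule transpose_rim_sequences[OF that[unfolded Rim_H_def] d'])
    fix k \<theta> assume "k \<in> {1..s}" "bottom_left_end \<theta> (k, part ?\<tau>' k + 1)"
    then show "top_right_end (transpose_boxes \<theta>) (conj_part \<tau> k + 1, k)"
      using P[of k "transpose_boxes \<theta>"] by simp
  qed
  have sign: "sign_H s ?\<kappa>' ?\<tau>' (transpose_seq s \<Theta>) = sign_E s \<kappa> \<tau> \<Theta>" for \<Theta>
  proof -
    have "(\<forall>i\<in>{1..s}. int (card (transpose_seq s \<Theta> i)) = int (part ?\<kappa>' (\<sigma> i)) - int (\<sigma> i) - int (part ?\<tau>' i) + int i) \<longleftrightarrow>
       (\<forall>i\<in>{1..s}. int (card (\<Theta> i)) = int (conj_part \<kappa> (\<sigma> i)) - int (\<sigma> i) - int (conj_part \<tau> i) + int i)"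
      if "\<sigma> permutes {1..s}" for \<sigma>
    proof (rule ball_cong[OF refl])
      fix i assume i: "i \<in> {1..s}"
      then have "\<sigma> i \<in> {1..s}" using permutes_in_image[OF that] by blast
      then show "(int (card (transpose_seq s \<Theta> i)) = int (part ?\<kappa>' (\<sigma> i)) - int (\<sigma> i) - int (part ?\<tau>' i) + int i) \<longleftrightarrow>
        (int (card (\<Theta> i)) = int (conj_part \<kappa> (\<sigma> i)) - int (\<sigma> i) - int (conj_part \<tau> i) + int i)"
        using i by (simp add: part_conj_list transpose_seq_def card_transpose_boxes)
    qed
    then show ?thesis unfolding sign_H_def sign_E_def rim_sign_def by (metis (no_types, lifting))
  qed
  have read: "read_up ?\<delta>' (transpose_seq s \<Theta> i) = read_down \<delta> (\<Theta> i)"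
    if \<Theta>: "\<Theta> \<in> Rim_E s \<kappa> \<tau>" and i: "i \<in> {1..s}" for \<Theta> i
  proof -
    have sub: "\<Theta> i \<subseteq> diagram \<kappa>" and rib: "\<Theta> i = {} \<or> ribbon (\<Theta> i) \<and> top_right_end (\<Theta> i) (conj_part \<tau> i + 1, i)"
      using \<Theta> i unfolding Rim_E_def rim_sequences_def by (auto dest: PiE_mem)
    have fin: "finite (\<Theta> i)" using sub finite_diagram finite_subset by blast
    have "inj_on content (transpose_boxes (\<Theta> i))"
    proof (cases "\<Theta> i = {}")
      case False
      then have "ribbon (transpose_boxes (\<Theta> i))" "bottom_left_end (transpose_boxes (\<Theta> i)) (i, conj_part \<tau> i + 1)"
        using rib transpose_ribbon transpose_bottom_left_end by blast+
      then show ?thesis by (rule ribbon_contents(1))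
    qed (simp add: transpose_boxes_def)
    then have inj: "inj_on content (prod.swap ` \<Theta> i)" by (simp add: transpose_boxes_def)
    have "inj_on content (\<Theta> i)"
    proof (rule inj_onI)
      fix p q assume "p \<in> \<Theta> i" "q \<in> \<Theta> i" "content p = content q"
      then have "prod.swap p = prod.swap q" by (intro inj_onD[OF inj]) (simp_all add: content_swap)
      then show "p = q" by (metis swap_swap)
    qed
    then show ?thesis using read_up_transpose[OF _ fin, of \<delta>] i by (simp add: transpose_seq_def)
  qed
  have "schur_qsym boxes \<delta> = monomial_sum (tableaux (<) (transpose_boxes boxes)) (weight ?\<delta>' (transpose_boxes boxes))"
    by (rule schur_qsym_transpose[OF skew])
  also have "\<dots> = (\<Sum>\<Theta> \<in> Rim_H s ?\<kappa>' ?\<tau>'. of_int (sign_H s ?\<kappa>' ?\<tau>' \<Theta>) *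
      (\<Prod>i \<in> {1..s}. chain_sum (<) (read_up ?\<delta>' (\<Theta> i))))"
    unfolding Tboxes[symmetric]
  proof (rule T.rim_expansion[symmetric, where a = "\<lambda>c. a (- c)"])
    fix b assume "b \<in> T.boxes"
    then have "prod.swap b \<in> boxes" unfolding Tboxes by (cases b) simp
    then show "?\<delta>' b = a (- content b)" using \<delta> by (simp add: content_swap)
  qed (use a in auto)
  also have "\<dots> = (\<Sum>\<Theta> \<in> Rim_E s \<kappa> \<tau>. of_int (sign_E s \<kappa> \<tau> \<Theta>) * (\<Prod>i \<in> {1..s}. M (read_down \<delta> (\<Theta> i))))"
  proof (rule sum.reindex_bij_witness[of _ "transpose_seq s" "transpose_seq s"])
    fix \<Theta> assume \<Theta>: "\<Theta> \<in> Rim_H s ?\<kappa>' ?\<tau>'"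
    show inv: "transpose_seq s (transpose_seq s \<Theta>) = \<Theta>" using transpose_seq_involution \<Theta> unfolding Rim_H_def by blast
    show "transpose_seq s \<Theta> \<in> Rim_E s \<kappa> \<tau>" by (rule toE[OF \<Theta>])
    show "of_int (sign_E s \<kappa> \<tau> (transpose_seq s \<Theta>)) * (\<Prod>i \<in> {1..s}. M (read_down \<delta> (transpose_seq s \<Theta> i))) =
        of_int (sign_H s ?\<kappa>' ?\<tau>' \<Theta>) * (\<Prod>i \<in> {1..s}. chain_sum (<) (read_up ?\<delta>' (\<Theta> i)))"
      using read[OF toE[OF \<Theta>]] sign[of "transpose_seq s \<Theta>"] unfolding inv M_chain_sum by simp
  next
    fix \<Theta> assume \<Theta>: "\<Theta> \<in> Rim_E s \<kappa> \<tau>"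
    show "transpose_seq s (transpose_seq s \<Theta>) = \<Theta>" using transpose_seq_involution \<Theta> unfolding Rim_E_def by blast
    show "transpose_seq s \<Theta> \<in> Rim_H s ?\<kappa>' ?\<tau>'" by (rule toH[OF \<Theta>])
  qed
  finally show ?thesis .
qed

section \<open>The antipode of a Schur type function\<close>

text \<open>
  Anti-transposition exchanges rows and columns and reverses the order in both. It therefore turns the reversed inequalities, weak ones along columns and strict ones along rows, into
  those of semistandard tableaux.
\<close>
lemma antipode_schur_qsym:
  assumes \<gamma>: "\<gamma> \<in> fillings \<nu>" and \<nu>: "\<nu> \<subseteq> {1..R} \<times> {1..C}"
  shows "antipode (schur_qsym \<nu> \<gamma>) =
    (- 1) ^ card \<nu> * schur_qsym (anti_transpose R C \<nu>) (anti_filling R C \<nu> \<gamma>)"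
proof -
  let ?W = "\<lambda>b b' :: box. fst b = fst b' \<and> snd b < snd b'" and ?T = "\<lambda>b b' :: box. snd b = snd b' \<and> fst b < fst b'"
  let ?f = "\<lambda>(i, j). (C + 1 - j, R + 1 - i)" and ?g = "\<lambda>(a, b). (R + 1 - b, C + 1 - a)"
  let ?\<nu>' = "anti_transpose R C \<nu>"
  have fin: "finite \<nu>" using \<nu> by (rule finite_subset) simp
  have pos: "1 \<le> \<gamma> b" if "b \<in> \<nu>" for b using \<gamma> that by (auto simp: fillings_def)
  have \<nu>': "?\<nu>' = ?f ` \<nu>" by (simp add: anti_transpose_def)
  have gf: "?g (?f b) = b" if "b \<in> \<nu>" for b using \<nu> that by (cases b) auto
  have g: "?g p \<in> \<nu>" "?f (?g p) = p" if "p \<in> ?\<nu>'" for p using that gf unfolding \<nu>' by auto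
  have SSYT: "SSYT \<nu> = admissible ?W ?T \<nu>"
    unfolding SSYT_def admissible_def fillings_def by fastforce
  have schur: "schur_qsym \<nu> \<gamma> = filling_gf ?W ?T \<gamma> \<nu>"
    unfolding schur_qsym_weight filling_gf_def SSYT ..
  have "antipode (schur_qsym \<nu> \<gamma>) = (- 1) ^ card \<nu> * filling_gf (\<lambda>b b'. ?T b' b) (\<lambda>b b'. ?W b' b) \<gamma> \<nu>"
    unfolding schur by (rule antipode_filling_gf[where h = content, OF fin pos]) (auto simp: content_def)
  also have "filling_gf (\<lambda>b b'. ?T b' b) (\<lambda>b b'. ?W b' b) \<gamma> \<nu> =
      monomial_sum (SSYT ?\<nu>') (weight (anti_filling R C \<nu> \<gamma>) ?\<nu>')"
    unfolding filling_gf_def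
  proof (rule monomial_sum_transport)
    let ?A = "admissible (\<lambda>b b'. ?T b' b) (\<lambda>b b'. ?W b' b) \<nu>"
    have f: "?f b \<in> ?\<nu>'" if "b \<in> \<nu>" for b using that unfolding \<nu>' by (rule imageI)
    show "bij_betw ?g ?\<nu>' \<nu>"
      by (rule bij_betw_byWitness[where f' = ?f]) (use f g gf in blast)+
    show "?A \<subseteq> \<nu> \<rightarrow>\<^sub>E {1..}" "SSYT ?\<nu>' \<subseteq> ?\<nu>' \<rightarrow>\<^sub>E {1..}"
      by (auto simp: admissible_def SSYT_def fillings_def)
    show "\<gamma> (?g p) = anti_filling R C \<nu> \<gamma> p" if "p \<in> ?\<nu>'" for p
      using that by (simp add: anti_filling_def case_prod_unfold)
    fix m :: "box \<Rightarrow> nat" assume m: "m \<in> \<nu> \<rightarrow>\<^sub>E {1..}"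
    let ?n = "\<lambda>p \<in> ?\<nu>'. m (?g p)"
    have n: "?n \<in> fillings ?\<nu>'"
      unfolding fillings_def
    proof
      fix p assume p: "p \<in> ?\<nu>'"
      then show "?n p \<in> {1..}" using PiE_mem[OF m g(1)[OF p]] by simp
    qed simp
    show "?n \<in> SSYT ?\<nu>' \<longleftrightarrow> m \<in> ?A"
    proof
      assume A: "m \<in> ?A"
      have bound: "b \<le> R \<and> a \<le> C" if p: "(a, b) \<in> ?\<nu>'" for a b
      proof -
        obtain i j where ij: "(i, j) \<in> \<nu>" "a = C + 1 - j" "b = R + 1 - i" using p unfolding \<nu>' by auto
        then have "1 \<le> i" "1 \<le> j" using \<nu> by auto
        then show ?thesis using ij by linarith
      qed
      have row: "m (?g (a, b)) \<le> m (?g (a, b'))" if p: "(a, b) \<in> ?\<nu>'" "(a, b') \<in> ?\<nu>'" "b < b'" for a b b'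
      proof -
        have "?T (?g (a, b')) (?g (a, b))" using p(3) bound[OF p(2)] by auto
        then show ?thesis using A g(1)[OF p(1)] g(1)[OF p(2)] unfolding admissible_def by blast
      qed
      have col: "m (?g (a, b)) < m (?g (a', b))" if p: "(a, b) \<in> ?\<nu>'" "(a', b) \<in> ?\<nu>'" "a < a'" for a a' b
      proof -
        have "?W (?g (a', b)) (?g (a, b))" using p(3) bound[OF p(2)] by auto
        then show ?thesis using A g(1)[OF p(1)] g(1)[OF p(2)] unfolding admissible_def by blast
      qed
      show "?n \<in> SSYT ?\<nu>'" unfolding SSYT_def using n row col by simp
    next
      assume S: "?n \<in> SSYT ?\<nu>'"
      have nf: "?n (?f b) = m b" if "b \<in> \<nu>" for b using f[OF that] gf[OF that] by (simp only: restrict_def if_True)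
      have "m b \<le> m b'" if b: "b \<in> \<nu>" "b' \<in> \<nu>" "?T b' b" for b b'
      proof -
        obtain i j i' where b': "b = (i, j)" "b' = (i', j)" "i' < i" using b(3) by (cases b, cases b') auto
        have "i \<le> R" using b(1) b' \<nu> by auto
        then have "R + 1 - i < R + 1 - i'" using b' by simp
        then have "?n (?f b) \<le> ?n (?f b')"
          using S f[OF b(1)] f[OF b(2)] unfolding SSYT_def b' prod.case by blast
        then show ?thesis unfolding nf[OF b(1)] nf[OF b(2)] .
      qed
      moreover have "m b < m b'" if b: "b \<in> \<nu>" "b' \<in> \<nu>" "?W b' b" for b b'
      proof -
        obtain i j j' where b': "b = (i, j)" "b' = (i, j')" "j' < j" using b(3) by (cases b, cases b') auto
        have "j \<le> C" using b(1) b' \<nu> by auto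
        then have "C + 1 - j < C + 1 - j'" using b' by simp
        then have "?n (?f b) < ?n (?f b')"
          using S f[OF b(1)] f[OF b(2)] unfolding SSYT_def b' prod.case by blast
        then show ?thesis unfolding nf[OF b(1)] nf[OF b(2)] .
      qed
      ultimately show "m \<in> ?A" using m unfolding admissible_def by blast
    qed
  qed
  finally show ?thesis by (simp add: schur_qsym_weight)
qed

text \<open>
  A diagonal filling is a function of the content. Contents without a box get the exponent 1, as
  exponents have to be positive.
\<close>
lemma anti_filling_content:
  assumes \<gamma>: "\<gamma> \<in> diag_fillings \<nu>" and \<nu>: "\<nu> \<subseteq> {1..R} \<times> {1..C}"
  obtains a where "\<And>c. 1 \<le> a c" "\<And>p. p \<in> anti_transpose R C \<nu> \<Longrightarrow> anti_filling R C \<nu> \<gamma> p = a (content p)"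
proof -
  let ?\<nu>' = "anti_transpose R C \<nu>"
  have ex: "\<exists>b \<in> \<nu>. anti_filling R C \<nu> \<gamma> p = \<gamma> b \<and> content b = content p + int C - int R" if p: "p \<in> ?\<nu>'" for p
  proof -
    obtain i j where ij: "(i, j) \<in> \<nu>" "p = (C + 1 - j, R + 1 - i)" using p by (auto simp: anti_transpose_def)
    have b: "1 \<le> i" "i \<le> R" "1 \<le> j" "j \<le> C" using \<nu> ij(1) by auto
    have "anti_filling R C \<nu> \<gamma> p = \<gamma> (i, j)" using p b by (simp add: anti_filling_def ij(2))
    moreover have "content (i, j) = content p + int C - int R" using b by (simp add: content_def ij(2) of_nat_diff)
    ultimately show ?thesis using ij(1) by blast
  qed
  have "\<gamma> \<in> fillings \<nu>" using \<gamma> by (simp add: diag_fillings_def)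
  then have pos: "1 \<le> \<gamma> b" if "b \<in> \<nu>" for b using that by (auto simp: fillings_def)
  \<comment> \<open>Anti-transposition shifts all contents by \<open>R - C\<close>.\<close>
  define a where "a = (\<lambda>c. if \<exists>b \<in> \<nu>. content b = c + int C - int R then \<gamma> (SOME b. b \<in> \<nu> \<and> content b = c + int C - int R) else 1)"
  have some: "(SOME b. b \<in> \<nu> \<and> content b = c) \<in> \<nu> \<and> content (SOME b. b \<in> \<nu> \<and> content b = c) = c"
    if "b \<in> \<nu>" "content b = c" for b c
    by (rule someI[where P = "\<lambda>b. b \<in> \<nu> \<and> content b = c"]) (use that in simp)
  show ?thesis
  proof
    show "1 \<le> a c" for c
    proof (cases "\<exists>b \<in> \<nu>. content b = c + int C - int R")
      case True
      then obtain b where b: "b \<in> \<nu>" "content b = c + int C - int R" by blast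
      show ?thesis unfolding a_def if_P[OF True] using some[OF b] by (intro pos) blast
    qed (simp add: a_def)
    fix p assume "p \<in> ?\<nu>'"
    then obtain b where b: "b \<in> \<nu>" "anti_filling R C \<nu> \<gamma> p = \<gamma> b" "content b = content p + int C - int R" using ex by blast
    then have ex: "\<exists>b \<in> \<nu>. content b = content p + int C - int R" by blast
    have "a (content p) = \<gamma> (SOME b. b \<in> \<nu> \<and> content b = content p + int C - int R)"
      unfolding a_def if_P[OF ex] ..
    also have "\<dots> = \<gamma> b"
      using some[OF b(1,3)] b(1,3) \<gamma> unfolding diag_fillings_def mem_Collect_eq by metis
    finally show "anti_filling R C \<nu> \<gamma> p = a (content p)" using b(2) by simp
  qed
qed

theorem theorem5p9:
  fixes \<nu> :: "box set" and \<gamma> :: "box \<Rightarrow> nat" and R C :: nat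
  assumes "skew_diagram \<nu>"
    and "\<gamma> \<in> fillings \<nu>"
    and "\<nu> \<subseteq> {1..R} \<times> {1..C}"
  shows "antipode (schur_qsym \<nu> \<gamma>) =
           (- 1) ^ card \<nu> * schur_qsym (anti_transpose R C \<nu>) (anti_filling R C \<nu> \<gamma>) \<and>
         (\<gamma> \<in> diag_fillings \<nu> \<longrightarrow>
           (\<forall>(\<kappa> :: nat list) (\<tau> :: nat list) (r :: nat) (s :: nat).
              is_partition \<kappa> \<and> is_partition \<tau> \<and> length \<kappa> = r \<and> length \<tau> = r \<and> part \<kappa> 1 \<le> s \<and>
              diagram \<tau> \<subseteq> diagram \<kappa> \<and> anti_transpose R C \<nu> = diagram \<kappa> - diagram \<tau> \<longrightarrow>
              antipode (schur_qsym \<nu> \<gamma>) =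
                (- 1) ^ card \<nu> *
                (\<Sum>\<Theta> \<in> Rim_H r \<kappa> \<tau>. of_int (sign_H r \<kappa> \<tau> \<Theta>) *
                   (\<Prod>i \<in> {1..r}. E (read_up (anti_filling R C \<nu> \<gamma>) (\<Theta> i)))) \<and>
              antipode (schur_qsym \<nu> \<gamma>) =
                (- 1) ^ card \<nu> *
                (\<Sum>\<Theta> \<in> Rim_E s \<kappa> \<tau>. of_int (sign_E s \<kappa> \<tau> \<Theta>) *
                   (\<Prod>i \<in> {1..s}. M (read_down (anti_filling R C \<nu> \<gamma>) (\<Theta> i))))))"
proof (intro conjI impI allI)
  show anti: "antipode (schur_qsym \<nu> \<gamma>) =
      (- 1) ^ card \<nu> * schur_qsym (anti_transpose R C \<nu>) (anti_filling R C \<nu> \<gamma>)"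
    by (rule antipode_schur_qsym[OF assms(2,3)])
  fix \<kappa> \<tau> :: "nat list" and r s :: nat
  assume diag: "\<gamma> \<in> diag_fillings \<nu>"
    and shape: "is_partition \<kappa> \<and> is_partition \<tau> \<and> length \<kappa> = r \<and> length \<tau> = r \<and> part \<kappa> 1 \<le> s \<and>
      diagram \<tau> \<subseteq> diagram \<kappa> \<and> anti_transpose R C \<nu> = diagram \<kappa> - diagram \<tau>"
  interpret skew_shape r \<kappa> \<tau> by unfold_locales (use shape in auto)
  have boxes: "anti_transpose R C \<nu> = boxes" using shape by (simp add: boxes_def)
  obtain a where a: "\<And>c. 1 \<le> a c" and \<delta>: "\<And>p. p \<in> boxes \<Longrightarrow> anti_filling R C \<nu> \<gamma> p = a (content p)"
    using anti_filling_content[OF diag assms(3)] unfolding boxes by metis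
  show "antipode (schur_qsym \<nu> \<gamma>) = (- 1) ^ card \<nu> *
      (\<Sum>\<Theta> \<in> Rim_H r \<kappa> \<tau>. of_int (sign_H r \<kappa> \<tau> \<Theta>) * (\<Prod>i \<in> {1..r}. E (read_up (anti_filling R C \<nu> \<gamma>) (\<Theta> i))))"
    unfolding anti boxes using schur_qsym_Rim_H[where a = a] a \<delta> by simp
  show "antipode (schur_qsym \<nu> \<gamma>) = (- 1) ^ card \<nu> *
      (\<Sum>\<Theta> \<in> Rim_E s \<kappa> \<tau>. of_int (sign_E s \<kappa> \<tau> \<Theta>) * (\<Prod>i \<in> {1..s}. M (read_down (anti_filling R C \<nu> \<gamma>) (\<Theta> i))))"
    unfolding anti boxes using schur_qsym_Rim_E[where a = a and s = s] a \<delta> shape by simp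
qed

end
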